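(* Let $X\subset\mathbb{R}^m$, $Y\subset\mathbb{R}^n$, $\Xi\subset\mathbb{R}^p$ be open, and let $H_1\in\mathcal{G}_{L^2}(X\times\Xi)$ and $H_2\in\mathcal{G}_{L^2}(\Xi\times Y)$. Then $\widehat{H}_1\circ\widehat{H}_2:\mathcal{G}_{L^2}(Y)\to\mathcal{G}_{L^2}(X)$ is a generalized integral operator whose kernel is $L\in\mathcal{G}_{L^2}(X\times Y)$ defined by $$L=Cl\Big((x,y)\mapsto\int_\Xi H_{1,\varepsilon}(x,\xi)H_{2,\varepsilon}(\xi,y)\,\mathrm{d}\xi\Big)_\varepsilon,$$ where $(H_{1,\varepsilon})_\varepsilon$ (resp. $(H_{2,\varepsilon})_\varepsilon$) is a representative of $H_1$ (resp. $H_2$).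
   Context: For $\Omega\subset\mathbb{R}^d$ open, $H^\infty(\Omega)=\bigcap_m H^m(\Omega)$ with the norms $\|f\|'_m=\sum_{|\alpha|\le m}\|\partial^\alpha f\|_{L^2(\Omega)}$, $m\ge0$; its elements are taken as smooth functions. $\mathcal{E}_{L^2}(\Omega)$ is the set of nets $(u_\varepsilon)_{\varepsilon\in(0,1]}$ in $H^\infty(\Omega)$ such that for every $m$ there is $n\in\mathbb{N}$ with $\|u_\varepsilon\|'_m=O(\varepsilon^{-n})$ as $\varepsilon\to0$; $\mathcal{I}_{L^2}(\Omega)$ is the set of nets such that for all $m$ and all $n\in\mathbb{N}$, $\|u_\varepsilon\|'_m=O(\varepsilon^{n})$. $\mathcal{G}_{L^2}(\Omega)=\mathcal{E}_{L^2}(\Omega)/\mathcal{I}_{L^2}(\Omega)$, and $Cl$ denotes the class of a net. For $H=Cl(H_\varepsilon)_\varepsilon\in\mathcal{G}_{L^2}(X\times Y)$, the generalized integral operator with kernel $H$ is $\widehat H:\mathcal{G}_{L^2}(Y)\to\mathcal{G}_{L^2}(X)$, $\widehat H(f)=Cl\big(x\mapsto\int_Y H_\varepsilon(x,y)f_\varepsilon(y)\,\mathrm{d}y\big)_\varepsilon$ for $f=Cl(f_\varepsilon)_\varepsilon$; it is well defined, independently of representatives. *)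

theory Defs
  imports "HOL-Analysis.Analysis" "HOL-Library.Landau_Symbols"
begin

text \<open>
  Functions on an open set \<open>\<Omega>\<close> are total functions whose values outside \<open>\<Omega>\<close> are irrelevant, and
  nets \<open>(u\<^sub>\<epsilon>)\<close>, \<open>\<epsilon> \<in> (0,1]\<close>, are total in \<open>\<epsilon>\<close>, with irrelevant values outside \<open>(0,1]\<close>. Two nets which
  agree on \<open>\<Omega>\<close> for all \<open>\<epsilon> \<in> (0,1]\<close> differ by a negligible net, so these junk values disappear in
  the quotient \<open>G_L2\<close>.
\<close>

definition partial_deriv ::
  "'a::euclidean_space \<Rightarrow> ('a \<Rightarrow> complex) \<Rightarrow> 'a \<Rightarrow> complex" where
  "partial_deriv b f x = vector_derivative (\<lambda>t::real. f (x + t *\<^sub>R b)) (at 0)"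

primrec Ck_on :: "nat \<Rightarrow> 'a::euclidean_space set \<Rightarrow> ('a \<Rightarrow> complex) \<Rightarrow> bool" where
  "Ck_on 0 \<Omega> f \<longleftrightarrow> continuous_on \<Omega> f"
| "Ck_on (Suc k) \<Omega> f \<longleftrightarrow>
     f differentiable_on \<Omega> \<and> (\<forall>b\<in>Basis. Ck_on k \<Omega> (partial_deriv b f))"

definition smooth_on :: "'a::euclidean_space set \<Rightarrow> ('a \<Rightarrow> complex) \<Rightarrow> bool" where
  "smooth_on \<Omega> f \<longleftrightarrow> (\<forall>k. Ck_on k \<Omega> f)"

definition multi_indices :: "nat \<Rightarrow> ('a::euclidean_space \<Rightarrow> nat) set" where
  "multi_indices m = {\<alpha>. (\<forall>b. b \<notin> Basis \<longrightarrow> \<alpha> b = 0) \<and> (\<Sum>b\<in>Basis. \<alpha> b) \<le> m}"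

lemma finite_multi_indices: "finite (multi_indices m :: ('a::euclidean_space \<Rightarrow> nat) set)"
proof (rule finite_subset)
  have "\<alpha> b \<le> m" if "(\<Sum>b\<in>Basis. \<alpha> b) \<le> m" "b \<in> Basis" for \<alpha> :: "'a \<Rightarrow> nat" and b
    using member_le_sum[of b Basis \<alpha>] that by simp
  then show "multi_indices m \<subseteq>
      {\<alpha>::'a \<Rightarrow> nat. \<forall>b. (b \<in> Basis \<longrightarrow> \<alpha> b \<in> {..m}) \<and> (b \<notin> Basis \<longrightarrow> \<alpha> b = 0)}"
    unfolding multi_indices_def by blast
qed (rule finite_set_of_finite_funs, simp_all)

text \<open>
  \<open>\<partial>\<^sup>\<alpha> f\<close>, the partial derivatives being taken in an arbitrary but fixed order of the coordinates;
  on smooth functions the order is immaterial.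
\<close>

definition basis_list :: "'a::euclidean_space list" where
  "basis_list = (SOME bs. distinct bs \<and> set bs = Basis)"

definition multi_deriv ::
  "('a::euclidean_space \<Rightarrow> nat) \<Rightarrow> ('a \<Rightarrow> complex) \<Rightarrow> 'a \<Rightarrow> complex" where
  "multi_deriv \<alpha> f = foldr (\<lambda>b. partial_deriv b ^^ \<alpha> b) basis_list f"

definition L2_on :: "'a::euclidean_space set \<Rightarrow> ('a \<Rightarrow> complex) set" where
  "L2_on \<Omega> = {f. set_borel_measurable lborel \<Omega> f \<and>
                 set_integrable lborel \<Omega> (\<lambda>x. (norm (f x))\<^sup>2)}"

definition L2_norm_on :: "'a::euclidean_space set \<Rightarrow> ('a \<Rightarrow> complex) \<Rightarrow> real" where
  "L2_norm_on \<Omega> f = sqrt (LINT x:\<Omega>|lborel. (norm (f x))\<^sup>2)"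

text \<open>
  The elements of the Sobolev spaces are represented by smooth functions, whose weak derivatives are
  the classical ones.
\<close>

definition H_inf :: "'a::euclidean_space set \<Rightarrow> ('a \<Rightarrow> complex) set" where
  "H_inf \<Omega> = (\<Inter>m. {f. smooth_on \<Omega> f \<and> (\<forall>\<alpha>\<in>multi_indices m. multi_deriv \<alpha> f \<in> L2_on \<Omega>)})"

definition H_norm :: "nat \<Rightarrow> 'a::euclidean_space set \<Rightarrow> ('a \<Rightarrow> complex) \<Rightarrow> real" where
  "H_norm m \<Omega> f = (\<Sum>\<alpha>\<in>multi_indices m. L2_norm_on \<Omega> (multi_deriv \<alpha> f))"

type_synonym 'a net = "real \<Rightarrow> 'a \<Rightarrow> complex"

definition E_L2 :: "'a::euclidean_space set \<Rightarrow> 'a net set" where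
  "E_L2 \<Omega> = {u. (\<forall>\<epsilon>\<in>{0<..1}. u \<epsilon> \<in> H_inf \<Omega>) \<and>
     (\<forall>m. \<exists>n::nat. (\<lambda>\<epsilon>. H_norm m \<Omega> (u \<epsilon>)) \<in> O[at_right 0](\<lambda>\<epsilon>. \<epsilon> powi (- int n)))}"

definition I_L2 :: "'a::euclidean_space set \<Rightarrow> 'a net set" where
  "I_L2 \<Omega> = {u. (\<forall>\<epsilon>\<in>{0<..1}. u \<epsilon> \<in> H_inf \<Omega>) \<and>
     (\<forall>m. \<forall>n::nat. (\<lambda>\<epsilon>. H_norm m \<Omega> (u \<epsilon>)) \<in> O[at_right 0](\<lambda>\<epsilon>. \<epsilon> ^ n))}"

definition L2_rel :: "'a::euclidean_space set \<Rightarrow> ('a net \<times> 'a net) set" where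
  "L2_rel \<Omega> = {(u, v). u \<in> E_L2 \<Omega> \<and> v \<in> E_L2 \<Omega> \<and> (\<lambda>\<epsilon> x. u \<epsilon> x - v \<epsilon> x) \<in> I_L2 \<Omega>}"

definition G_L2 :: "'a::euclidean_space set \<Rightarrow> 'a net set set" where
  "G_L2 \<Omega> = E_L2 \<Omega> // L2_rel \<Omega>"

definition Cl :: "'a::euclidean_space set \<Rightarrow> 'a net \<Rightarrow> 'a net set" where
  "Cl \<Omega> u = L2_rel \<Omega> `` {u}"

text \<open>
  The operator on classes is lifted from representatives by a union over all of them, as for
  functions on quotients in \<^theory>\<open>HOL.Equiv_Relations\<close>; it is an extensional function on \<open>G_L2 Y\<close>.
\<close>

definition gen_int_op ::
  "'a::euclidean_space set \<Rightarrow> 'b::euclidean_space set \<Rightarrow> ('a \<times> 'b) net set \<Rightarrow>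
   'b net set \<Rightarrow> 'a net set" where
  "gen_int_op X Y H =
     (\<lambda>f\<in>G_L2 Y. \<Union>h\<in>H. \<Union>u\<in>f. Cl X (\<lambda>\<epsilon> x. LINT y:Y|lborel. h \<epsilon> (x, y) * u \<epsilon> y))"

end

theory Submission
  imports Defs
begin

text \<open>
  A local Sobolev inequality, obtained by integrating the one-dimensional one along each coordinate
  axis, shows that a kernel \<open>h \<in> H_inf (X \<times> \<Xi>)\<close>, like each of its derivatives, satisfies \<open>\<bar>h (x, \<xi>)\<bar> \<le> G \<xi>\<close>
  with \<open>G\<close> square integrable, locally uniformly in \<open>x\<close>. Hence \<open>\<integral> h (x, \<xi>) u \<xi> d\<xi>\<close> and
  \<open>\<integral> h1 (x, \<xi>) h2 (\<xi>, y) d\<xi>\<close> exist at every point and may be differentiated under the integral sign;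
  by the Cauchy-Schwarz inequality both are bilinear maps between the spaces \<open>H_inf\<close> which satisfy
  \<open>\<parallel>T f g\<parallel>\<^sub>m \<le> C \<parallel>f\<parallel>\<^sub>m \<parallel>g\<parallel>\<^sub>m\<close>. Such maps descend to the quotients \<open>G_L2\<close>, and on representatives the
  composition formula is Fubini's theorem.
\<close>

section \<open>Iterated partial derivatives of smooth functions\<close>

text \<open>Nothing is assumed about the boundaries of the open sets, so no global Sobolev embedding
  is available; the pointwise estimate is only local, with a constant that depends on the distance
  to the boundary. It is used qualitatively: a general L2 kernel has square integrable slices for
  almost every x only, whereas nets of smooth functions need the integral and its derivatives at
  every x. The quantitative bounds come from Cauchy-Schwarz alone; their constants depend on m and
  the dimension but not on \<epsilon>, which is what lets moderate and negligible growth pass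
  through. Derivatives in x fall on the kernel and never on the function that it is applied to, so
  the estimates use only the L2 norm of that function. The Sobolev norms are sums over multi-indices
  with a fixed order of the coordinates, whereas the inductions add one derivative at a time.
  Therefore derivatives are indexed by words of basis vectors, and the symmetry of second
  derivatives translates between the two.\<close>

lemma has_vector_derivative_line:
  fixes f :: "'a::euclidean_space \<Rightarrow> complex"
  assumes "(f has_derivative f') (at (x + t *\<^sub>R b))"
  shows "((\<lambda>t::real. f (x + t *\<^sub>R b)) has_vector_derivative f' b) (at t)"
proof -
  have "((\<lambda>t::real. x + t *\<^sub>R b) has_derivative (\<lambda>h. h *\<^sub>R b)) (at t)"
    by (auto intro!: derivative_eq_intros)
  from has_derivative_compose[OF this assms]
  show ?thesis
    by (simp add: has_vector_derivative_def linear_cmul[OF has_derivative_linear[OF assms]])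
qed

lemma partial_deriv_eq:
  fixes f :: "'a::euclidean_space \<Rightarrow> complex"
  assumes "(f has_derivative f') (at x)"
  shows "partial_deriv b f x = f' b"
  unfolding partial_deriv_def
  by (intro vector_derivative_at has_vector_derivative_line) (use assms in simp)

lemma has_vector_derivative_along_line:
  fixes f :: "'a::euclidean_space \<Rightarrow> complex"
  assumes "f differentiable at (x + t *\<^sub>R b)"
  shows "((\<lambda>t::real. f (x + t *\<^sub>R b)) has_vector_derivative partial_deriv b f (x + t *\<^sub>R b)) (at t)"
  using assms has_vector_derivative_line partial_deriv_eq by (metis differentiable_def)

text \<open>This expansion in coordinates is the link to differentiation under the integral sign,
  where the derivative is integrated coefficient by coefficient.\<close>

lemma has_derivative_partial_deriv:
  fixes f :: "'a::euclidean_space \<Rightarrow> complex"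
  assumes "f differentiable at x"
  shows "(f has_derivative (\<lambda>v. \<Sum>b\<in>Basis. (v \<bullet> b) *\<^sub>R partial_deriv b f x)) (at x)"
proof -
  obtain f' where f': "(f has_derivative f') (at x)"
    using assms by (auto simp: differentiable_def)
  interpret linear f'
    using f' has_derivative_linear by blast
  have "f' v = (\<Sum>b\<in>Basis. (v \<bullet> b) *\<^sub>R partial_deriv b f x)" for v
    by (subst euclidean_representation[of v, symmetric])
       (simp add: sum scale partial_deriv_eq[OF f'])
  then show ?thesis
    using f' by presburger
qed

text \<open>Since \<Omega> is open, a short piece of the line through x stays in \<Omega>, and only
  that piece matters for the derivative. Functions are total with arbitrary values off \<Omega>, so
  equalities are known on \<Omega> only and are carried through derivatives by this lemma.\<close>

lemma partial_deriv_cong: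
  assumes "open \<Omega>" "x \<in> \<Omega>" "\<And>x. x \<in> \<Omega> \<Longrightarrow> f x = g x"
  shows "partial_deriv b f x = partial_deriv b g x"
  unfolding partial_deriv_def
proof (rule vector_derivative_cong_eq)
  have "((\<lambda>t::real. x + t *\<^sub>R b) \<longlongrightarrow> x + 0 *\<^sub>R b) (nhds 0)"
    by (intro tendsto_intros) (simp add: filterlim_def)
  then have "eventually (\<lambda>t::real. x + t *\<^sub>R b \<in> \<Omega>) (nhds 0)"
    using assms(1,2) by (simp add: tendsto_def)
  then show "\<forall>\<^sub>F t in nhds 0. t \<in> UNIV \<longrightarrow> f (x + t *\<^sub>R b) = g (x + t *\<^sub>R b)"
    by eventually_elim (use assms(3) in auto)
qed (use assms in auto)

lemma differentiable_on_cong: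
  assumes "\<And>x. x \<in> \<Omega> \<Longrightarrow> f x = g x" "f differentiable_on \<Omega>"
  shows "g differentiable_on \<Omega>"
  using assms unfolding differentiable_on_def
  by (metis differentiable_transform_within zero_less_one)

lemma Ck_on_cong:
  assumes "open \<Omega>" "\<And>x. x \<in> \<Omega> \<Longrightarrow> f x = g x" "Ck_on k \<Omega> f"
  shows "Ck_on k \<Omega> g"
  using assms(2,3)
proof (induction k arbitrary: f g)
  case 0
  then show ?case by (simp cong: continuous_on_cong)
next
  case (Suc k)
  have "Ck_on k \<Omega> (partial_deriv b g)" if "b \<in> Basis" for b
    using Suc.prems that partial_deriv_cong[OF \<open>open \<Omega>\<close> _ Suc.prems(1)]
    by (intro Suc.IH[of "partial_deriv b f" "partial_deriv b g"]) auto
  moreover have "g differentiable_on \<Omega>"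
    using Suc.prems differentiable_on_cong[of \<Omega> f g] by auto
  ultimately show ?case
    by simp
qed

lemma smooth_on_cong:
  assumes "open \<Omega>" "\<And>x. x \<in> \<Omega> \<Longrightarrow> f x = g x" "smooth_on \<Omega> f"
  shows "smooth_on \<Omega> g"
  using assms Ck_on_cong[of \<Omega> f g] by (auto simp: smooth_on_def)

lemma smooth_on_unfold:
  "smooth_on \<Omega> f \<longleftrightarrow> f differentiable_on \<Omega> \<and> (\<forall>b\<in>Basis. smooth_on \<Omega> (partial_deriv b f))"
    (is "_ \<longleftrightarrow> ?R")
proof
  assume ?R
  then show "smooth_on \<Omega> f"
    unfolding smooth_on_def
    by (metis Ck_on.simps differentiable_imp_continuous_on old.nat.exhaust)
next
  assume *: "smooth_on \<Omega> f"
  then have "Ck_on (Suc k) \<Omega> f" for k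
    unfolding smooth_on_def by blast
  then show ?R
    by (auto simp: smooth_on_def)
qed

text \<open>Smoothness is the greatest property that implies differentiability and is inherited by
  partial derivatives. To prove it, one names a class \<open>P\<close> closed under partial
  derivatives up to equality on \<Omega>; the induction on the order is done here once. Below,
  \<open>P\<close> consists of differences, of slices, or of integrals with varying kernels.\<close>

lemma smooth_on_coinduct:
  assumes "P f" "open \<Omega>"
    and diff: "\<And>f. P f \<Longrightarrow> f differentiable_on \<Omega>"
    and step: "\<And>f b. P f \<Longrightarrow> b \<in> Basis \<Longrightarrow> \<exists>g. P g \<and> (\<forall>x\<in>\<Omega>. partial_deriv b f x = g x)"
  shows "smooth_on \<Omega> f"
proof -
  have "Ck_on k \<Omega> f" if "P f" for k f
    using that
  proof (induction k arbitrary: f)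
    case 0
    then show ?case
      using diff differentiable_imp_continuous_on by fastforce
  next
    case (Suc k)
    have "Ck_on k \<Omega> (partial_deriv b f)" if b: "b \<in> Basis" for b
    proof -
      obtain g where "P g" "\<forall>x\<in>\<Omega>. partial_deriv b f x = g x"
        using step[OF Suc.prems b] by blast
      then show ?thesis
        using Ck_on_cong[OF \<open>open \<Omega>\<close>, of g "partial_deriv b f" k] Suc.IH[of g] by auto
    qed
    then show ?case
      using diff[OF Suc.prems] by simp
  qed
  then show ?thesis
    using assms(1) by (auto simp: smooth_on_def)
qed

lemma smooth_on_partial_deriv:
  "smooth_on \<Omega> f \<Longrightarrow> b \<in> Basis \<Longrightarrow> smooth_on \<Omega> (partial_deriv b f)"
  using smooth_on_unfold by blast

lemma smooth_on_imp_differentiable: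
  "smooth_on \<Omega> f \<Longrightarrow> open \<Omega> \<Longrightarrow> x \<in> \<Omega> \<Longrightarrow> f differentiable at x"
  using smooth_on_unfold differentiable_on_eq_differentiable_at by blast

lemma smooth_on_imp_continuous_on: "smooth_on \<Omega> f \<Longrightarrow> continuous_on \<Omega> f"
  using smooth_on_unfold differentiable_imp_continuous_on by blast

text \<open>Schwarz's theorem, by integration. The increment f(x+sa+tb) - f(x+sa) is the integral of
  the b-derivative of f over a segment. Differentiating in s at 0 under the integral sign expresses
  the increment of the a-derivative from x to x+tb as an integral of the mixed derivative, and the
  derivative of this identity in t at 0 is the claim.\<close>

lemma partial_deriv_commute:
  fixes f :: "'a::euclidean_space \<Rightarrow> complex"
  assumes "open \<Omega>" "smooth_on \<Omega> f" "x \<in> \<Omega>" and a: "a \<in> Basis" and b: "b \<in> Basis"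
  shows "partial_deriv a (partial_deriv b f) x = partial_deriv b (partial_deriv a f) x"
proof -
  obtain e where e: "e > 0" "ball x e \<subseteq> \<Omega>"
    using assms open_contains_ball by blast
  \<comment> \<open>Both parameters are at most \<open>r\<close> in absolute value, so the
    displacement has norm at most 2e/3 < e.\<close>
  define r where "r = e / 3"
  have r: "r > 0"
    using e by (simp add: r_def)
  have in_\<Omega>: "x + s *\<^sub>R a + t *\<^sub>R b \<in> \<Omega>" if "\<bar>s\<bar> \<le> r" "\<bar>t\<bar> \<le> r" for s t
  proof -
    have "norm (s *\<^sub>R a + t *\<^sub>R b) \<le> \<bar>s\<bar> + \<bar>t\<bar>"
      using norm_triangle_ineq[of "s *\<^sub>R a" "t *\<^sub>R b"] a b by simp
    also have "\<dots> < e"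
      using that r unfolding r_def by linarith
    finally have "x + (s *\<^sub>R a + t *\<^sub>R b) \<in> ball x e"
      by (metis add_diff_cancel_left' dist_norm dist_commute mem_ball)
    then show ?thesis
      using e(2) by (auto simp: add.assoc)
  qed
  note sm = smooth_on_partial_deriv[OF assms(2)] smooth_on_partial_deriv[OF smooth_on_partial_deriv[OF assms(2)]]
  note diff = smooth_on_imp_differentiable[OF _ \<open>open \<Omega>\<close>]
  define \<phi> where "\<phi> \<tau> = partial_deriv a (partial_deriv b f) (x + \<tau> *\<^sub>R b)" for \<tau> :: real
  have cont2: "continuous_on \<Omega> (partial_deriv a (partial_deriv b f))"
    by (intro smooth_on_imp_continuous_on sm a b)
  have \<phi>_int: "partial_deriv a f (x + t *\<^sub>R b) = partial_deriv a f x + integral {0..t} \<phi>"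
    if t: "t \<in> {0..r}" for t
  proof -
    let ?I = "\<lambda>s. integral {0..t} (\<lambda>\<tau>. partial_deriv b f (x + s *\<^sub>R a + \<tau> *\<^sub>R b))"
    have ftc: "((\<lambda>\<tau>. partial_deriv b f (x + s *\<^sub>R a + \<tau> *\<^sub>R b)) has_integral
        f (x + s *\<^sub>R a + t *\<^sub>R b) - f (x + s *\<^sub>R a + 0 *\<^sub>R b)) {0..t}" if "s \<in> {-r..r}" for s
    proof (rule fundamental_theorem_of_calculus)
      fix \<tau> assume "\<tau> \<in> {0..t}"
      then have "f differentiable at (x + s *\<^sub>R a + \<tau> *\<^sub>R b)"
        using that t by (intro diff[OF assms(2)] in_\<Omega>) auto
      then show "((\<lambda>\<tau>. f (x + s *\<^sub>R a + \<tau> *\<^sub>R b)) has_vector_derivative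
          partial_deriv b f (x + s *\<^sub>R a + \<tau> *\<^sub>R b)) (at \<tau> within {0..t})"
        by (intro has_vector_derivative_at_within[OF has_vector_derivative_along_line])
    qed (use t in auto)
    then have I_eq: "f (x + s *\<^sub>R a + t *\<^sub>R b) - f (x + s *\<^sub>R a) = ?I s" if "s \<in> {-r..r}" for s
      using integral_unique[OF ftc[OF that]] by simp
    have "(?I has_vector_derivative integral (cbox 0 t) (\<lambda>\<tau>. partial_deriv a (partial_deriv b f) (x + 0 *\<^sub>R a + \<tau> *\<^sub>R b)))
        (at 0 within {-r..r})"
      unfolding cbox_interval[symmetric]
    proof (rule leibniz_rule_vector_derivative)
      fix s \<tau> :: real assume s: "s \<in> cbox (-r) r" and \<tau>: "\<tau> \<in> cbox 0 t"
      then have "x + \<tau> *\<^sub>R b + s *\<^sub>R a \<in> \<Omega>"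
        using in_\<Omega>[of s \<tau>] t by (auto simp: ac_simps)
      from has_vector_derivative_along_line[OF diff[OF sm(1)[OF b] this]]
      show "((\<lambda>s. partial_deriv b f (x + s *\<^sub>R a + \<tau> *\<^sub>R b)) has_vector_derivative
          partial_deriv a (partial_deriv b f) (x + s *\<^sub>R a + \<tau> *\<^sub>R b)) (at s within cbox (-r) r)"
        by (simp only: add_ac has_vector_derivative_at_within)
    next
      fix s :: real assume s: "s \<in> cbox (-r) r"
      then show "(\<lambda>\<tau>. partial_deriv b f (x + s *\<^sub>R a + \<tau> *\<^sub>R b)) integrable_on cbox 0 t"
        using ftc[of s] by (auto simp: has_integral_integrable)
    next
      show "continuous_on (cbox (- r) r \<times> cbox 0 t)
          (\<lambda>(s, \<tau>). partial_deriv a (partial_deriv b f) (x + s *\<^sub>R a + \<tau> *\<^sub>R b))"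
        unfolding split_beta using t
        by (intro continuous_on_compose2[OF cont2] continuous_intros) (auto intro!: in_\<Omega>)
    qed (use r in auto)
    moreover have "at 0 within {-r..r} = at 0"
      by (rule at_within_Icc_at) (use r in auto)
    ultimately have "(?I has_vector_derivative integral {0..t} \<phi>) (at 0)"
      by (simp add: \<phi>_def[abs_def])
    moreover have "(?I has_vector_derivative (partial_deriv a f (x + t *\<^sub>R b) - partial_deriv a f x)) (at 0)"
    proof (rule has_vector_derivative_transform_within_open[of _ _ _ "{-r<..<r}"])
      show "((\<lambda>s. f (x + s *\<^sub>R a + t *\<^sub>R b) - f (x + s *\<^sub>R a)) has_vector_derivative
         (partial_deriv a f (x + t *\<^sub>R b) - partial_deriv a f x)) (at 0)"
        using has_vector_derivative_along_line[OF diff[OF assms(2)], of "x + t *\<^sub>R b" 0 a]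
          has_vector_derivative_along_line[OF diff[OF assms(2)], of x 0 a]
          in_\<Omega>[of 0 t] t r \<open>x \<in> \<Omega>\<close>
        by (intro has_vector_derivative_diff) (auto simp: add_ac)
    qed (use r I_eq in auto)
    ultimately show ?thesis
      using vector_derivative_unique_at by fastforce
  qed
  \<comment> \<open>The integral formula is available for t \<ge> 0 only, so the last derivative is
    one-sided; uniqueness of derivatives within a closed interval suffices.\<close>
  have "continuous_on {0..r} \<phi>"
    unfolding \<phi>_def using in_\<Omega>[of 0]
    by (intro continuous_on_compose2[OF cont2] continuous_intros) auto
  then have "((\<lambda>t. integral {0..t} \<phi>) has_vector_derivative \<phi> 0) (at 0 within {0..r})"
    using r by (intro integral_has_vector_derivative) auto
  then have "((\<lambda>t. partial_deriv a f x + integral {0..t} \<phi>) has_vector_derivative 0 + \<phi> 0) (at 0 within {0..r})"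
    by (intro has_vector_derivative_add has_vector_derivative_const)
  then have "((\<lambda>t. partial_deriv a f (x + t *\<^sub>R b)) has_vector_derivative \<phi> 0) (at 0 within {0..r})"
    using r \<phi>_int has_vector_derivative_transform[of 0 "{0..r}" "\<lambda>t. partial_deriv a f (x + t *\<^sub>R b)"
        "\<lambda>t. partial_deriv a f x + integral {0..t} \<phi>"] by simp
  moreover have "((\<lambda>t. partial_deriv a f (x + t *\<^sub>R b)) has_vector_derivative
      partial_deriv b (partial_deriv a f) (x + 0 *\<^sub>R b)) (at 0 within {0..r})"
    by (rule has_vector_derivative_at_within[OF has_vector_derivative_along_line[OF diff[OF sm(1)[OF a]]]])
       (use \<open>x \<in> \<Omega>\<close> in auto)
  ultimately show ?thesis
    using vector_derivative_unique_within_closed_interval[of 0 r 0] r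
    by (auto simp: \<phi>_def)
qed

text \<open>The head of the word is the outermost derivative. Words, unlike multi-indices, can be
  extended and split one letter at a time, which is what the inductions below need.\<close>

primrec partial_derivs :: "'a::euclidean_space list \<Rightarrow> ('a \<Rightarrow> complex) \<Rightarrow> 'a \<Rightarrow> complex" where
  "partial_derivs [] f = f"
| "partial_derivs (b # w) f = partial_deriv b (partial_derivs w f)"

lemma partial_derivs_append: "partial_derivs (v @ w) f = partial_derivs v (partial_derivs w f)"
  by (induction v) auto

lemma smooth_on_partial_derivs:
  "smooth_on \<Omega> f \<Longrightarrow> set w \<subseteq> Basis \<Longrightarrow> smooth_on \<Omega> (partial_derivs w f)"
  by (induction w) (auto simp: smooth_on_partial_deriv)

lemma partial_derivs_cong:
  assumes "open \<Omega>" "\<And>x. x \<in> \<Omega> \<Longrightarrow> f x = g x" "x \<in> \<Omega>"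
  shows "partial_derivs w f x = partial_derivs w g x"
  using assms(3)
proof (induction w arbitrary: x)
  case (Cons b w)
  have "partial_deriv b (partial_derivs w f) x = partial_deriv b (partial_derivs w g) x"
    using Cons by (intro partial_deriv_cong[OF assms(1)]) auto
  then show ?case
    by simp
qed (use assms(2) in simp)

text \<open>A letter moves to the front by one transposition per recursion step, each justified by
  the symmetry of second derivatives of the smooth function that the shorter word produces.\<close>

lemma partial_derivs_remove1:
  assumes "open \<Omega>" "smooth_on \<Omega> f" "set w \<subseteq> Basis" "b \<in> set w" "x \<in> \<Omega>"
  shows "partial_derivs w f x = partial_deriv b (partial_derivs (remove1 b w) f) x"
  using assms(3-5)
proof (induction w arbitrary: x)
  case (Cons c w)
  show ?case
  proof (cases "c = b")
    case False
    have sub: "set (remove1 b w) \<subseteq> Basis"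
      using Cons.prems set_remove1_subset[of b w] by auto
    have "partial_derivs (c # w) f x = partial_deriv c (partial_deriv b (partial_derivs (remove1 b w) f)) x"
      using Cons.IH Cons.prems False
      by (auto intro!: partial_deriv_cong[OF assms(1)])
    also have "\<dots> = partial_deriv b (partial_deriv c (partial_derivs (remove1 b w) f)) x"
      using Cons.prems sub
      by (intro partial_deriv_commute[OF assms(1) smooth_on_partial_derivs[OF assms(2)]]) auto
    finally show ?thesis
      using False by simp
  qed simp
qed simp

lemma partial_derivs_perm:
  assumes "open \<Omega>" "smooth_on \<Omega> f" "set w \<subseteq> Basis" "mset v = mset w" "x \<in> \<Omega>"
  shows "partial_derivs v f x = partial_derivs w f x"
  using assms(3-5)
proof (induction v arbitrary: w x)
  case (Cons b v)
  have b: "b \<in> set w"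
    using Cons.prems by (metis list.set_intros(1) mset_eq_setD)
  have "mset v = mset (remove1 b w)"
    using Cons.prems(2) by (simp flip: Cons.prems(2))
  moreover have "set (remove1 b w) \<subseteq> Basis"
    using Cons.prems set_remove1_subset[of b w] by auto
  ultimately have "partial_derivs v f y = partial_derivs (remove1 b w) f y" if "y \<in> \<Omega>" for y
    using Cons.IH that by blast
  then have "partial_deriv b (partial_derivs v f) x = partial_deriv b (partial_derivs (remove1 b w) f) x"
    by (rule partial_deriv_cong[OF assms(1) Cons.prems(3)])
  then show ?case
    using partial_derivs_remove1[OF assms(1,2) Cons.prems(1) b Cons.prems(3)] by simp
qed simp

section \<open>Words and multi-indices\<close>

lemma basis_list: "distinct (basis_list :: 'a::euclidean_space list)" "set (basis_list :: 'a list) = Basis"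
proof -
  have "\<exists>bs :: 'a list. distinct bs \<and> set bs = Basis"
    using finite_distinct_list[OF finite_Basis] by blast
  from someI_ex[OF this] show "distinct (basis_list :: 'a list)" "set (basis_list :: 'a list) = Basis"
    unfolding basis_list_def by auto
qed

text \<open>The normal form among the words with multiplicities \<alpha>: equal letters are grouped
  in the order of \<open>basis_list\<close>, exactly as \<open>multi_deriv\<close> applies
  them.\<close>

definition multi_word :: "('a::euclidean_space \<Rightarrow> nat) \<Rightarrow> 'a list" where
  "multi_word \<alpha> = concat (map (\<lambda>b. replicate (\<alpha> b) b) basis_list)"

lemma multi_deriv_eq: "multi_deriv \<alpha> f = partial_derivs (multi_word \<alpha>) f"
proof -
  have "partial_derivs (replicate n b) g = (partial_deriv b ^^ n) g" for n b and g :: "'a \<Rightarrow> complex"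
    by (induction n) auto
  then have "foldr (\<lambda>b. partial_deriv b ^^ \<alpha> b) bs f = partial_derivs (concat (map (\<lambda>b. replicate (\<alpha> b) b) bs)) f" for bs
    by (induction bs) (auto simp: partial_derivs_append)
  then show ?thesis
    by (simp add: multi_deriv_def multi_word_def)
qed

lemma set_multi_word: "set (multi_word \<alpha>) \<subseteq> Basis"
  by (auto simp: multi_word_def basis_list)

lemma length_multi_word: "length (multi_word \<alpha>) = (\<Sum>b\<in>Basis. \<alpha> b)"
  by (simp add: multi_word_def length_concat o_def sum_list_distinct_conv_sum_set[OF basis_list(1)] basis_list(2))

lemma count_multi_word: "b \<in> Basis \<Longrightarrow> count (mset (multi_word \<alpha>)) b = \<alpha> b"
proof -
  assume b: "b \<in> Basis"
  have "count (mset (concat (map (\<lambda>b. replicate (\<alpha> b) b) bs))) b = (if b \<in> set bs then \<alpha> b else 0)"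
    if "distinct bs" for bs
    using that by (induction bs) (auto simp: count_list_0_iff)
  then show ?thesis
    using b by (simp add: multi_word_def basis_list)
qed

text \<open>\<alpha> counts the letters of \<open>w\<close>, so \<open>w\<close> and
  \<open>multi_word \<alpha>\<close> are permutations of each other. Stated with
  \<open>obtains\<close> so that one \<alpha> serves all \<Omega> and f.\<close>

lemma partial_derivs_eq_multi_deriv:
  fixes w :: "'a::euclidean_space list"
  assumes "set w \<subseteq> Basis"
  obtains \<alpha> where "\<alpha> \<in> multi_indices (length w)"
    "\<And>\<Omega> f x. open \<Omega> \<Longrightarrow> smooth_on \<Omega> f \<Longrightarrow> x \<in> \<Omega> \<Longrightarrow> partial_derivs w f x = multi_deriv \<alpha> f x"
proof
  let ?\<alpha> = "count (mset w)"
  have "(\<Sum>b\<in>Basis. ?\<alpha> b) = size (mset w)"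
    unfolding size_multiset_overloaded_eq using assms
    by (intro sum.mono_neutral_right) auto
  then show "?\<alpha> \<in> multi_indices (length w)"
    using assms by (auto simp: multi_indices_def count_eq_zero_iff)
  have "count (mset w) b = count (mset (multi_word ?\<alpha>)) b" for b
    using count_multi_word[of b ?\<alpha>] assms set_multi_word[of ?\<alpha>]
    by (metis count_mset_0_iff subsetD)
  then have "mset w = mset (multi_word ?\<alpha>)"
    by (rule multiset_eqI)
  then show "partial_derivs w f x = multi_deriv ?\<alpha> f x"
    if "open \<Omega>" "smooth_on \<Omega> f" "x \<in> \<Omega>" for \<Omega> f x
    unfolding multi_deriv_eq using that partial_derivs_perm set_multi_word by blast
qed

section \<open>Square integrable functions and Sobolev norms\<close>

text \<open>Valued in \<open>ennreal\<close>, so that Tonelli's theorem and the Cauchy-Schwarz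
  inequality apply before any finiteness is known. The indicator inside the norm erases the values
  off \<Omega>, so that measurability is that of the function extended by zero.\<close>

definition L2_sq :: "'a::euclidean_space set \<Rightarrow> ('a \<Rightarrow> complex) \<Rightarrow> ennreal" where
  "L2_sq \<Omega> f = (\<integral>\<^sup>+x. ennreal ((norm (indicator \<Omega> x *\<^sub>R f x))\<^sup>2) \<partial>lborel)"

lemma L2_sq_cong: "\<forall>x\<in>\<Omega>. f x = g x \<Longrightarrow> L2_sq \<Omega> f = L2_sq \<Omega> g"
  unfolding L2_sq_def by (intro nn_integral_cong) (auto simp: indicator_def)

lemma L2_on_iff: "f \<in> L2_on \<Omega> \<longleftrightarrow> set_borel_measurable lborel \<Omega> f \<and> L2_sq \<Omega> f < \<infinity>"
proof (cases "set_borel_measurable lborel \<Omega> f")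
  case True
  have eq: "(\<lambda>x. indicator \<Omega> x *\<^sub>R (norm (f x))\<^sup>2) = (\<lambda>x. (norm (indicator \<Omega> x *\<^sub>R f x))\<^sup>2)"
    by (auto simp: indicator_def)
  have [measurable]: "(\<lambda>x. indicator \<Omega> x *\<^sub>R f x) \<in> borel_measurable lborel"
    using True by (simp add: set_borel_measurable_def)
  have m: "(\<lambda>x. (norm (indicator \<Omega> x *\<^sub>R f x))\<^sup>2) \<in> borel_measurable lborel"
    by (simp del: norm_scaleR)
  have "set_integrable lborel \<Omega> (\<lambda>x. (norm (f x))\<^sup>2) \<longleftrightarrow> integrable lborel (\<lambda>x. (norm (indicator \<Omega> x *\<^sub>R f x))\<^sup>2)"
    by (simp only: set_integrable_def eq)
  also have "\<dots> \<longleftrightarrow> L2_sq \<Omega> f < \<infinity>"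
    unfolding integrable_iff_bounded L2_sq_def using m by (simp del: norm_scaleR)
  finally show ?thesis
    using True by (simp add: L2_on_def)
qed (simp add: L2_on_def)

lemma L2_norm_on_nonneg: "0 \<le> L2_norm_on \<Omega> f"
  unfolding L2_norm_on_def set_lebesgue_integral_def
  by (auto intro!: Bochner_Integration.integral_nonneg)

lemma L2_sq_eq: "f \<in> L2_on \<Omega> \<Longrightarrow> L2_sq \<Omega> f = ennreal ((L2_norm_on \<Omega> f)\<^sup>2)"
proof -
  assume f: "f \<in> L2_on \<Omega>"
  have eq: "(\<lambda>x. indicator \<Omega> x *\<^sub>R (norm (f x))\<^sup>2) = (\<lambda>x. (norm (indicator \<Omega> x *\<^sub>R f x))\<^sup>2)"
    by (auto simp: indicator_def)
  have "integrable lborel (\<lambda>x. (norm (indicator \<Omega> x *\<^sub>R f x))\<^sup>2)"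
    using f by (simp only: L2_on_def set_integrable_def eq mem_Collect_eq)
  then have "L2_sq \<Omega> f = ennreal (LINT x|lborel. (norm (indicator \<Omega> x *\<^sub>R f x))\<^sup>2)"
    unfolding L2_sq_def by (intro nn_integral_eq_integral) auto
  moreover have "(LINT x:\<Omega>|lborel. (norm (f x))\<^sup>2) = (LINT x|lborel. (norm (indicator \<Omega> x *\<^sub>R f x))\<^sup>2)"
    by (simp only: set_lebesgue_integral_def eq)
  moreover have "0 \<le> (LINT x|lborel. (norm (indicator \<Omega> x *\<^sub>R f x))\<^sup>2)"
    by (rule Bochner_Integration.integral_nonneg) simp
  ultimately show ?thesis
    by (simp only: L2_norm_on_def real_sqrt_pow2)
qed

text \<open>How the estimates of integrals below end: a bound computed in \<open>ennreal\<close>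
  yields membership and the bound of the real norm together.\<close>

lemma L2_onI:
  assumes "set_borel_measurable lborel \<Omega> f" "L2_sq \<Omega> f \<le> ennreal (c\<^sup>2)" "0 \<le> c"
  shows "f \<in> L2_on \<Omega>" "L2_norm_on \<Omega> f \<le> c"
proof -
  show f: "f \<in> L2_on \<Omega>"
    using assms L2_on_iff[of f \<Omega>] by (auto simp: less_top[symmetric] top_unique)
  show "L2_norm_on \<Omega> f \<le> c"
  proof (rule power2_le_imp_le)
    have "ennreal ((L2_norm_on \<Omega> f)\<^sup>2) \<le> ennreal (c\<^sup>2)"
      using assms(2) unfolding L2_sq_eq[OF f] .
    then show "(L2_norm_on \<Omega> f)\<^sup>2 \<le> c\<^sup>2"
      by (subst (asm) ennreal_le_iff) auto
  qed fact
qed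

section \<open>The spaces \<open>H_inf\<close> described by words\<close>

lemma set_borel_measurable_smooth:
  assumes "open \<Omega>" "smooth_on \<Omega> f"
  shows "set_borel_measurable lborel \<Omega> f"
  unfolding set_borel_measurable_def
  using borel_measurable_continuous_on_indicator[OF _ smooth_on_imp_continuous_on[OF assms(2)]] assms(1)
  by simp

text \<open>The intersection over all m makes every multi-index available, hence every word. In this
  form closure under derivatives is immediate, since a derivative of f only appends an innermost
  letter to the word.\<close>

lemma H_inf_iff:
  assumes "open \<Omega>"
  shows "f \<in> H_inf \<Omega> \<longleftrightarrow>
    smooth_on \<Omega> f \<and> (\<forall>w. set w \<subseteq> Basis \<longrightarrow> partial_derivs w f \<in> L2_on \<Omega>)" (is "_ \<longleftrightarrow> ?R")
proof
  assume f: "f \<in> H_inf \<Omega>"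
  then have sm: "smooth_on \<Omega> f"
    by (auto simp: H_inf_def)
  have "partial_derivs w f \<in> L2_on \<Omega>" if w: "set w \<subseteq> Basis" for w
  proof -
    obtain \<alpha> where "\<alpha> \<in> multi_indices (length w)"
      and eq: "\<forall>x\<in>\<Omega>. partial_derivs w f x = multi_deriv \<alpha> f x"
      using partial_derivs_eq_multi_deriv[OF w] assms sm by metis
    then have "multi_deriv \<alpha> f \<in> L2_on \<Omega>"
      using f by (auto simp: H_inf_def)
    then show ?thesis
      using L2_sq_cong[OF eq] set_borel_measurable_smooth[OF assms smooth_on_partial_derivs[OF sm w]]
      by (simp add: L2_on_iff)
  qed
  with sm show ?R
    by blast
next
  assume ?R
  then show "f \<in> H_inf \<Omega>"
    by (auto simp: H_inf_def multi_deriv_eq set_multi_word)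
qed

lemma H_inf_smooth: "f \<in> H_inf \<Omega> \<Longrightarrow> smooth_on \<Omega> f"
  by (simp add: H_inf_def)

lemma H_inf_partial_deriv:
  assumes "open \<Omega>" "f \<in> H_inf \<Omega>" "b \<in> Basis"
  shows "partial_deriv b f \<in> H_inf \<Omega>"
proof -
  have "partial_derivs w (partial_deriv b f) \<in> L2_on \<Omega>" if "set w \<subseteq> Basis" for w
  proof -
    have "partial_derivs (w @ [b]) f \<in> L2_on \<Omega>"
      using assms that H_inf_iff[OF assms(1), of f] by auto
    then show ?thesis
      by (simp add: partial_derivs_append)
  qed
  then show ?thesis
    using smooth_on_partial_deriv[OF H_inf_smooth[OF assms(2)] assms(3)] by (simp add: H_inf_iff[OF assms(1)])
qed

lemma H_inf_partial_derivs:
  assumes "open \<Omega>" "f \<in> H_inf \<Omega>" "set w \<subseteq> Basis"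
  shows "partial_derivs w f \<in> H_inf \<Omega>"
  using assms(3) by (induction w) (auto simp: assms intro!: H_inf_partial_deriv)

lemma H_inf_L2: "f \<in> H_inf \<Omega> \<Longrightarrow> open \<Omega> \<Longrightarrow> f \<in> L2_on \<Omega>"
  using H_inf_iff[of \<Omega> f] by (auto dest: spec[of _ "[]"])

lemma L2_norm_on_cong: "\<forall>x\<in>\<Omega>. f x = g x \<Longrightarrow> L2_norm_on \<Omega> f = L2_norm_on \<Omega> g"
  unfolding L2_norm_on_def set_lebesgue_integral_def
  by (intro arg_cong[where f=sqrt] Bochner_Integration.integral_cong) (auto simp: indicator_def)

lemma L2_norm_partial_derivs_le:
  assumes "open \<Omega>" "f \<in> H_inf \<Omega>" "set w \<subseteq> Basis" "length w \<le> m"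
  shows "L2_norm_on \<Omega> (partial_derivs w f) \<le> H_norm m \<Omega> f"
proof -
  obtain \<alpha> where \<alpha>: "\<alpha> \<in> multi_indices (length w)"
    and eq: "\<forall>x\<in>\<Omega>. partial_derivs w f x = multi_deriv \<alpha> f x"
    using partial_derivs_eq_multi_deriv[OF assms(3)] assms(1) H_inf_smooth[OF assms(2)] by metis
  have "\<alpha> \<in> multi_indices m"
    using \<alpha> assms(4) by (auto simp: multi_indices_def)
  then have "L2_norm_on \<Omega> (multi_deriv \<alpha> f) \<le> H_norm m \<Omega> f"
    unfolding H_norm_def
    by (intro member_le_sum) (auto simp: L2_norm_on_nonneg finite_multi_indices)
  then show ?thesis
    using L2_norm_on_cong[OF eq] by simp
qed

lemma L2_norm_le_H_norm: "open \<Omega> \<Longrightarrow> f \<in> H_inf \<Omega> \<Longrightarrow> L2_norm_on \<Omega> f \<le> H_norm m \<Omega> f"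
  using L2_norm_partial_derivs_le[of \<Omega> f "[]" m] by simp

lemma H_norm_nonneg: "0 \<le> H_norm m \<Omega> f"
  unfolding H_norm_def by (intro sum_nonneg L2_norm_on_nonneg)

text \<open>Each summand of \<open>H_norm\<close> belongs to a word of length at most m. The price
  is the number of multi-indices, which is the origin of the constants in the norm bounds
  below.\<close>

lemma H_norm_le:
  fixes f :: "'a::euclidean_space \<Rightarrow> complex"
  assumes "\<And>w. set w \<subseteq> Basis \<Longrightarrow> length w \<le> m \<Longrightarrow> L2_norm_on \<Omega> (partial_derivs w f) \<le> c"
  shows "H_norm m \<Omega> f \<le> real (card (multi_indices m :: ('a \<Rightarrow> nat) set)) * c"
  unfolding H_norm_def
proof (rule sum_bounded_above)
  fix \<alpha> :: "'a \<Rightarrow> nat" assume "\<alpha> \<in> multi_indices m"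
  then have "length (multi_word \<alpha>) \<le> m"
    by (simp add: length_multi_word multi_indices_def)
  then show "L2_norm_on \<Omega> (multi_deriv \<alpha> f) \<le> c"
    unfolding multi_deriv_eq by (intro assms set_multi_word)
qed

lemma H_inf_cong:
  assumes "open \<Omega>" "\<And>x. x \<in> \<Omega> \<Longrightarrow> f x = g x" "f \<in> H_inf \<Omega>"
  shows "g \<in> H_inf \<Omega>"
proof -
  have sm: "smooth_on \<Omega> g"
    by (rule smooth_on_cong[OF assms(1,2) H_inf_smooth[OF assms(3)]])
  have "partial_derivs w g \<in> L2_on \<Omega>" if w: "set w \<subseteq> Basis" for w
  proof -
    have "L2_sq \<Omega> (partial_derivs w g) = L2_sq \<Omega> (partial_derivs w f)"
      by (rule L2_sq_cong) (simp add: partial_derivs_cong[OF assms(1,2)])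
    moreover have "partial_derivs w f \<in> L2_on \<Omega>"
      using assms(3) w by (simp add: H_inf_iff[OF assms(1)])
    ultimately show ?thesis
      using set_borel_measurable_smooth[OF assms(1) smooth_on_partial_derivs[OF sm w]]
      by (simp add: L2_on_iff)
  qed
  then show ?thesis
    using sm by (simp add: H_inf_iff[OF assms(1)])
qed

lemma H_norm_cong:
  assumes "open \<Omega>" "\<And>x. x \<in> \<Omega> \<Longrightarrow> f x = g x"
  shows "H_norm m \<Omega> f = H_norm m \<Omega> g"
  unfolding H_norm_def multi_deriv_eq
  by (intro sum.cong refl L2_norm_on_cong ballI partial_derivs_cong[OF assms])

section \<open>Differences of functions\<close>

lemma partial_deriv_diff:
  assumes "f differentiable at x" "g differentiable at x"
  shows "partial_deriv b (\<lambda>x. f x - g x) x = partial_deriv b f x - partial_deriv b g x"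
proof -
  obtain f' g' where *: "(f has_derivative f') (at x)" "(g has_derivative g') (at x)"
    using assms by (auto simp: differentiable_def)
  show ?thesis
    using partial_deriv_eq[OF has_derivative_diff[OF *]] *[THEN partial_deriv_eq] by simp
qed

lemma smooth_on_diff:
  assumes "open \<Omega>" "smooth_on \<Omega> f" "smooth_on \<Omega> g"
  shows "smooth_on \<Omega> (\<lambda>x. f x - g x)"
proof (rule smooth_on_coinduct[where P="\<lambda>u. \<exists>f g. smooth_on \<Omega> f \<and> smooth_on \<Omega> g \<and> u = (\<lambda>x. f x - g x)"])
  show "u differentiable_on \<Omega>"
    if u: "\<exists>f g. smooth_on \<Omega> f \<and> smooth_on \<Omega> g \<and> u = (\<lambda>x. f x - g x)" for u
    using u smooth_on_unfold by (auto intro!: differentiable_on_diff)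
  show "\<exists>v. (\<exists>f g. smooth_on \<Omega> f \<and> smooth_on \<Omega> g \<and> v = (\<lambda>x. f x - g x)) \<and> (\<forall>x\<in>\<Omega>. partial_deriv b u x = v x)"
    if u: "\<exists>f g. smooth_on \<Omega> f \<and> smooth_on \<Omega> g \<and> u = (\<lambda>x. f x - g x)" and b: "b \<in> Basis" for u b
  proof -
    obtain f g where fg: "smooth_on \<Omega> f" "smooth_on \<Omega> g" "u = (\<lambda>x. f x - g x)"
      using u by blast
    have "\<forall>x\<in>\<Omega>. partial_deriv b u x = partial_deriv b f x - partial_deriv b g x"
      unfolding fg(3) using fg(1,2) assms(1)
      by (intro ballI partial_deriv_diff smooth_on_imp_differentiable) auto
    then show ?thesis
      using smooth_on_partial_deriv[OF fg(1) b] smooth_on_partial_deriv[OF fg(2) b] by blast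
  qed
qed (use assms in auto)

lemma partial_derivs_diff:
  assumes "open \<Omega>" "smooth_on \<Omega> f" "smooth_on \<Omega> g" "set w \<subseteq> Basis" "x \<in> \<Omega>"
  shows "partial_derivs w (\<lambda>x. f x - g x) x = partial_derivs w f x - partial_derivs w g x"
  using assms(4,5)
proof (induction w arbitrary: x)
  case (Cons b w)
  have "partial_deriv b (partial_derivs w (\<lambda>x. f x - g x)) x =
      partial_deriv b (\<lambda>x. partial_derivs w f x - partial_derivs w g x) x"
    using Cons by (intro partial_deriv_cong[OF assms(1)]) auto
  also have "\<dots> = partial_deriv b (partial_derivs w f) x - partial_deriv b (partial_derivs w g) x"
    using Cons.prems assms
    by (intro partial_deriv_diff smooth_on_imp_differentiable[OF smooth_on_partial_derivs]) auto
  finally show ?case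
    by simp
qed simp

text \<open>Instead of Minkowski's inequality, |a - b|^2 \<le> 2|a|^2 + 2|b|^2 is integrated. The
  resulting constant 2 is not sharp, which is harmless because growth is measured up to
  constants.\<close>

lemma L2_diff:
  assumes "f \<in> L2_on \<Omega>" "g \<in> L2_on \<Omega>"
  shows "(\<lambda>x. f x - g x) \<in> L2_on \<Omega>"
    "L2_norm_on \<Omega> (\<lambda>x. f x - g x) \<le> 2 * (L2_norm_on \<Omega> f + L2_norm_on \<Omega> g)"
proof -
  let ?f = "\<lambda>x. indicator \<Omega> x *\<^sub>R f x" and ?g = "\<lambda>x. indicator \<Omega> x *\<^sub>R g x"
  have [measurable]: "?f \<in> borel_measurable lborel" "?g \<in> borel_measurable lborel"
    using assms by (auto simp: L2_on_iff set_borel_measurable_def)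
  have eq: "(\<lambda>x. indicator \<Omega> x *\<^sub>R (f x - g x)) = (\<lambda>x. ?f x - ?g x)"
    by (auto simp: indicator_def)
  have m: "set_borel_measurable lborel \<Omega> (\<lambda>x. f x - g x)"
    unfolding set_borel_measurable_def eq by measurable
  have pt: "(norm (a - b))\<^sup>2 \<le> 2 * (norm a)\<^sup>2 + 2 * (norm b)\<^sup>2" for a b :: complex
  proof -
    have "(norm (a - b))\<^sup>2 \<le> (norm a + norm b)\<^sup>2"
      by (intro power_mono norm_triangle_ineq4) auto
    also have "\<dots> \<le> 2 * (norm a)\<^sup>2 + 2 * (norm b)\<^sup>2"
      using sum_squares_bound[of "norm a" "norm b"] by (simp add: power2_sum)
    finally show ?thesis .
  qed
  have "L2_sq \<Omega> (\<lambda>x. f x - g x) \<le> (\<integral>\<^sup>+x. 2 * ennreal ((norm (?f x))\<^sup>2) + 2 * ennreal ((norm (?g x))\<^sup>2) \<partial>lborel)"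
    unfolding L2_sq_def
  proof (rule nn_integral_mono)
    fix x
    have "ennreal ((norm (indicator \<Omega> x *\<^sub>R (f x - g x)))\<^sup>2) \<le> ennreal (2 * (norm (?f x))\<^sup>2 + 2 * (norm (?g x))\<^sup>2)"
      using pt[of "?f x" "?g x"] by (intro ennreal_leI) (auto simp: indicator_def)
    also have "\<dots> = 2 * ennreal ((norm (?f x))\<^sup>2) + 2 * ennreal ((norm (?g x))\<^sup>2)"
      by (simp add: ennreal_plus ennreal_mult del: norm_scaleR)
    finally show "ennreal ((norm (indicator \<Omega> x *\<^sub>R (f x - g x)))\<^sup>2) \<le> \<dots>" .
  qed
  also have "\<dots> = 2 * L2_sq \<Omega> f + 2 * L2_sq \<Omega> g"
    unfolding L2_sq_def by (subst nn_integral_add) (simp_all add: nn_integral_cmult del: norm_scaleR)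
  also have "\<dots> = ennreal (2 * (L2_norm_on \<Omega> f)\<^sup>2 + 2 * (L2_norm_on \<Omega> g)\<^sup>2)"
    using assms by (simp add: L2_sq_eq ennreal_plus ennreal_mult)
  also have "\<dots> \<le> ennreal ((2 * (L2_norm_on \<Omega> f + L2_norm_on \<Omega> g))\<^sup>2)"
  proof (rule ennreal_leI)
    have "2 * s\<^sup>2 + 2 * t\<^sup>2 \<le> (2 * (s + t))\<^sup>2" if "0 \<le> s" "0 \<le> t" for s t :: real
      using that mult_nonneg_nonneg[OF that] by (simp add: power2_eq_square algebra_simps)
    then show "2 * (L2_norm_on \<Omega> f)\<^sup>2 + 2 * (L2_norm_on \<Omega> g)\<^sup>2 \<le> (2 * (L2_norm_on \<Omega> f + L2_norm_on \<Omega> g))\<^sup>2"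
      using L2_norm_on_nonneg by blast
  qed
  finally have le: "L2_sq \<Omega> (\<lambda>x. f x - g x) \<le> ennreal ((2 * (L2_norm_on \<Omega> f + L2_norm_on \<Omega> g))\<^sup>2)" .
  show "(\<lambda>x. f x - g x) \<in> L2_on \<Omega>"
    "L2_norm_on \<Omega> (\<lambda>x. f x - g x) \<le> 2 * (L2_norm_on \<Omega> f + L2_norm_on \<Omega> g)"
    using L2_onI[OF m le] L2_norm_on_nonneg[of \<Omega> f] L2_norm_on_nonneg[of \<Omega> g] by auto
qed

text \<open>Differences are the only linear operation treated: they give symmetry and transitivity
  of \<open>L2_rel\<close>, and bilinear maps are compared through them.\<close>

lemma H_inf_diff:
  fixes f :: "'a::euclidean_space \<Rightarrow> complex"
  assumes "open \<Omega>" "f \<in> H_inf \<Omega>" "g \<in> H_inf \<Omega>"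
  shows "(\<lambda>x. f x - g x) \<in> H_inf \<Omega>"
    "H_norm m \<Omega> (\<lambda>x. f x - g x) \<le>
      real (card (multi_indices m :: ('a \<Rightarrow> nat) set)) * (2 * (H_norm m \<Omega> f + H_norm m \<Omega> g))"
proof -
  note sm = H_inf_smooth[OF assms(2)] H_inf_smooth[OF assms(3)]
  have eq: "\<forall>x\<in>\<Omega>. partial_derivs w (\<lambda>x. f x - g x) x = partial_derivs w f x - partial_derivs w g x"
    if "set w \<subseteq> Basis" for w
    using partial_derivs_diff[OF assms(1) sm that] by blast
  have L2: "partial_derivs w f \<in> L2_on \<Omega>" "partial_derivs w g \<in> L2_on \<Omega>" if "set w \<subseteq> Basis" for w
    using assms that by (auto simp: H_inf_iff)
  have "partial_derivs w (\<lambda>x. f x - g x) \<in> L2_on \<Omega>" if w: "set w \<subseteq> Basis" for w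
    using L2_diff(1)[OF L2[OF w]] L2_sq_cong[OF eq[OF w]]
      set_borel_measurable_smooth[OF assms(1) smooth_on_partial_derivs[OF smooth_on_diff[OF assms(1) sm] w]]
    by (simp add: L2_on_iff)
  then show "(\<lambda>x. f x - g x) \<in> H_inf \<Omega>"
    using smooth_on_diff[OF assms(1) sm] by (simp add: H_inf_iff[OF assms(1)])
  show "H_norm m \<Omega> (\<lambda>x. f x - g x) \<le>
      real (card (multi_indices m :: ('a \<Rightarrow> nat) set)) * (2 * (H_norm m \<Omega> f + H_norm m \<Omega> g))"
  proof (rule H_norm_le)
    fix w :: "'a list" assume w: "set w \<subseteq> Basis" "length w \<le> m"
    have "L2_norm_on \<Omega> (partial_derivs w (\<lambda>x. f x - g x)) \<le>
        2 * (L2_norm_on \<Omega> (partial_derivs w f) + L2_norm_on \<Omega> (partial_derivs w g))"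
      using L2_diff(2)[OF L2[OF w(1)]] L2_norm_on_cong[OF eq[OF w(1)]] by simp
    also have "\<dots> \<le> 2 * (H_norm m \<Omega> f + H_norm m \<Omega> g)"
      using L2_norm_partial_derivs_le[OF assms(1,2) w] L2_norm_partial_derivs_le[OF assms(1,3) w] by simp
    finally show "L2_norm_on \<Omega> (partial_derivs w (\<lambda>x. f x - g x)) \<le> 2 * (H_norm m \<Omega> f + H_norm m \<Omega> g)" .
  qed
qed

section \<open>A pointwise Sobolev inequality\<close>

text \<open>For t in [0,r], |\<gamma>(0)|^2 is |\<gamma>(t)|^2 minus the integral of 2(\<gamma>
  \<bullet> \<gamma>') over [0,t], and the integrand is at most \<psi> = |\<gamma>|^2 +
  |\<gamma>'|^2 in absolute value. Hence |\<gamma>(0)|^2 is at most \<psi>(t) plus the integral of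
  \<psi> over [0,r]; averaging over t produces the constant 1/r + 1.\<close>

lemma interval_sobolev:
  fixes \<gamma> \<gamma>' :: "real \<Rightarrow> complex"
  assumes r: "r > 0"
    and der: "\<And>t. t \<in> {0..r} \<Longrightarrow> (\<gamma> has_vector_derivative \<gamma>' t) (at t within {0..r})"
    and cont: "continuous_on {0..r} \<gamma>'"
  shows "ennreal ((norm (\<gamma> 0))\<^sup>2) \<le>
    ennreal (1 / r + 1) * (\<integral>\<^sup>+t\<in>{0..r}. ennreal ((norm (\<gamma> t))\<^sup>2 + (norm (\<gamma>' t))\<^sup>2) \<partial>lborel)"
proof -
  define \<psi> where "\<psi> t = (norm (\<gamma> t))\<^sup>2 + (norm (\<gamma>' t))\<^sup>2" for t
  have cont\<gamma>: "continuous_on {0..r} \<gamma>"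
    unfolding continuous_on_eq_continuous_within using has_vector_derivative_continuous[OF der] by blast
  have cont\<psi>: "continuous_on {0..r} \<psi>"
    unfolding \<psi>_def by (intro continuous_intros cont cont\<gamma>)
  have int\<psi>: "\<psi> integrable_on {0..r}"
    by (intro integrable_continuous_real cont\<psi>)
  have \<psi>0: "0 \<le> \<psi> t" for t
    by (simp add: \<psi>_def)
  have step: "(norm (\<gamma> 0))\<^sup>2 - integral {0..r} \<psi> \<le> \<psi> t" if t: "t \<in> {0..r}" for t
  proof -
    have ftc: "((\<lambda>s. 2 * (\<gamma> s \<bullet> \<gamma>' s)) has_integral \<gamma> t \<bullet> \<gamma> t - \<gamma> 0 \<bullet> \<gamma> 0) {0..t}"
    proof (rule fundamental_theorem_of_calculus)
      fix s assume s: "s \<in> {0..t}"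
      have "(\<gamma> has_vector_derivative \<gamma>' s) (at s within {0..t})"
        using der[of s] s t by (auto intro: has_vector_derivative_within_subset)
      then have "(\<gamma> has_derivative (\<lambda>h. h *\<^sub>R \<gamma>' s)) (at s within {0..t})"
        by (simp add: has_vector_derivative_def)
      from has_derivative_inner[OF this this]
      show "((\<lambda>s. \<gamma> s \<bullet> \<gamma> s) has_vector_derivative 2 * (\<gamma> s \<bullet> \<gamma>' s)) (at s within {0..t})"
        by (simp add: has_vector_derivative_def inner_commute algebra_simps)
    qed (use t in auto)
    have "(\<psi> has_integral integral {0..t} \<psi>) {0..t}"
      using t by (intro integrable_integral integrable_continuous_real continuous_on_subset[OF cont\<psi>]) auto
    then have neg: "((\<lambda>s. - \<psi> s) has_integral - integral {0..t} \<psi>) {0..t}"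
      by (rule has_integral_neg)
    have bound: "- \<psi> s \<le> 2 * (\<gamma> s \<bullet> \<gamma>' s)" for s
    proof -
      have "\<bar>\<gamma> s \<bullet> \<gamma>' s\<bar> \<le> norm (\<gamma> s) * norm (\<gamma>' s)"
        by (rule Cauchy_Schwarz_ineq2)
      moreover have "2 * (norm (\<gamma> s) * norm (\<gamma>' s)) \<le> \<psi> s"
        using sum_squares_bound[of "norm (\<gamma> s)" "norm (\<gamma>' s)"] by (simp add: \<psi>_def)
      ultimately show ?thesis
        by linarith
    qed
    have "- integral {0..t} \<psi> \<le> \<gamma> t \<bullet> \<gamma> t - \<gamma> 0 \<bullet> \<gamma> 0"
      by (rule has_integral_le[OF neg ftc bound])
    moreover have "integral {0..t} \<psi> \<le> integral {0..r} \<psi>"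
      using t \<psi>0 by (intro integral_subset_le integrable_continuous_real continuous_on_subset[OF cont\<psi>]) auto
    ultimately have "(norm (\<gamma> 0))\<^sup>2 - integral {0..r} \<psi> \<le> (norm (\<gamma> t))\<^sup>2"
      by (simp add: power2_norm_eq_inner)
    then show ?thesis
      by (simp add: \<psi>_def add_increasing2)
  qed
  have "integral {0..r} (\<lambda>t. (norm (\<gamma> 0))\<^sup>2 - integral {0..r} \<psi>) \<le> integral {0..r} \<psi>"
    by (intro integral_le int\<psi> step integrable_const_ivl) auto
  then have "r * ((norm (\<gamma> 0))\<^sup>2 - integral {0..r} \<psi>) \<le> integral {0..r} \<psi>"
    using r by simp
  then have "(norm (\<gamma> 0))\<^sup>2 \<le> (1 / r + 1) * integral {0..r} \<psi>"
    using r by (simp add: field_simps)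
  then have "ennreal ((norm (\<gamma> 0))\<^sup>2) \<le> ennreal ((1 / r + 1) * integral {0..r} \<psi>)"
    by (rule ennreal_leI)
  also have "\<dots> = ennreal (1 / r + 1) * ennreal (integral {0..r} \<psi>)"
    using r by (intro ennreal_mult) (auto intro!: integral_nonneg int\<psi> \<psi>0)
  also have "ennreal (integral {0..r} \<psi>) = (\<integral>\<^sup>+t\<in>{0..r}. ennreal (\<psi> t) \<partial>lborel)"
  proof -
    have si: "set_integrable lborel {0..r} \<psi>"
      by (rule borel_integrable_atLeastAtMost'[OF cont\<psi>])
    have "(\<integral>\<^sup>+t\<in>{0..r}. ennreal (\<psi> t) \<partial>lborel) = (\<integral>\<^sup>+t. ennreal (indicator {0..r} t *\<^sub>R \<psi> t) \<partial>lborel)"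
      by (intro nn_integral_cong) (auto simp: indicator_def)
    also have "\<dots> = ennreal (LINT t|lborel. indicator {0..r} t *\<^sub>R \<psi> t)"
      using si \<psi>0 unfolding set_integrable_def
      by (intro nn_integral_eq_integral) (auto simp: indicator_def)
    finally show ?thesis
      using set_borel_integral_eq_integral(2)[OF si] by (simp add: set_lebesgue_integral_def)
  qed
  finally show ?thesis
    by (simp only: \<psi>_def)
qed

text \<open>Induction on the set of directions: a new direction b applies
  \<open>interval_sobolev\<close> along the lines parallel to b, at the cost of a factor 1/r + 1 and
  of a further word b # w for every word w. The constant and the words are chosen before \<Omega>, g
  and x, so that the estimate is uniform in them. The factor \<open>indicator \<Omega>\<close> makes
  the integrand measurable on the whole space.\<close>

lemma sobolev_directions:
  fixes I :: "'a::euclidean_space set"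
  assumes "finite I" "I \<subseteq> Basis" "r > 0"
  shows "\<exists>(c::real) (ws :: 'a list list). 0 \<le> c \<and> (\<forall>w\<in>set ws. set w \<subseteq> Basis) \<and>
    (\<forall>\<Omega> g x. open \<Omega> \<longrightarrow> smooth_on \<Omega> g \<longrightarrow>
      (\<forall>t. (\<forall>b\<in>I. t b \<in> {0..r}) \<longrightarrow> x + (\<Sum>b\<in>I. t b *\<^sub>R b) \<in> \<Omega>) \<longrightarrow>
      ennreal ((norm (g x))\<^sup>2) \<le> ennreal c * (\<Sum>w\<leftarrow>ws. \<integral>\<^sup>+t. (\<Prod>b\<in>I. indicator {0..r} (t b)) *
         ennreal ((norm (indicator \<Omega> (x + (\<Sum>b\<in>I. t b *\<^sub>R b)) *\<^sub>R partial_derivs w g (x + (\<Sum>b\<in>I. t b *\<^sub>R b))))\<^sup>2)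
         \<partial>(\<Pi>\<^sub>M b\<in>I. lborel)))"
  using assms(1,2)
proof (induction I rule: finite_induct)
  case empty
  interpret product_sigma_finite "\<lambda>b::'a. lborel :: real measure" ..
  \<comment> \<open>Without directions, the integral over the empty product is evaluation at one
    point, and the claim is an equality with constant 1 and the empty word.\<close>
  show ?case
    by (intro exI[of _ 1] exI[of _ "[[]]"]) (auto simp: PiM_empty emeasure_count_space_finite)
next
  case (insert b I)
  interpret product_sigma_finite "\<lambda>b::'a. lborel :: real measure" ..
  obtain c ws where c: "0 \<le> c" and ws: "\<forall>w\<in>set ws. set w \<subseteq> Basis"
    and IH: "\<And>\<Omega> g x. open \<Omega> \<Longrightarrow> smooth_on \<Omega> g \<Longrightarrow>
      (\<And>t. (\<forall>b\<in>I. t b \<in> {0..r}) \<Longrightarrow> x + (\<Sum>b\<in>I. t b *\<^sub>R b) \<in> \<Omega>) \<Longrightarrow>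
      ennreal ((norm (g x))\<^sup>2) \<le> ennreal c * (\<Sum>w\<leftarrow>ws. \<integral>\<^sup>+t. (\<Prod>b\<in>I. indicator {0..r} (t b)) *
         ennreal ((norm (indicator \<Omega> (x + (\<Sum>b\<in>I. t b *\<^sub>R b)) *\<^sub>R partial_derivs w g (x + (\<Sum>b\<in>I. t b *\<^sub>R b))))\<^sup>2)
         \<partial>(\<Pi>\<^sub>M b\<in>I. lborel))"
    using insert by auto
  \<comment> \<open>The one-dimensional inequality involves a function and its derivative, so every
    old word occurs with and without b.\<close>
  define ws' where "ws' = ws @ map ((#) b) ws"
  define k where "k = 1 / r + 1"
  have k: "0 \<le> k"
    using \<open>r > 0\<close> by (simp add: k_def)
  have b: "b \<in> Basis"
    using insert by auto
  show ?case
  proof (intro exI[of _ "c * k"] exI[of _ ws'] conjI allI impI)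
    show "0 \<le> c * k"
      using c k by simp
    show "\<forall>w\<in>set ws'. set w \<subseteq> Basis"
      using ws b by (auto simp: ws'_def subset_iff)
    fix \<Omega> :: "'a set" and g x
    assume \<Omega>: "open \<Omega>" and g: "smooth_on \<Omega> g"
      and region: "\<forall>t. (\<forall>c\<in>insert b I. t c \<in> {0..r}) \<longrightarrow> x + (\<Sum>c\<in>insert b I. t c *\<^sub>R c) \<in> \<Omega>"
    define u where "u w z = ennreal ((norm (indicator \<Omega> z *\<^sub>R partial_derivs w g z))\<^sup>2)" for w z
    have u_meas: "u w \<in> borel_measurable borel" if "set w \<subseteq> Basis" for w
    proof -
      have [measurable]: "(\<lambda>z. indicator \<Omega> z *\<^sub>R partial_derivs w g z) \<in> borel_measurable borel"
        using set_borel_measurable_smooth[OF \<Omega> smooth_on_partial_derivs[OF g that]]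
        by (simp add: set_borel_measurable_def)
      show ?thesis
        unfolding u_def by measurable
    qed
    define A where "A w = (\<integral>\<^sup>+t. (\<Prod>b\<in>I. indicator {0..r} (t b)) * u w (x + (\<Sum>b\<in>I. t b *\<^sub>R b)) \<partial>(\<Pi>\<^sub>M b\<in>I. lborel))" for w
    define A' where "A' w = (\<integral>\<^sup>+t. (\<Prod>c\<in>insert b I. indicator {0..r} (t c)) * u w (x + (\<Sum>c\<in>insert b I. t c *\<^sub>R c))
        \<partial>(\<Pi>\<^sub>M c\<in>insert b I. lborel))" for w
    have reg: "x + (\<Sum>c\<in>I. t c *\<^sub>R c) + s *\<^sub>R b \<in> \<Omega>" if "\<forall>c\<in>I. t c \<in> {0..r}" "s \<in> {0..r}" for t s
    proof -
      have "(\<Sum>c\<in>insert b I. (t(b := s)) c *\<^sub>R c) = s *\<^sub>R b + (\<Sum>c\<in>I. t c *\<^sub>R c)"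
        using insert.hyps by (auto intro!: sum.cong)
      moreover have "\<forall>c\<in>insert b I. (t(b := s)) c \<in> {0..r}"
        using that by auto
      ultimately show ?thesis
        using region[THEN spec, of "t(b := s)"] by (simp only: add_ac simp_thms)
    qed
    have A'_eq: "A' w = (\<integral>\<^sup>+t. (\<Prod>c\<in>I. indicator {0..r} (t c)) *
        (\<integral>\<^sup>+s\<in>{0..r}. u w (x + (\<Sum>c\<in>I. t c *\<^sub>R c) + s *\<^sub>R b) \<partial>lborel) \<partial>(\<Pi>\<^sub>M c\<in>I. lborel))"
      if w: "set w \<subseteq> Basis" for w
    proof -
      note [measurable] = u_meas[OF w]
      have "A' w = (\<integral>\<^sup>+t. (\<integral>\<^sup>+s. (\<Prod>c\<in>insert b I. indicator {0..r} ((t(b := s)) c)) *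
          u w (x + (\<Sum>c\<in>insert b I. (t(b := s)) c *\<^sub>R c)) \<partial>lborel) \<partial>(\<Pi>\<^sub>M c\<in>I. lborel))"
        unfolding A'_def using insert.hyps
        by (intro product_nn_integral_insert) auto
      also have "\<dots> = (\<integral>\<^sup>+t. (\<integral>\<^sup>+s. (\<Prod>c\<in>I. indicator {0..r} (t c)) *
          (u w (x + (\<Sum>c\<in>I. t c *\<^sub>R c) + s *\<^sub>R b) * indicator {0..r} s) \<partial>lborel) \<partial>(\<Pi>\<^sub>M c\<in>I. lborel))"
      proof (intro nn_integral_cong)
        fix t s
        have 1: "(\<Sum>c\<in>insert b I. (t(b := s)) c *\<^sub>R c) = s *\<^sub>R b + (\<Sum>c\<in>I. t c *\<^sub>R c)"
          using insert.hyps by (auto intro!: sum.cong)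
        have 2: "(\<Prod>c\<in>insert b I. indicator {0..r} ((t(b := s)) c) :: ennreal) =
            indicator {0..r} s * (\<Prod>c\<in>I. indicator {0..r} (t c))"
          using insert.hyps by (auto intro!: arg_cong2[where f="(*)"] prod.cong)
        show "(\<Prod>c\<in>insert b I. indicator {0..r} ((t(b := s)) c)) * u w (x + (\<Sum>c\<in>insert b I. (t(b := s)) c *\<^sub>R c)) =
          (\<Prod>c\<in>I. indicator {0..r} (t c)) * (u w (x + (\<Sum>c\<in>I. t c *\<^sub>R c) + s *\<^sub>R b) * indicator {0..r} s)"
          unfolding 1 2 by (simp only: ac_simps)
      qed
      also have "\<dots> = (\<integral>\<^sup>+t. (\<Prod>c\<in>I. indicator {0..r} (t c)) *
        (\<integral>\<^sup>+s\<in>{0..r}. u w (x + (\<Sum>c\<in>I. t c *\<^sub>R c) + s *\<^sub>R b) \<partial>lborel) \<partial>(\<Pi>\<^sub>M c\<in>I. lborel))"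
        by (intro nn_integral_cong nn_integral_cmult) measurable
      finally show ?thesis .
    qed
    have AA': "A w \<le> ennreal k * (A' w + A' (b # w))" if w: "set w \<subseteq> Basis" for w
    proof -
      have bw: "set (b # w) \<subseteq> Basis"
        using w b by auto
      note [measurable] = u_meas[OF w] u_meas[OF bw]
      let ?J = "\<lambda>w t. \<integral>\<^sup>+s\<in>{0..r}. u w (x + (\<Sum>c\<in>I. t c *\<^sub>R c) + s *\<^sub>R b) \<partial>lborel"
      have "A w \<le> (\<integral>\<^sup>+t. (\<Prod>c\<in>I. indicator {0..r} (t c)) * (ennreal k * (?J w t + ?J (b # w) t)) \<partial>(\<Pi>\<^sub>M c\<in>I. lborel))"
        unfolding A_def
      proof (intro nn_integral_mono)
        fix t :: "'a \<Rightarrow> real"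
        show "(\<Prod>c\<in>I. indicator {0..r} (t c)) * u w (x + (\<Sum>c\<in>I. t c *\<^sub>R c)) \<le>
          (\<Prod>c\<in>I. indicator {0..r} (t c)) * (ennreal k * (?J w t + ?J (b # w) t))"
        \<comment> \<open>Off the cube the product of indicators vanishes on both sides; on the cube
          the whole segment from y in direction b lies in \<Omega>.\<close>
        proof (cases "\<forall>c\<in>I. t c \<in> {0..r}")
          case False
          then have "(\<Prod>c\<in>I. indicator {0..r} (t c) :: ennreal) = 0"
            using insert.hyps by (auto intro!: prod_zero simp: indicator_def)
          then show ?thesis
            by (simp only: mult_zero_left order_refl)
        next
          case True
          define y where "y = x + (\<Sum>c\<in>I. t c *\<^sub>R c)"
          have in_\<Omega>: "y + s *\<^sub>R b \<in> \<Omega>" if "s \<in> {0..r}" for s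
            using reg[OF True that] by (simp add: y_def)
          have y: "y \<in> \<Omega>"
            using in_\<Omega>[of 0] \<open>r > 0\<close> by simp
          have sm: "smooth_on \<Omega> (partial_derivs w g)" "smooth_on \<Omega> (partial_derivs (b # w) g)"
            using smooth_on_partial_derivs[OF g] w bw by blast+
          have "ennreal ((norm (partial_derivs w g (y + 0 *\<^sub>R b)))\<^sup>2) \<le>
            ennreal (1 / r + 1) * (\<integral>\<^sup>+s\<in>{0..r}. ennreal ((norm (partial_derivs w g (y + s *\<^sub>R b)))\<^sup>2 +
              (norm (partial_derivs (b # w) g (y + s *\<^sub>R b)))\<^sup>2) \<partial>lborel)"
          proof (rule interval_sobolev[OF \<open>r > 0\<close>])
            fix s assume "s \<in> {0..r}"
            then show "((\<lambda>s. partial_derivs w g (y + s *\<^sub>R b)) has_vector_derivative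
                partial_derivs (b # w) g (y + s *\<^sub>R b)) (at s within {0..r})"
              using has_vector_derivative_at_within[OF has_vector_derivative_along_line[OF
                smooth_on_imp_differentiable[OF sm(1) \<Omega> in_\<Omega>]]] by simp
          next
            show "continuous_on {0..r} (\<lambda>s. partial_derivs (b # w) g (y + s *\<^sub>R b))"
              by (rule continuous_on_compose2[OF smooth_on_imp_continuous_on[OF sm(2)]])
                 (auto intro!: continuous_intros in_\<Omega>)
          qed
          also have "(\<integral>\<^sup>+s\<in>{0..r}. ennreal ((norm (partial_derivs w g (y + s *\<^sub>R b)))\<^sup>2 +
              (norm (partial_derivs (b # w) g (y + s *\<^sub>R b)))\<^sup>2) \<partial>lborel) =
              (\<integral>\<^sup>+s. u w (y + s *\<^sub>R b) * indicator {0..r} s + u (b # w) (y + s *\<^sub>R b) * indicator {0..r} s \<partial>lborel)"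
            by (intro nn_integral_cong) (auto simp: u_def indicator_def in_\<Omega>)
          also have "\<dots> = ?J w t + ?J (b # w) t"
            unfolding y_def by (intro nn_integral_add) measurable
          finally have "u w y \<le> ennreal k * (?J w t + ?J (b # w) t)"
            using y by (simp add: u_def k_def)
          then show ?thesis
            unfolding y_def by (intro mult_left_mono) auto
        qed
      qed
      also have "\<dots> = (\<integral>\<^sup>+t. ennreal k * ((\<Prod>c\<in>I. indicator {0..r} (t c)) * ?J w t +
          (\<Prod>c\<in>I. indicator {0..r} (t c)) * ?J (b # w) t) \<partial>(\<Pi>\<^sub>M c\<in>I. lborel))"
        by (intro nn_integral_cong) (simp only: distrib_left mult.left_commute)
      also have "\<dots> = ennreal k * (\<integral>\<^sup>+t. (\<Prod>c\<in>I. indicator {0..r} (t c)) * ?J w t +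
          (\<Prod>c\<in>I. indicator {0..r} (t c)) * ?J (b # w) t \<partial>(\<Pi>\<^sub>M c\<in>I. lborel))"
        by (intro nn_integral_cmult) measurable
      also have "\<dots> = ennreal k * (A' w + A' (b # w))"
        unfolding A'_eq[OF w] A'_eq[OF bw]
        by (intro arg_cong2[where f="(*)"] refl nn_integral_add) measurable
      finally show ?thesis .
    qed
    have "ennreal ((norm (g x))\<^sup>2) \<le> ennreal c * (\<Sum>w\<leftarrow>ws. A w)"
      unfolding A_def u_def
    proof (rule IH[OF \<Omega> g])
      fix t :: "'a \<Rightarrow> real" assume "\<forall>b\<in>I. t b \<in> {0..r}"
      \<comment> \<open>The smaller cube is the face s = 0 of the larger one, so it lies in \<Omega>
        as well.\<close>
      from reg[OF this, of 0] show "x + (\<Sum>b\<in>I. t b *\<^sub>R b) \<in> \<Omega>"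
        using \<open>r > 0\<close> by simp
    qed
    also have "(\<Sum>w\<leftarrow>ws. A w) \<le> (\<Sum>w\<leftarrow>ws. ennreal k * (A' w + A' (b # w)))"
      using ws by (intro sum_list_mono AA') auto
    also have "\<dots> = ennreal k * (\<Sum>w\<leftarrow>ws'. A' w)"
      by (simp add: ws'_def sum_list_const_mult sum_list_addf o_def)
    finally have "ennreal ((norm (g x))\<^sup>2) \<le> ennreal c * (ennreal k * (\<Sum>w\<leftarrow>ws'. A' w))"
      by (simp add: mult_left_mono)
    then show "ennreal ((norm (g x))\<^sup>2) \<le> ennreal (c * k) * (\<Sum>w\<leftarrow>ws'. \<integral>\<^sup>+t. (\<Prod>b\<in>insert b I. indicator {0..r} (t b)) *
         ennreal ((norm (indicator \<Omega> (x + (\<Sum>b\<in>insert b I. t b *\<^sub>R b)) *\<^sub>R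
            partial_derivs w g (x + (\<Sum>b\<in>insert b I. t b *\<^sub>R b))))\<^sup>2) \<partial>(\<Pi>\<^sub>M b\<in>insert b I. lborel))"
      unfolding A'_def u_def ennreal_mult[OF c k] mult.assoc .
  qed
qed

text \<open>All directions at once. Lebesgue measure is the image of the product measure of the
  coordinates, translation by x leaves it invariant, and dropping the indicator of the cube enlarges
  the integral to all of \<Omega>. The cube has x as a corner, not as its centre.\<close>

lemma sobolev_pointwise:
  assumes "r > 0"
  obtains c :: real and ws :: "'a::euclidean_space list list"
  where "\<And>w. w \<in> set ws \<Longrightarrow> set w \<subseteq> Basis"
    and "\<And>\<Omega> g x. open \<Omega> \<Longrightarrow> smooth_on \<Omega> g \<Longrightarrow>
      (\<And>z. (\<And>b. b \<in> Basis \<Longrightarrow> z \<bullet> b \<in> {0..r}) \<Longrightarrow> x + z \<in> \<Omega>) \<Longrightarrow>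
      ennreal ((norm (g x))\<^sup>2) \<le> ennreal c * (\<Sum>w\<leftarrow>ws. L2_sq \<Omega> (partial_derivs w g))"
proof -
  obtain c ws where c: "0 \<le> c" and ws: "\<forall>w\<in>set ws. set w \<subseteq> (Basis :: 'a set)"
    and est: "\<And>\<Omega> g x. open \<Omega> \<Longrightarrow> smooth_on \<Omega> g \<Longrightarrow>
      (\<And>t. (\<forall>b\<in>Basis. t b \<in> {0..r}) \<Longrightarrow> x + (\<Sum>b\<in>Basis. t b *\<^sub>R b) \<in> \<Omega>) \<Longrightarrow>
      ennreal ((norm (g x))\<^sup>2) \<le> ennreal c * (\<Sum>w\<leftarrow>ws. \<integral>\<^sup>+t. (\<Prod>b\<in>Basis. indicator {0..r} (t b)) *
         ennreal ((norm (indicator \<Omega> (x + (\<Sum>b\<in>Basis. t b *\<^sub>R b)) *\<^sub>R partial_derivs w g (x + (\<Sum>b\<in>Basis. t b *\<^sub>R b))))\<^sup>2)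
         \<partial>(\<Pi>\<^sub>M b\<in>Basis. lborel))"
    using sobolev_directions[of "Basis :: 'a set" r] assms by auto
  have "ennreal ((norm (g x))\<^sup>2) \<le> ennreal c * (\<Sum>w\<leftarrow>ws. L2_sq \<Omega> (partial_derivs w g))"
    if \<Omega>: "open \<Omega>" and g: "smooth_on \<Omega> g"
      and reg: "\<And>z. (\<And>b. b \<in> Basis \<Longrightarrow> z \<bullet> b \<in> {0..r}) \<Longrightarrow> x + z \<in> \<Omega>" for \<Omega> g and x :: 'a
  proof -
    have "(\<integral>\<^sup>+t. (\<Prod>b\<in>Basis. indicator {0..r} (t b)) *
         ennreal ((norm (indicator \<Omega> (x + (\<Sum>b\<in>Basis. t b *\<^sub>R b)) *\<^sub>R partial_derivs w g (x + (\<Sum>b\<in>Basis. t b *\<^sub>R b))))\<^sup>2)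
         \<partial>(\<Pi>\<^sub>M b\<in>Basis. lborel)) \<le> L2_sq \<Omega> (partial_derivs w g)" if w: "set w \<subseteq> Basis" for w
    proof -
      define u where "u z = ennreal ((norm (indicator \<Omega> z *\<^sub>R partial_derivs w g z))\<^sup>2)" for z
      have [measurable]: "(\<lambda>z. indicator \<Omega> z *\<^sub>R partial_derivs w g z) \<in> borel_measurable borel"
        using set_borel_measurable_smooth[OF \<Omega> smooth_on_partial_derivs[OF g w]]
        by (simp add: set_borel_measurable_def)
      have [measurable]: "u \<in> borel_measurable borel"
        unfolding u_def by measurable
      have ind: "(\<Prod>b\<in>Basis. indicator {0..r} (t b)) \<le> (1 :: ennreal)" for t :: "'a \<Rightarrow> real"
        by (intro prod_le_1) (auto simp: indicator_def)
      have "(\<integral>\<^sup>+t. (\<Prod>b\<in>Basis. indicator {0..r} (t b)) * u (x + (\<Sum>b\<in>Basis. t b *\<^sub>R b)) \<partial>(\<Pi>\<^sub>M b\<in>Basis. lborel))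
          \<le> (\<integral>\<^sup>+t. u (x + (\<Sum>b\<in>Basis. t b *\<^sub>R b)) \<partial>(\<Pi>\<^sub>M b\<in>Basis. lborel))"
        using mult_right_mono[OF ind] by (intro nn_integral_mono) auto
      also have "\<dots> = (\<integral>\<^sup>+z. u (x + z) \<partial>lborel)"
        by (subst lborel_eq, subst nn_integral_distr) auto
      also have "\<dots> = (\<integral>\<^sup>+z. u z \<partial>distr lborel borel ((+) x))"
        by (subst nn_integral_distr) auto
      also have "\<dots> = L2_sq \<Omega> (partial_derivs w g)"
        unfolding lborel_distr_plus L2_sq_def u_def ..
      finally show ?thesis
        by (simp only: u_def)
    qed
    then have "(\<Sum>w\<leftarrow>ws. \<integral>\<^sup>+t. (\<Prod>b\<in>Basis. indicator {0..r} (t b)) *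
         ennreal ((norm (indicator \<Omega> (x + (\<Sum>b\<in>Basis. t b *\<^sub>R b)) *\<^sub>R partial_derivs w g (x + (\<Sum>b\<in>Basis. t b *\<^sub>R b))))\<^sup>2)
         \<partial>(\<Pi>\<^sub>M b\<in>Basis. lborel)) \<le> (\<Sum>w\<leftarrow>ws. L2_sq \<Omega> (partial_derivs w g))"
      using ws by (intro sum_list_mono) auto
    moreover have "x + (\<Sum>b\<in>Basis. t b *\<^sub>R b) \<in> \<Omega>" if "\<forall>b\<in>Basis. t b \<in> {0..r}" for t
      using that by (intro reg) simp
    ultimately show ?thesis
      using est[OF \<Omega> g, of x] by (meson mult_left_mono order_trans zero_le)
  qed
  then show ?thesis
    using that[of ws c] ws by blast
qed

section \<open>Differentiation under the integral sign\<close>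

text \<open>The quantifier over x stands inside \<open>AE\<close>: the exceptional null set of \<xi>
  does not depend on x. The square of G is integrated in \<open>ennreal\<close>, because only
  finiteness matters.\<close>

definition locally_L2_dominated ::
  "'a::euclidean_space set \<Rightarrow> 'c::euclidean_space set \<Rightarrow> ('a \<Rightarrow> 'c \<Rightarrow> complex) \<Rightarrow> bool" where
  "locally_L2_dominated X \<Xi> h \<longleftrightarrow> (\<forall>x0\<in>X. \<exists>U G. open U \<and> x0 \<in> U \<and> U \<subseteq> X \<and>
     G \<in> borel_measurable lborel \<and> (\<integral>\<^sup>+\<xi>. ennreal ((G \<xi>)\<^sup>2) \<partial>lborel) < \<infinity> \<and>
     (AE \<xi> in lborel. \<forall>x\<in>U. norm (indicator \<Xi> \<xi> *\<^sub>R h x \<xi>) \<le> G \<xi>))"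

definition locally_L1_dominated ::
  "'a::euclidean_space set \<Rightarrow> 'c::euclidean_space set \<Rightarrow> ('a \<Rightarrow> 'c \<Rightarrow> complex) \<Rightarrow> bool" where
  "locally_L1_dominated X \<Xi> h \<longleftrightarrow> (\<forall>x0\<in>X. \<exists>U G. open U \<and> x0 \<in> U \<and> U \<subseteq> X \<and>
     integrable lborel G \<and>
     (AE \<xi> in lborel. \<forall>x\<in>U. norm (indicator \<Xi> \<xi> *\<^sub>R h x \<xi>) \<le> G \<xi>))"

text \<open>For fixed \<xi> the pointwise Sobolev inequality on X bounds |h x \<xi>|^2, for all x in
  a ball, by a constant times a sum of integrals over X of squared derivatives. This bound
  \<open>Q \<xi>\<close> no longer depends on x, and its integral over \<xi> is finite by
  \<open>fin\<close>; the dominating function is its square root.\<close>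

lemma locally_L2_dominated_smooth:
  fixes h :: "'a::euclidean_space \<Rightarrow> 'c::euclidean_space \<Rightarrow> complex"
  assumes X: "open X"
    and smooth: "\<And>\<xi>. \<xi> \<in> \<Xi> \<Longrightarrow> smooth_on X (\<lambda>x. h x \<xi>)"
    and meas: "\<And>w. set w \<subseteq> Basis \<Longrightarrow> (\<lambda>(\<xi>, x). indicator X x *\<^sub>R (indicator \<Xi> \<xi> *\<^sub>R partial_derivs w (\<lambda>x. h x \<xi>) x))
        \<in> borel_measurable (lborel \<Otimes>\<^sub>M lborel)"
    and fin: "\<And>w. set w \<subseteq> Basis \<Longrightarrow>
      (\<integral>\<^sup>+\<xi>. \<integral>\<^sup>+x. ennreal ((norm (indicator X x *\<^sub>R (indicator \<Xi> \<xi> *\<^sub>R partial_derivs w (\<lambda>x. h x \<xi>) x)))\<^sup>2) \<partial>lborel \<partial>lborel) < \<infinity>"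
  shows "locally_L2_dominated X \<Xi> h"
  unfolding locally_L2_dominated_def
proof
  fix x0 assume "x0 \<in> X"
  then obtain e where e: "e > 0" "ball x0 e \<subseteq> X"
    using X open_contains_ball by blast
  \<comment> \<open>A vector in the cube has norm at most the sum of its coordinates, hence at most
    e/2; added to a point of the half ball it stays in the ball of radius e.\<close>
  define r where "r = e / 2 / (real DIM('a) + 1)"
  have r: "r > 0"
    using e by (simp add: r_def)
  obtain c :: real and ws :: "'a list list" where ws: "\<And>w. w \<in> set ws \<Longrightarrow> set w \<subseteq> Basis"
    and est: "\<And>\<Omega> g x. open \<Omega> \<Longrightarrow> smooth_on \<Omega> g \<Longrightarrow>
      (\<And>z. (\<And>b. b \<in> Basis \<Longrightarrow> z \<bullet> b \<in> {0..r}) \<Longrightarrow> x + z \<in> \<Omega>) \<Longrightarrow>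
      ennreal ((norm (g x))\<^sup>2) \<le> ennreal c * (\<Sum>w\<leftarrow>ws. L2_sq \<Omega> (partial_derivs w g))"
    using sobolev_pointwise[OF r] by metis
  define q where "q w \<xi> = (\<integral>\<^sup>+x. ennreal ((norm (indicator X x *\<^sub>R (indicator \<Xi> \<xi> *\<^sub>R partial_derivs w (\<lambda>x. h x \<xi>) x)))\<^sup>2) \<partial>lborel)" for w \<xi>
  define Q where "Q \<xi> = ennreal c * (\<Sum>i<length ws. q (ws ! i) \<xi>)" for \<xi>
  have q_meas: "q w \<in> borel_measurable lborel" if w: "set w \<subseteq> Basis" for w
  proof -
    note [measurable] = meas[OF w, unfolded case_prod_beta]
    have "(\<lambda>p. ennreal ((norm (indicator X (snd p) *\<^sub>R (indicator \<Xi> (fst p) *\<^sub>R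
        partial_derivs w (\<lambda>x. h x (fst p)) (snd p))))\<^sup>2)) \<in> borel_measurable (lborel \<Otimes>\<^sub>M lborel)"
      by measurable
    then show ?thesis
      unfolding q_def by (intro lborel.borel_measurable_nn_integral) (simp add: case_prod_beta)
  qed
  have wsi: "set (ws ! i) \<subseteq> Basis" if "i < length ws" for i
    using ws[OF nth_mem[OF that]] .
  have Q_meas [measurable]: "Q \<in> borel_measurable lborel"
  proof -
    have [measurable]: "(\<lambda>\<xi>. \<Sum>i<length ws. q (ws ! i) \<xi>) \<in> borel_measurable lborel"
      using q_meas[OF wsi] by (intro borel_measurable_sum) auto
    show ?thesis
      unfolding Q_def by measurable
  qed
  have "(\<integral>\<^sup>+\<xi>. Q \<xi> \<partial>lborel) = ennreal c * (\<Sum>i<length ws. \<integral>\<^sup>+\<xi>. q (ws ! i) \<xi> \<partial>lborel)"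
    unfolding Q_def
  proof (subst nn_integral_cmult)
    show "(\<lambda>\<xi>. \<Sum>i<length ws. q (ws ! i) \<xi>) \<in> borel_measurable lborel"
      using q_meas[OF wsi] by (intro borel_measurable_sum) auto
    show "ennreal c * (\<integral>\<^sup>+\<xi>. (\<Sum>i<length ws. q (ws ! i) \<xi>) \<partial>lborel) =
        ennreal c * (\<Sum>i<length ws. \<integral>\<^sup>+\<xi>. q (ws ! i) \<xi> \<partial>lborel)"
      using q_meas[OF wsi] by (subst nn_integral_sum) auto
  qed
  also have "\<dots> < \<infinity>"
    using fin[OF wsi] by (auto simp: q_def ennreal_mult_less_top)
  finally have Q_fin: "(\<integral>\<^sup>+\<xi>. Q \<xi> \<partial>lborel) < \<infinity>" .
  then have AE_Q: "AE \<xi> in lborel. Q \<xi> \<noteq> \<infinity>"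
    by (intro nn_integral_PInf_AE Q_meas) auto
  have bound: "ennreal ((norm (h x \<xi>))\<^sup>2) \<le> Q \<xi>" if x: "x \<in> ball x0 (e / 2)" and \<xi>: "\<xi> \<in> \<Xi>" for x \<xi>
  proof -
    have reg: "x + z \<in> X" if z: "\<And>b. b \<in> Basis \<Longrightarrow> z \<bullet> b \<in> {0..r}" for z
    proof -
      have "norm z \<le> (\<Sum>b\<in>Basis. \<bar>z \<bullet> b\<bar>)"
        by (rule norm_le_l1)
      also have "\<dots> \<le> (\<Sum>b\<in>(Basis :: 'a set). r)"
        using z by (intro sum_mono) auto
      also have "\<dots> \<le> (real DIM('a) + 1) * r"
        using r by (simp add: algebra_simps)
      also have "\<dots> = e / 2"
        using of_nat_0_le_iff[of "DIM('a)", where 'a=real] unfolding r_def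
        by (subst times_divide_eq_right, subst nonzero_mult_div_cancel_left) auto
      finally have "dist x0 (x + z) < e"
        using x dist_triangle[of x0 "x + z" x] by (simp add: dist_norm)
      then show ?thesis
        using e(2) by auto
    qed
    have "ennreal ((norm (h x \<xi>))\<^sup>2) \<le> ennreal c * (\<Sum>w\<leftarrow>ws. L2_sq X (partial_derivs w (\<lambda>x. h x \<xi>)))"
      by (rule est[OF X smooth[OF \<xi>] reg])
    also have "\<dots> = Q \<xi>"
      using \<xi> by (simp add: Q_def q_def L2_sq_def sum_list_sum_nth atLeast0LessThan)
    finally show ?thesis .
  qed
  \<comment> \<open>Where \<open>Q\<close> is infinite, \<open>enn2real\<close> returns 0 and the
    bound may fail, which is why the domination is claimed almost everywhere only.\<close>
  define G where "G \<xi> = sqrt (enn2real (Q \<xi>))" for \<xi>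
  show "\<exists>U G. open U \<and> x0 \<in> U \<and> U \<subseteq> X \<and> G \<in> borel_measurable lborel \<and>
      (\<integral>\<^sup>+\<xi>. ennreal ((G \<xi>)\<^sup>2) \<partial>lborel) < \<infinity> \<and>
     (AE \<xi> in lborel. \<forall>x\<in>U. norm (indicator \<Xi> \<xi> *\<^sub>R h x \<xi>) \<le> G \<xi>)"
  proof (intro exI[of _ "ball x0 (e / 2)"] exI[of _ G] conjI)
    show "x0 \<in> ball x0 (e / 2)" "ball x0 (e / 2) \<subseteq> X"
      using e by auto
    show "G \<in> borel_measurable lborel"
      unfolding G_def by measurable
    have "(\<integral>\<^sup>+\<xi>. ennreal ((G \<xi>)\<^sup>2) \<partial>lborel) \<le> (\<integral>\<^sup>+\<xi>. Q \<xi> \<partial>lborel)"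
      unfolding G_def by (intro nn_integral_mono) (simp add: ennreal_enn2real_if)
    then show "(\<integral>\<^sup>+\<xi>. ennreal ((G \<xi>)\<^sup>2) \<partial>lborel) < \<infinity>"
      using Q_fin by (rule le_less_trans)
    show "AE \<xi> in lborel. \<forall>x\<in>ball x0 (e / 2). norm (indicator \<Xi> \<xi> *\<^sub>R h x \<xi>) \<le> G \<xi>"
      using AE_Q
    proof eventually_elim
      fix \<xi> assume Q: "Q \<xi> \<noteq> \<infinity>"
      show "\<forall>x\<in>ball x0 (e / 2). norm (indicator \<Xi> \<xi> *\<^sub>R h x \<xi>) \<le> G \<xi>"
      proof
        fix x assume x: "x \<in> ball x0 (e / 2)"
        show "norm (indicator \<Xi> \<xi> *\<^sub>R h x \<xi>) \<le> G \<xi>"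
        proof (cases "\<xi> \<in> \<Xi>")
          case True
          have "ennreal ((norm (h x \<xi>))\<^sup>2) \<le> ennreal (enn2real (Q \<xi>))"
            using bound[OF x True] Q by (simp add: ennreal_enn2real_if)
          then have "(norm (h x \<xi>))\<^sup>2 \<le> enn2real (Q \<xi>)"
            by (subst (asm) ennreal_le_iff) auto
          then show ?thesis
            using True by (simp add: G_def real_le_rsqrt)
        qed (simp add: G_def)
      qed
    qed
  qed simp
qed

lemma set_integrable_dominated:
  assumes "locally_L1_dominated X \<Xi> h" "x \<in> X" "set_borel_measurable lborel \<Xi> (h x)"
  shows "set_integrable lborel \<Xi> (h x)"
proof -
  obtain U G where *: "x \<in> U" "integrable lborel G"
    "AE \<xi> in lborel. \<forall>x\<in>U. norm (indicator \<Xi> \<xi> *\<^sub>R h x \<xi>) \<le> G \<xi>"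
    using assms(1,2) unfolding locally_L1_dominated_def by blast
  show ?thesis
    unfolding set_integrable_def
  proof (rule Bochner_Integration.integrable_bound[OF *(2)])
    show "AE \<xi> in lborel. norm (indicator \<Xi> \<xi> *\<^sub>R h x \<xi>) \<le> norm (G \<xi>)"
      using *(3) by eventually_elim (use *(1) in fastforce)
  qed (use assms(3) in \<open>simp add: set_borel_measurable_def\<close>)
qed

text \<open>The remainder quotient \<open>q\<close> tends to 0 for each \<xi> by differentiability,
  and near z it is bounded by 2H with H integrable, so dominated convergence applies. The total
  derivative is needed, not just the partial ones, because \<open>Ck_on\<close> asks for
  differentiability.\<close>

lemma has_derivative_set_integral:
  fixes \<Phi> :: "'a::euclidean_space \<Rightarrow> 'c::euclidean_space \<Rightarrow> complex"
  assumes Z: "open Z" "z \<in> Z"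
    and meas: "\<And>z. z \<in> Z \<Longrightarrow> set_borel_measurable lborel \<Xi> (\<Phi> z)"
      "\<And>b z. b \<in> Basis \<Longrightarrow> z \<in> Z \<Longrightarrow> set_borel_measurable lborel \<Xi> (\<Psi> b z)"
    and diff: "\<And>z \<xi>. z \<in> Z \<Longrightarrow> \<xi> \<in> \<Xi> \<Longrightarrow> (\<lambda>z. \<Phi> z \<xi>) differentiable at z"
    and partial: "\<And>b z \<xi>. b \<in> Basis \<Longrightarrow> z \<in> Z \<Longrightarrow> \<xi> \<in> \<Xi> \<Longrightarrow> partial_deriv b (\<lambda>z. \<Phi> z \<xi>) z = \<Psi> b z \<xi>"
    and dom: "locally_L1_dominated Z \<Xi> \<Phi>" "\<And>b. b \<in> Basis \<Longrightarrow> locally_L1_dominated Z \<Xi> (\<Psi> b)"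
  shows "((\<lambda>z. LINT \<xi>:\<Xi>|lborel. \<Phi> z \<xi>) has_derivative
    (\<lambda>v. \<Sum>b\<in>Basis. (v \<bullet> b) *\<^sub>R (LINT \<xi>:\<Xi>|lborel. \<Psi> b z \<xi>))) (at z)"
proof -
  define \<phi> where "\<phi> z \<xi> = indicator \<Xi> \<xi> *\<^sub>R \<Phi> z \<xi>" for z \<xi>
  define \<psi> where "\<psi> b z \<xi> = indicator \<Xi> \<xi> *\<^sub>R \<Psi> b z \<xi>" for b z \<xi>
  have int\<phi>: "integrable lborel (\<phi> z)" if "z \<in> Z" for z
    using set_integrable_dominated[OF dom(1) that meas(1)[OF that]] by (simp add: \<phi>_def[abs_def] set_integrable_def)
  have int\<psi>: "integrable lborel (\<psi> b z)" if "b \<in> Basis" "z \<in> Z" for b z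
    using set_integrable_dominated[OF dom(2) that(2) meas(2)] that by (simp add: \<psi>_def[abs_def] set_integrable_def)
  have "\<forall>b\<in>Basis. \<exists>U G. open U \<and> z \<in> U \<and> U \<subseteq> Z \<and> integrable lborel G \<and>
     (AE \<xi> in lborel. \<forall>x\<in>U. norm (\<psi> b x \<xi>) \<le> G \<xi>)"
    using dom(2) Z(2) unfolding locally_L1_dominated_def \<psi>_def by blast
  from bchoice[OF this] obtain U where "\<forall>b\<in>Basis. \<exists>G. open (U b) \<and> z \<in> U b \<and> U b \<subseteq> Z \<and> integrable lborel G \<and>
     (AE \<xi> in lborel. \<forall>x\<in>U b. norm (\<psi> b x \<xi>) \<le> G \<xi>)" ..
  from bchoice[OF this] obtain G where "\<forall>b\<in>Basis. open (U b) \<and> z \<in> U b \<and> U b \<subseteq> Z \<and> integrable lborel (G b) \<and>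
     (AE \<xi> in lborel. \<forall>x\<in>U b. norm (\<psi> b x \<xi>) \<le> G b \<xi>)" ..
  then have UG: "\<And>b. b \<in> Basis \<Longrightarrow> open (U b)" "\<And>b. b \<in> Basis \<Longrightarrow> z \<in> U b"
      "\<And>b. b \<in> Basis \<Longrightarrow> integrable lborel (G b)"
      "\<And>b. b \<in> Basis \<Longrightarrow> AE \<xi> in lborel. \<forall>x\<in>U b. norm (\<psi> b x \<xi>) \<le> G b \<xi>"
    by auto
  have "open (Z \<inter> (\<Inter>b\<in>Basis. U b))" "z \<in> Z \<inter> (\<Inter>b\<in>Basis. U b)"
    using Z UG by (auto intro!: open_Int open_INT)
  \<comment> \<open>A ball inside the neighbourhoods of all directions: it is convex, as the mean
    value inequality requires.\<close>
  then obtain e where e: "e > 0" "ball z e \<subseteq> Z \<inter> (\<Inter>b\<in>Basis. U b)"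
    by (rule openE)
  define B where "B = ball z e"
  have B: "convex B" "open B" "z \<in> B" "B \<subseteq> Z"
    using e by (auto simp: B_def)
  \<comment> \<open>H dominates the operator norm of the derivative, since each coordinate of v is
    at most norm v.\<close>
  define H where "H \<xi> = (\<Sum>b\<in>Basis. G b \<xi>)" for \<xi>
  have intH: "integrable lborel H"
    unfolding H_def using UG(3) by auto
  have der: "((\<lambda>y. \<phi> y \<xi>) has_derivative (\<lambda>v. \<Sum>b\<in>Basis. (v \<bullet> b) *\<^sub>R \<psi> b y \<xi>)) (at y)" if "y \<in> Z" for y \<xi>
  proof (cases "\<xi> \<in> \<Xi>")
    case True
    have eq: "(\<lambda>v. \<Sum>b\<in>Basis. (v \<bullet> b) *\<^sub>R partial_deriv b (\<lambda>z. \<Phi> z \<xi>) y) = (\<lambda>v. \<Sum>b\<in>Basis. (v \<bullet> b) *\<^sub>R \<Psi> b y \<xi>)"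
      using partial[OF _ that True] by (intro ext sum.cong) auto
    show ?thesis
      using has_derivative_partial_deriv[OF diff[OF that True]] True unfolding eq
      by (simp add: \<phi>_def \<psi>_def)
  qed (simp add: \<phi>_def \<psi>_def)
  have "AE \<xi> in lborel. \<forall>b\<in>Basis. \<forall>x\<in>U b. norm (\<psi> b x \<xi>) \<le> G b \<xi>"
    by (rule AE_finite_allI[OF finite_Basis UG(4)])
  then have AE_bound: "AE \<xi> in lborel. \<forall>y\<in>B. \<forall>v. norm (\<Sum>b\<in>Basis. (v \<bullet> b) *\<^sub>R \<psi> b y \<xi>) \<le> H \<xi> * norm v"
  proof eventually_elim
    fix \<xi> assume *: "\<forall>b\<in>Basis. \<forall>x\<in>U b. norm (\<psi> b x \<xi>) \<le> G b \<xi>"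
    show "\<forall>y\<in>B. \<forall>v. norm (\<Sum>b\<in>Basis. (v \<bullet> b) *\<^sub>R \<psi> b y \<xi>) \<le> H \<xi> * norm v"
    proof (intro ballI allI)
      fix y and v :: 'a assume y: "y \<in> B"
      have "norm (\<Sum>b\<in>Basis. (v \<bullet> b) *\<^sub>R \<psi> b y \<xi>) \<le> (\<Sum>b\<in>Basis. norm ((v \<bullet> b) *\<^sub>R \<psi> b y \<xi>))"
        by (rule norm_sum)
      also have "\<dots> \<le> (\<Sum>b\<in>Basis. norm v * G b \<xi>)"
      proof (rule sum_mono)
        fix b :: 'a assume b: "b \<in> Basis"
        have "norm (\<psi> b y \<xi>) \<le> G b \<xi>"
          using * b y e(2) by (auto simp: B_def)
        then show "norm ((v \<bullet> b) *\<^sub>R \<psi> b y \<xi>) \<le> norm v * G b \<xi>"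
          using Basis_le_norm[OF b, of v] by (auto intro!: mult_mono)
      qed
      also have "\<dots> = H \<xi> * norm v"
        by (simp add: H_def sum_distrib_left mult.commute)
      finally show "norm (\<Sum>b\<in>Basis. (v \<bullet> b) *\<^sub>R \<psi> b y \<xi>) \<le> H \<xi> * norm v" .
    qed
  qed
  define q where "q y \<xi> = ((\<phi> y \<xi> - \<phi> z \<xi>) - (\<Sum>b\<in>Basis. ((y - z) \<bullet> b) *\<^sub>R \<psi> b z \<xi>)) /\<^sub>R norm (y - z)" for y \<xi>
  \<comment> \<open>One H bounds the increment, by the mean value inequality, and the other the
    linear part.\<close>
  have AE_q: "AE \<xi> in lborel. \<forall>y\<in>B - {z}. norm (q y \<xi>) \<le> 2 * H \<xi>"
    using AE_bound
  proof eventually_elim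
    fix \<xi> assume *: "\<forall>y\<in>B. \<forall>v. norm (\<Sum>b\<in>Basis. (v \<bullet> b) *\<^sub>R \<psi> b y \<xi>) \<le> H \<xi> * norm v"
    show "\<forall>y\<in>B - {z}. norm (q y \<xi>) \<le> 2 * H \<xi>"
    proof
      fix y assume y: "y \<in> B - {z}"
      have "norm (\<phi> y \<xi> - \<phi> z \<xi>) \<le> H \<xi> * norm (y - z)"
      proof (rule differentiable_bound[OF B(1)])
        show "((\<lambda>y. \<phi> y \<xi>) has_derivative (\<lambda>v. \<Sum>b\<in>Basis. (v \<bullet> b) *\<^sub>R \<psi> b x \<xi>)) (at x within B)"
          if "x \<in> B" for x
          using der[of x \<xi>] that B(4) by (auto intro: has_derivative_at_withinI)
        show "onorm (\<lambda>v. \<Sum>b\<in>Basis. (v \<bullet> b) *\<^sub>R \<psi> b x \<xi>) \<le> H \<xi>" if "x \<in> B" for x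
          using * that by (intro onorm_le) auto
      qed (use y B in auto)
      moreover have "norm (\<Sum>b\<in>Basis. ((y - z) \<bullet> b) *\<^sub>R \<psi> b z \<xi>) \<le> H \<xi> * norm (y - z)"
        using * B(3) by blast
      ultimately have "norm ((\<phi> y \<xi> - \<phi> z \<xi>) - (\<Sum>b\<in>Basis. ((y - z) \<bullet> b) *\<^sub>R \<psi> b z \<xi>)) \<le> 2 * H \<xi> * norm (y - z)"
        using norm_triangle_ineq4[of "\<phi> y \<xi> - \<phi> z \<xi>" "\<Sum>b\<in>Basis. ((y - z) \<bullet> b) *\<^sub>R \<psi> b z \<xi>"] by linarith
      moreover have "norm (q y \<xi>) = norm ((\<phi> y \<xi> - \<phi> z \<xi>) - (\<Sum>b\<in>Basis. ((y - z) \<bullet> b) *\<^sub>R \<psi> b z \<xi>)) / norm (y - z)"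
        unfolding q_def norm_scaleR by (simp add: divide_inverse mult.commute)
      moreover have "0 < norm (y - z)"
        using y by simp
      ultimately show "norm (q y \<xi>) \<le> 2 * H \<xi>"
        by (simp only: pos_divide_le_eq)
    qed
  qed
  have int_sum: "integrable lborel (\<lambda>\<xi>. \<Sum>b\<in>Basis. ((y - z) \<bullet> b) *\<^sub>R \<psi> b z \<xi>)" for y
    using int\<psi>[OF _ Z(2)] by auto
  let ?F = "\<lambda>z. LINT \<xi>|lborel. \<phi> z \<xi>" and ?F' = "\<lambda>v. \<Sum>b\<in>Basis. (v \<bullet> b) *\<^sub>R (LINT \<xi>|lborel. \<psi> b z \<xi>)"
  have int_q: "(LINT \<xi>|lborel. q y \<xi>) = ((?F y - ?F z) - ?F' (y - z)) /\<^sub>R norm (y - z)" if "y \<in> Z" for y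
  proof -
    have "(LINT \<xi>|lborel. (\<phi> y \<xi> - \<phi> z \<xi>) - (\<Sum>b\<in>Basis. ((y - z) \<bullet> b) *\<^sub>R \<psi> b z \<xi>)) =
        (?F y - ?F z) - (LINT \<xi>|lborel. (\<Sum>b\<in>Basis. ((y - z) \<bullet> b) *\<^sub>R \<psi> b z \<xi>))"
      using int\<phi>[OF that] int\<phi>[OF Z(2)] int_sum by simp
    also have "(LINT \<xi>|lborel. (\<Sum>b\<in>Basis. ((y - z) \<bullet> b) *\<^sub>R \<psi> b z \<xi>)) = ?F' (y - z)"
      using int\<psi>[OF _ Z(2)] by (subst Bochner_Integration.integral_sum) auto
    finally show ?thesis
      unfolding q_def by simp
  qed
  have "(?F has_derivative ?F') (at z within B)"
    unfolding has_derivative_at_within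
  proof
    show "bounded_linear ?F'"
      by (intro bounded_linear_sum bounded_linear_scaleR_left[THEN bounded_linear_compose] bounded_linear_inner_left)
    show "((\<lambda>y. ((?F y - ?F z) - ?F' (y - z)) /\<^sub>R norm (y - z)) \<longlongrightarrow> 0) (at z within B)"
      \<comment> \<open>Dominated convergence is a statement on sequences, so the limit is tested
        along sequences in B that avoid z.\<close>
      unfolding tendsto_at_iff_sequentially
    proof (intro allI impI)
      fix Y assume Y: "\<forall>i. Y i \<in> B - {z}" "Y \<longlonglongrightarrow> z"
      have "(\<lambda>i. LINT \<xi>|lborel. q (Y i) \<xi>) \<longlonglongrightarrow> (LINT \<xi>|(lborel :: 'c measure). 0)"
      proof (rule integral_dominated_convergence)
        show "integrable lborel (\<lambda>\<xi>. 2 * H \<xi>)"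
          using intH by simp
        show "AE \<xi> in lborel. norm (q (Y i) \<xi>) \<le> 2 * H \<xi>" for i
          using AE_q by eventually_elim (use Y in blast)
        show "AE \<xi> in lborel. (\<lambda>i. q (Y i) \<xi>) \<longlonglongrightarrow> 0"
        proof (rule AE_I2)
          fix \<xi>
          have "((\<lambda>y. q y \<xi>) \<longlongrightarrow> 0) (at z within B)"
            using has_derivative_at_withinI[OF der[OF Z(2), of \<xi>], of B]
            unfolding has_derivative_at_within q_def by blast
          then show "(\<lambda>i. q (Y i) \<xi>) \<longlonglongrightarrow> 0"
            using Y unfolding tendsto_at_iff_sequentially by (auto simp: o_def)
        qed
        show "(\<lambda>\<xi>. q (Y i) \<xi>) \<in> borel_measurable lborel" for i
        proof -
          have "Y i \<in> Z"
            using Y B by auto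
          then show ?thesis
            unfolding q_def
            by (intro borel_measurable_scaleR borel_measurable_const borel_measurable_diff
                borel_measurable_integrable int\<phi> int_sum Z)
        qed
      qed simp
      then show "((\<lambda>y. ((?F y - ?F z) - ?F' (y - z)) /\<^sub>R norm (y - z)) \<circ> Y) \<longlonglongrightarrow> 0"
        using int_q Y B by (simp add: o_def subset_iff)
    qed
  qed
  then have "(?F has_derivative ?F') (at z)"
    using B at_within_open[of z B] by simp
  then show ?thesis
    by (simp add: set_lebesgue_integral_def \<phi>_def \<psi>_def)
qed

lemma
  fixes \<Phi> :: "'a::euclidean_space \<Rightarrow> 'c::euclidean_space \<Rightarrow> complex"
  assumes "open Z" "z \<in> Z"
    and "\<And>z. z \<in> Z \<Longrightarrow> set_borel_measurable lborel \<Xi> (\<Phi> z)"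
      "\<And>b z. b \<in> Basis \<Longrightarrow> z \<in> Z \<Longrightarrow> set_borel_measurable lborel \<Xi> (\<Psi> b z)"
    and "\<And>z \<xi>. z \<in> Z \<Longrightarrow> \<xi> \<in> \<Xi> \<Longrightarrow> (\<lambda>z. \<Phi> z \<xi>) differentiable at z"
    and "\<And>b z \<xi>. b \<in> Basis \<Longrightarrow> z \<in> Z \<Longrightarrow> \<xi> \<in> \<Xi> \<Longrightarrow> partial_deriv b (\<lambda>z. \<Phi> z \<xi>) z = \<Psi> b z \<xi>"
    and "locally_L1_dominated Z \<Xi> \<Phi>" "\<And>b. b \<in> Basis \<Longrightarrow> locally_L1_dominated Z \<Xi> (\<Psi> b)"
  shows differentiable_set_integral: "(\<lambda>z. LINT \<xi>:\<Xi>|lborel. \<Phi> z \<xi>) differentiable at z"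
    and partial_deriv_set_integral:
      "b \<in> Basis \<Longrightarrow> partial_deriv b (\<lambda>z. LINT \<xi>:\<Xi>|lborel. \<Phi> z \<xi>) z = (LINT \<xi>:\<Xi>|lborel. \<Psi> b z \<xi>)"
proof -
  note der = has_derivative_set_integral[of Z z \<Xi> \<Phi> \<Psi>, OF assms]
  show "(\<lambda>z. LINT \<xi>:\<Xi>|lborel. \<Phi> z \<xi>) differentiable at z"
    using der by (rule differentiableI)
  assume b: "b \<in> Basis"
  have "(\<Sum>c\<in>Basis. (b \<bullet> c) *\<^sub>R (LINT \<xi>:\<Xi>|lborel. \<Psi> c z \<xi>)) =
      (\<Sum>c\<in>Basis. if c = b then LINT \<xi>:\<Xi>|lborel. \<Psi> c z \<xi> else 0)"
    using b by (intro sum.cong) (auto simp: inner_Basis)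
  then show "partial_deriv b (\<lambda>z. LINT \<xi>:\<Xi>|lborel. \<Phi> z \<xi>) z = (LINT \<xi>:\<Xi>|lborel. \<Psi> b z \<xi>)"
    using partial_deriv_eq[OF der, of b] b by simp
qed

section \<open>Functions on products\<close>

lemma L2_sq_times:
  fixes f :: "'a::euclidean_space \<times> 'b::euclidean_space \<Rightarrow> complex"
  assumes "set_borel_measurable lborel (A \<times> B) f"
  shows L2_sq_times_fst: "L2_sq (A \<times> B) f =
      (\<integral>\<^sup>+x. \<integral>\<^sup>+y. ennreal ((norm (indicator (A \<times> B) (x, y) *\<^sub>R f (x, y)))\<^sup>2) \<partial>lborel \<partial>lborel)"
    and L2_sq_times_snd: "L2_sq (A \<times> B) f =
      (\<integral>\<^sup>+y. \<integral>\<^sup>+x. ennreal ((norm (indicator (A \<times> B) (x, y) *\<^sub>R f (x, y)))\<^sup>2) \<partial>lborel \<partial>lborel)"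
proof -
  have [measurable]: "(\<lambda>p. indicator (A \<times> B) p *\<^sub>R f p) \<in> borel_measurable (lborel \<Otimes>\<^sub>M lborel)"
    using assms by (simp add: set_borel_measurable_def lborel_prod)
  have m: "(\<lambda>p. ennreal ((norm (indicator (A \<times> B) p *\<^sub>R f p))\<^sup>2)) \<in> borel_measurable (lborel \<Otimes>\<^sub>M lborel)"
    by measurable
  show "L2_sq (A \<times> B) f =
      (\<integral>\<^sup>+x. \<integral>\<^sup>+y. ennreal ((norm (indicator (A \<times> B) (x, y) *\<^sub>R f (x, y)))\<^sup>2) \<partial>lborel \<partial>lborel)"
    unfolding L2_sq_def lborel_prod[symmetric] using lborel.nn_integral_fst[OF m] by simp
  show "L2_sq (A \<times> B) f =
      (\<integral>\<^sup>+y. \<integral>\<^sup>+x. ennreal ((norm (indicator (A \<times> B) (x, y) *\<^sub>R f (x, y)))\<^sup>2) \<partial>lborel \<partial>lborel)"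
    unfolding L2_sq_def lborel_prod[symmetric] using lborel_pair.nn_integral_snd[OF m] by simp
qed

lemma set_borel_measurable_Pair:
  fixes f :: "'a::euclidean_space \<times> 'b::euclidean_space \<Rightarrow> complex"
  assumes "set_borel_measurable lborel (A \<times> B) f"
  shows set_borel_measurable_Pair1: "x \<in> A \<Longrightarrow> set_borel_measurable lborel B (\<lambda>y. f (x, y))"
    and set_borel_measurable_Pair2: "y \<in> B \<Longrightarrow> set_borel_measurable lborel A (\<lambda>x. f (x, y))"
proof -
  have k: "(\<lambda>p. indicator (A \<times> B) p *\<^sub>R f p) \<in> borel_measurable (lborel \<Otimes>\<^sub>M lborel)"
    using assms by (simp add: set_borel_measurable_def lborel_prod)
  show "set_borel_measurable lborel B (\<lambda>y. f (x, y))" if "x \<in> A"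
  proof -
    have "(\<lambda>y. indicator (A \<times> B) (x, y) *\<^sub>R f (x, y)) \<in> borel_measurable lborel"
      by (rule measurable_compose_Pair1[OF _ k]) simp
    then show ?thesis
      using that by (simp add: set_borel_measurable_def indicator_times)
  qed
  show "set_borel_measurable lborel A (\<lambda>x. f (x, y))" if "y \<in> B"
  proof -
    have "(\<lambda>x. indicator (A \<times> B) (x, y) *\<^sub>R f (x, y)) \<in> borel_measurable lborel"
      by (rule measurable_compose[OF _ k]) measurable
    then show ?thesis
      using that by (simp add: set_borel_measurable_def indicator_times)
  qed
qed

section \<open>Slices of functions on a product\<close>

lemma partial_deriv_fst:
  "partial_deriv b (\<lambda>x. h (x, y)) x = partial_deriv (b, 0) h (x, y)"
  by (simp add: partial_deriv_def)

lemma partial_deriv_snd: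
  "partial_deriv b (\<lambda>y. h (x, y)) y = partial_deriv (0, b) h (x, y)"
  by (simp add: partial_deriv_def)

text \<open>The slice along b and the function along (b, 0) are the same function of one real
  variable, so the identity holds everywhere, even where no derivative exists, and iterates
  freely.\<close>

lemma partial_derivs_fst:
  "partial_derivs w (\<lambda>x. h (x, y)) = (\<lambda>x. partial_derivs (map (\<lambda>b. (b, 0)) w) h (x, y))"
  by (induction w) (auto simp: partial_deriv_fst)

lemma partial_derivs_snd:
  "partial_derivs w (\<lambda>y. h (x, y)) = (\<lambda>y. partial_derivs (map (\<lambda>b. (0, b)) w) h (x, y))"
  by (induction w) (auto simp: partial_deriv_snd)

lemma Basis_PairI: "b \<in> Basis \<Longrightarrow> (b, 0) \<in> Basis" "b \<in> Basis \<Longrightarrow> (0, b) \<in> Basis"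
  by (auto simp: Basis_prod_def)

lemma differentiable_Pair1:
  assumes "h differentiable at (x, y)"
  shows "(\<lambda>x. h (x, y)) differentiable at x"
proof -
  have "(\<lambda>x. (x, y)) differentiable at x"
    unfolding differentiable_def by (auto intro!: exI derivative_eq_intros)
  from differentiable_chain_at[OF this assms] show ?thesis
    by (simp add: o_def)
qed

lemma differentiable_Pair2:
  assumes "h differentiable at (x, y)"
  shows "(\<lambda>y. h (x, y)) differentiable at y"
proof -
  have "(\<lambda>y. (x, y)) differentiable at y"
    unfolding differentiable_def by (auto intro!: exI derivative_eq_intros)
  from differentiable_chain_at[OF this assms] show ?thesis
    by (simp add: o_def)
qed

text \<open>Slices of smooth functions form a class closed under partial derivatives, since
  differentiating a slice is slicing a derivative.\<close>

lemma smooth_on_Pair1: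
  assumes "open X" "open Y" "smooth_on (X \<times> Y) h" "y \<in> Y"
  shows "smooth_on X (\<lambda>x. h (x, y))"
proof (rule smooth_on_coinduct[where P="\<lambda>u. \<exists>h. smooth_on (X \<times> Y) h \<and> u = (\<lambda>x. h (x, y))"])
  show "u differentiable_on X" if u: "\<exists>h. smooth_on (X \<times> Y) h \<and> u = (\<lambda>x. h (x, y))" for u
  proof -
    obtain h where h: "smooth_on (X \<times> Y) h" "u = (\<lambda>x. h (x, y))"
      using u by blast
    have "h differentiable at (x, y)" if "x \<in> X" for x
      using smooth_on_imp_differentiable[OF h(1)] assms that by (simp add: open_Times)
    then show ?thesis
      unfolding h(2) differentiable_on_eq_differentiable_at[OF assms(1)]
      by (intro ballI differentiable_Pair1)
  qed
  show "\<exists>v. (\<exists>h. smooth_on (X \<times> Y) h \<and> v = (\<lambda>x. h (x, y))) \<and> (\<forall>x\<in>X. partial_deriv b u x = v x)"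
    if u: "\<exists>h. smooth_on (X \<times> Y) h \<and> u = (\<lambda>x. h (x, y))" and b: "b \<in> Basis" for u b
  proof -
    obtain h where h: "smooth_on (X \<times> Y) h" "u = (\<lambda>x. h (x, y))"
      using u by blast
    show ?thesis
      unfolding h(2) partial_deriv_fst
      using smooth_on_partial_deriv[OF h(1) Basis_PairI(1)[OF b]] by blast
  qed
qed (use assms in auto)

lemma smooth_on_Pair2:
  assumes "open X" "open Y" "smooth_on (X \<times> Y) h" "x \<in> X"
  shows "smooth_on Y (\<lambda>y. h (x, y))"
proof (rule smooth_on_coinduct[where P="\<lambda>u. \<exists>h. smooth_on (X \<times> Y) h \<and> u = (\<lambda>y. h (x, y))"])
  show "u differentiable_on Y" if u: "\<exists>h. smooth_on (X \<times> Y) h \<and> u = (\<lambda>y. h (x, y))" for u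
  proof -
    obtain h where h: "smooth_on (X \<times> Y) h" "u = (\<lambda>y. h (x, y))"
      using u by blast
    have "h differentiable at (x, y)" if "y \<in> Y" for y
      using smooth_on_imp_differentiable[OF h(1)] assms that by (simp add: open_Times)
    then show ?thesis
      unfolding h(2) differentiable_on_eq_differentiable_at[OF assms(2)]
      by (intro ballI differentiable_Pair2)
  qed
  show "\<exists>v. (\<exists>h. smooth_on (X \<times> Y) h \<and> v = (\<lambda>y. h (x, y))) \<and> (\<forall>y\<in>Y. partial_deriv b u y = v y)"
    if u: "\<exists>h. smooth_on (X \<times> Y) h \<and> u = (\<lambda>y. h (x, y))" and b: "b \<in> Basis" for u b
  proof -
    obtain h where h: "smooth_on (X \<times> Y) h" "u = (\<lambda>y. h (x, y))"
      using u by blast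
    show ?thesis
      unfolding h(2) partial_deriv_snd
      using smooth_on_partial_deriv[OF h(1) Basis_PairI(2)[OF b]] by blast
  qed
qed (use assms in auto)

lemma H_inf_measurable:
  "f \<in> H_inf \<Omega> \<Longrightarrow> open \<Omega> \<Longrightarrow> set_borel_measurable lborel \<Omega> f"
  using set_borel_measurable_smooth H_inf_smooth by blast

text \<open>Derivatives of the slices in x are slices of derivatives of h, whose squares are
  integrable over the product; Tonelli turns this into the iterated integral of \<open>fin\<close>,
  with \<xi> as the outer variable.\<close>

lemma locally_L2_dominated_fst:
  assumes "open X" "open \<Xi>" "h \<in> H_inf (X \<times> \<Xi>)"
  shows "locally_L2_dominated X \<Xi> (\<lambda>x \<xi>. h (x, \<xi>))"
proof (rule locally_L2_dominated_smooth[OF assms(1)])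
  show "smooth_on X (\<lambda>x. h (x, \<xi>))" if "\<xi> \<in> \<Xi>" for \<xi>
    by (rule smooth_on_Pair1[OF assms(1,2) H_inf_smooth[OF assms(3)] that])
  fix w :: "'a list" assume w: "set w \<subseteq> Basis"
  define k where "k = partial_derivs (map (\<lambda>b. (b, 0)) w) h"
  have "open (X \<times> \<Xi>)"
    using assms by (simp add: open_Times)
  then have k: "k \<in> H_inf (X \<times> \<Xi>)"
    unfolding k_def using w assms(3) by (intro H_inf_partial_derivs) (auto intro: Basis_PairI)
  have k_meas: "set_borel_measurable lborel (X \<times> \<Xi>) k"
    using H_inf_measurable[OF k \<open>open (X \<times> \<Xi>)\<close>] .
  have eq: "indicator X x *\<^sub>R (indicator \<Xi> \<xi> *\<^sub>R partial_derivs w (\<lambda>x. h (x, \<xi>)) x) = indicator (X \<times> \<Xi>) (x, \<xi>) *\<^sub>R k (x, \<xi>)" for x \<xi>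
    by (auto simp: partial_derivs_fst k_def indicator_def)
  have "(\<lambda>p. indicator (X \<times> \<Xi>) p *\<^sub>R k p) \<in> borel_measurable (lborel \<Otimes>\<^sub>M lborel)"
    using k_meas by (simp add: set_borel_measurable_def lborel_prod)
  \<comment> \<open>Measurability is required for the pair (\<xi>, x), which has the order opposite
    to X \<times> \<Xi>.\<close>
  from measurable_pair_swap[OF this]
  show "(\<lambda>(\<xi>, x). indicator X x *\<^sub>R (indicator \<Xi> \<xi> *\<^sub>R partial_derivs w (\<lambda>x. h (x, \<xi>)) x))
      \<in> borel_measurable (lborel \<Otimes>\<^sub>M lborel)"
    unfolding eq .
  show "(\<integral>\<^sup>+\<xi>. \<integral>\<^sup>+x. ennreal ((norm (indicator X x *\<^sub>R (indicator \<Xi> \<xi> *\<^sub>R partial_derivs w (\<lambda>x. h (x, \<xi>)) x)))\<^sup>2) \<partial>lborel \<partial>lborel) < \<infinity>"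
    unfolding eq L2_sq_times_snd[OF k_meas, symmetric]
    using H_inf_L2[OF k \<open>open (X \<times> \<Xi>)\<close>] by (simp add: L2_on_iff)
qed

lemma locally_L2_dominated_snd:
  assumes "open \<Xi>" "open Y" "h \<in> H_inf (\<Xi> \<times> Y)"
  shows "locally_L2_dominated Y \<Xi> (\<lambda>y \<xi>. h (\<xi>, y))"
proof (rule locally_L2_dominated_smooth[OF assms(2)])
  show "smooth_on Y (\<lambda>y. h (\<xi>, y))" if "\<xi> \<in> \<Xi>" for \<xi>
    by (rule smooth_on_Pair2[OF assms(1,2) H_inf_smooth[OF assms(3)] that])
  fix w :: "'b list" assume w: "set w \<subseteq> Basis"
  define k where "k = partial_derivs (map (\<lambda>b. (0, b)) w) h"
  have "open (\<Xi> \<times> Y)"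
    using assms by (simp add: open_Times)
  then have k: "k \<in> H_inf (\<Xi> \<times> Y)"
    unfolding k_def using w assms(3) by (intro H_inf_partial_derivs) (auto intro: Basis_PairI)
  have k_meas: "set_borel_measurable lborel (\<Xi> \<times> Y) k"
    using H_inf_measurable[OF k \<open>open (\<Xi> \<times> Y)\<close>] .
  have eq: "indicator Y y *\<^sub>R (indicator \<Xi> \<xi> *\<^sub>R partial_derivs w (\<lambda>y. h (\<xi>, y)) y) = indicator (\<Xi> \<times> Y) (\<xi>, y) *\<^sub>R k (\<xi>, y)" for y \<xi>
    by (auto simp: partial_derivs_snd k_def indicator_def)
  have "(\<lambda>p. indicator (\<Xi> \<times> Y) p *\<^sub>R k p) \<in> borel_measurable (lborel \<Otimes>\<^sub>M lborel)"
    using k_meas by (simp add: set_borel_measurable_def lborel_prod)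
  then show "(\<lambda>(\<xi>, y). indicator Y y *\<^sub>R (indicator \<Xi> \<xi> *\<^sub>R partial_derivs w (\<lambda>y. h (\<xi>, y)) y))
      \<in> borel_measurable (lborel \<Otimes>\<^sub>M lborel)"
    unfolding eq by simp
  show "(\<integral>\<^sup>+\<xi>. \<integral>\<^sup>+y. ennreal ((norm (indicator Y y *\<^sub>R (indicator \<Xi> \<xi> *\<^sub>R partial_derivs w (\<lambda>y. h (\<xi>, y)) y)))\<^sup>2) \<partial>lborel \<partial>lborel) < \<infinity>"
    unfolding eq L2_sq_times_fst[OF k_meas, symmetric]
    using H_inf_L2[OF k \<open>open (\<Xi> \<times> Y)\<close>] by (simp add: L2_on_iff)
qed

section \<open>Cauchy-Schwarz and the domination of products\<close>

lemma integrable_mult_L2: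
  fixes f g :: "'c::euclidean_space \<Rightarrow> 'd::{real_normed_field, banach, second_countable_topology}"
  assumes [measurable]: "f \<in> borel_measurable lborel" "g \<in> borel_measurable lborel"
    and "(\<integral>\<^sup>+x. ennreal ((norm (f x))\<^sup>2) \<partial>lborel) < \<infinity>" "(\<integral>\<^sup>+x. ennreal ((norm (g x))\<^sup>2) \<partial>lborel) < \<infinity>"
  shows "integrable lborel (\<lambda>x. f x * g x)"
  unfolding integrable_iff_bounded
proof
  have "(\<integral>\<^sup>+x. ennreal (norm (f x * g x)) \<partial>lborel)\<^sup>2 = (\<integral>\<^sup>+x. ennreal (norm (f x)) * ennreal (norm (g x)) \<partial>lborel)\<^sup>2"
    by (simp add: norm_mult ennreal_mult)
  also have "\<dots> \<le> (\<integral>\<^sup>+x. (ennreal (norm (f x)))\<^sup>2 \<partial>lborel) * (\<integral>\<^sup>+x. (ennreal (norm (g x)))\<^sup>2 \<partial>lborel)"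
    by (intro Cauchy_Schwarz_nn_integral) measurable
  also have "\<dots> < \<infinity>"
    using assms(3,4) by (simp add: ennreal_power ennreal_mult_less_top)
  finally show "(\<integral>\<^sup>+x. ennreal (norm (f x * g x)) \<partial>lborel) < \<infinity>"
    by (auto simp: less_top[symmetric] power2_eq_square ennreal_mult_eq_top_iff ennreal_top_mult)
qed measurable

text \<open>Cauchy-Schwarz on \<Xi>, with no claim of integrability: if the product is not
  integrable, its Bochner integral is 0 by convention and the inequality is trivial.\<close>

lemma norm_set_integral_mult_le:
  assumes "set_borel_measurable lborel \<Xi> a" "set_borel_measurable lborel \<Xi> b"
  shows "ennreal ((norm (LINT \<xi>:\<Xi>|lborel. a \<xi> * b \<xi>))\<^sup>2) \<le> L2_sq \<Xi> a * L2_sq \<Xi> b"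
proof -
  let ?a = "\<lambda>\<xi>. indicator \<Xi> \<xi> *\<^sub>R a \<xi>" and ?b = "\<lambda>\<xi>. indicator \<Xi> \<xi> *\<^sub>R b \<xi>"
  have [measurable]: "?a \<in> borel_measurable lborel" "?b \<in> borel_measurable lborel"
    using assms by (auto simp: set_borel_measurable_def)
  have eq: "(LINT \<xi>:\<Xi>|lborel. a \<xi> * b \<xi>) = (LINT \<xi>|lborel. ?a \<xi> * ?b \<xi>)"
    unfolding set_lebesgue_integral_def
    by (intro Bochner_Integration.integral_cong) (auto simp: indicator_def)
  have "ennreal (norm (LINT \<xi>|lborel. ?a \<xi> * ?b \<xi>)) \<le> (\<integral>\<^sup>+\<xi>. ennreal (norm (?a \<xi> * ?b \<xi>)) \<partial>lborel)"
  proof (cases "integrable lborel (\<lambda>\<xi>. ?a \<xi> * ?b \<xi>)")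
    case True
    then show ?thesis
      by (rule integral_norm_bound_ennreal)
  next
    case False
    show ?thesis
      unfolding not_integrable_integral_eq[OF False] by simp
  qed
  also have "\<dots> = (\<integral>\<^sup>+\<xi>. ennreal (norm (?a \<xi>)) * ennreal (norm (?b \<xi>)) \<partial>lborel)"
    by (simp only: norm_mult ennreal_mult norm_ge_zero)
  finally have "(ennreal (norm (LINT \<xi>|lborel. ?a \<xi> * ?b \<xi>)))\<^sup>2 \<le> (\<integral>\<^sup>+\<xi>. ennreal (norm (?a \<xi>)) * ennreal (norm (?b \<xi>)) \<partial>lborel)\<^sup>2"
    by (rule power_mono) simp
  also have "\<dots> \<le> (\<integral>\<^sup>+\<xi>. (ennreal (norm (?a \<xi>)))\<^sup>2 \<partial>lborel) * (\<integral>\<^sup>+\<xi>. (ennreal (norm (?b \<xi>)))\<^sup>2 \<partial>lborel)"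
    by (intro Cauchy_Schwarz_nn_integral) measurable
  also have "\<dots> = L2_sq \<Xi> a * L2_sq \<Xi> b"
    by (simp only: L2_sq_def ennreal_power norm_ge_zero)
  finally show ?thesis
    by (simp only: eq ennreal_power norm_ge_zero)
qed

text \<open>G times |u| dominates and is integrable by Cauchy-Schwarz; u does not involve x, so the
  neighbourhood is unchanged.\<close>

lemma locally_L1_dominated_mult:
  assumes "locally_L2_dominated X \<Xi> h" "u \<in> L2_on \<Xi>"
  shows "locally_L1_dominated X \<Xi> (\<lambda>x \<xi>. h x \<xi> * u \<xi>)"
  unfolding locally_L1_dominated_def
proof
  fix x0 assume "x0 \<in> X"
  then obtain U G where UG: "open U" "x0 \<in> U" "U \<subseteq> X" "G \<in> borel_measurable lborel"
    "(\<integral>\<^sup>+\<xi>. ennreal ((G \<xi>)\<^sup>2) \<partial>lborel) < \<infinity>"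
    "AE \<xi> in lborel. \<forall>x\<in>U. norm (indicator \<Xi> \<xi> *\<^sub>R h x \<xi>) \<le> G \<xi>"
    using assms(1) unfolding locally_L2_dominated_def by blast
  let ?v = "\<lambda>\<xi>. norm (indicator \<Xi> \<xi> *\<^sub>R u \<xi>)"
  have "(\<lambda>\<xi>. indicator \<Xi> \<xi> *\<^sub>R u \<xi>) \<in> borel_measurable lborel"
    using assms(2) by (simp add: L2_on_iff set_borel_measurable_def)
  then have "?v \<in> borel_measurable lborel"
    by measurable
  moreover have "(\<integral>\<^sup>+\<xi>. ennreal ((norm (?v \<xi>))\<^sup>2) \<partial>lborel) < \<infinity>"
    using assms(2) by (simp only: L2_on_iff L2_sq_def real_norm_def power2_abs)
  ultimately have "integrable lborel (\<lambda>\<xi>. G \<xi> * ?v \<xi>)"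
    using UG(4,5) by (intro integrable_mult_L2) auto
  moreover have "AE \<xi> in lborel. \<forall>x\<in>U. norm (indicator \<Xi> \<xi> *\<^sub>R (h x \<xi> * u \<xi>)) \<le> G \<xi> * ?v \<xi>"
    using UG(6)
  proof eventually_elim
    fix \<xi> assume *: "\<forall>x\<in>U. norm (indicator \<Xi> \<xi> *\<^sub>R h x \<xi>) \<le> G \<xi>"
    show "\<forall>x\<in>U. norm (indicator \<Xi> \<xi> *\<^sub>R (h x \<xi> * u \<xi>)) \<le> G \<xi> * ?v \<xi>"
    proof
      fix x assume "x \<in> U"
      have "norm (indicator \<Xi> \<xi> *\<^sub>R (h x \<xi> * u \<xi>)) = norm (indicator \<Xi> \<xi> *\<^sub>R h x \<xi>) * ?v \<xi>"
        by (auto simp: indicator_def norm_mult)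
      then show "norm (indicator \<Xi> \<xi> *\<^sub>R (h x \<xi> * u \<xi>)) \<le> G \<xi> * ?v \<xi>"
        using * \<open>x \<in> U\<close> mult_right_mono[OF _ norm_ge_zero] by metis
    qed
  qed
  ultimately show "\<exists>U G. open U \<and> x0 \<in> U \<and> U \<subseteq> X \<and> integrable lborel G \<and>
     (AE \<xi> in lborel. \<forall>x\<in>U. norm (indicator \<Xi> \<xi> *\<^sub>R (h x \<xi> * u \<xi>)) \<le> G \<xi>)"
    using UG(1-3) by blast
qed

text \<open>The parameter is now the pair (x, y), with neighbourhood U \<times> V, and the
  dominating function is the product of the two L2 bounds. This is where domination of each kernel
  uniformly in its own free variable pays off.\<close>

lemma locally_L1_dominated_mult2:
  assumes "locally_L2_dominated X \<Xi> h1" "locally_L2_dominated Y \<Xi> h2"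
  shows "locally_L1_dominated (X \<times> Y) \<Xi> (\<lambda>z \<xi>. h1 (fst z) \<xi> * h2 (snd z) \<xi>)"
  unfolding locally_L1_dominated_def
proof
  fix z0 assume "z0 \<in> X \<times> Y"
  then have z0: "fst z0 \<in> X" "snd z0 \<in> Y"
    by auto
  obtain U G where UG: "open U" "fst z0 \<in> U" "U \<subseteq> X" "G \<in> borel_measurable lborel"
    "(\<integral>\<^sup>+\<xi>. ennreal ((G \<xi>)\<^sup>2) \<partial>lborel) < \<infinity>"
    "AE \<xi> in lborel. \<forall>x\<in>U. norm (indicator \<Xi> \<xi> *\<^sub>R h1 x \<xi>) \<le> G \<xi>"
    using assms(1) z0(1) unfolding locally_L2_dominated_def by blast
  obtain V K where VK: "open V" "snd z0 \<in> V" "V \<subseteq> Y" "K \<in> borel_measurable lborel"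
    "(\<integral>\<^sup>+\<xi>. ennreal ((K \<xi>)\<^sup>2) \<partial>lborel) < \<infinity>"
    "AE \<xi> in lborel. \<forall>y\<in>V. norm (indicator \<Xi> \<xi> *\<^sub>R h2 y \<xi>) \<le> K \<xi>"
    using assms(2) z0(2) unfolding locally_L2_dominated_def by blast
  have "integrable lborel (\<lambda>\<xi>. G \<xi> * K \<xi>)"
    using UG(4,5) VK(4,5) by (intro integrable_mult_L2) auto
  moreover have "AE \<xi> in lborel. \<forall>z\<in>U \<times> V. norm (indicator \<Xi> \<xi> *\<^sub>R (h1 (fst z) \<xi> * h2 (snd z) \<xi>)) \<le> G \<xi> * K \<xi>"
    using UG(6) VK(6)
  proof eventually_elim
    fix \<xi> assume *: "\<forall>x\<in>U. norm (indicator \<Xi> \<xi> *\<^sub>R h1 x \<xi>) \<le> G \<xi>" "\<forall>y\<in>V. norm (indicator \<Xi> \<xi> *\<^sub>R h2 y \<xi>) \<le> K \<xi>"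
    show "\<forall>z\<in>U \<times> V. norm (indicator \<Xi> \<xi> *\<^sub>R (h1 (fst z) \<xi> * h2 (snd z) \<xi>)) \<le> G \<xi> * K \<xi>"
    proof
      fix z assume z: "z \<in> U \<times> V"
      have 1: "norm (indicator \<Xi> \<xi> *\<^sub>R (h1 (fst z) \<xi> * h2 (snd z) \<xi>)) =
          norm (indicator \<Xi> \<xi> *\<^sub>R h1 (fst z) \<xi>) * norm (indicator \<Xi> \<xi> *\<^sub>R h2 (snd z) \<xi>)"
        by (auto simp: indicator_def norm_mult)
      have 2: "norm (indicator \<Xi> \<xi> *\<^sub>R h1 (fst z) \<xi>) \<le> G \<xi>" "norm (indicator \<Xi> \<xi> *\<^sub>R h2 (snd z) \<xi>) \<le> K \<xi>"
        using * z by (auto simp del: norm_scaleR)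
      show "norm (indicator \<Xi> \<xi> *\<^sub>R (h1 (fst z) \<xi> * h2 (snd z) \<xi>)) \<le> G \<xi> * K \<xi>"
        unfolding 1 by (rule mult_mono[OF 2 order_trans[OF norm_ge_zero 2(1)] norm_ge_zero])
    qed
  qed
  moreover have "open (U \<times> V)" "z0 \<in> U \<times> V" "U \<times> V \<subseteq> X \<times> Y"
    using UG(1-3) VK(1-3) by (auto simp: open_Times mem_Times_iff)
  ultimately show "\<exists>U G. open U \<and> z0 \<in> U \<and> U \<subseteq> X \<times> Y \<and> integrable lborel G \<and>
     (AE \<xi> in lborel. \<forall>z\<in>U. norm (indicator \<Xi> \<xi> *\<^sub>R (h1 (fst z) \<xi> * h2 (snd z) \<xi>)) \<le> G \<xi>)"
    by blast
qed

section \<open>Integral operators and composed kernels\<close>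

text \<open>The operator of \<open>gen_int_op\<close> for a single parameter \<epsilon>, before
  passing to classes.\<close>

definition int_op :: "'c::euclidean_space set \<Rightarrow> ('a::euclidean_space \<times> 'c \<Rightarrow> complex) \<Rightarrow> ('c \<Rightarrow> complex) \<Rightarrow> 'a \<Rightarrow> complex" where
  "int_op \<Xi> h u = (\<lambda>x. LINT \<xi>:\<Xi>|lborel. h (x, \<xi>) * u \<xi>)"

text \<open>Written with projections instead of a pattern, so that the integrand is directly a
  function of a point of the product space, to be differentiated along its basis vectors.\<close>

definition comp_kernel ::
  "'c::euclidean_space set \<Rightarrow> ('a::euclidean_space \<times> 'c \<Rightarrow> complex) \<Rightarrow> ('c \<times> 'b::euclidean_space \<Rightarrow> complex) \<Rightarrow>
   'a \<times> 'b \<Rightarrow> complex" where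
  "comp_kernel \<Xi> h1 h2 = (\<lambda>z. LINT \<xi>:\<Xi>|lborel. h1 (fst z, \<xi>) * h2 (\<xi>, snd z))"

text \<open>A basis vector of the product is \<open>(b, 0)\<close> or \<open>(0, b)\<close>, and differentiates only one of the factors.\<close>

definition left_deriv :: "'a::euclidean_space \<times> 'b::euclidean_space \<Rightarrow> ('a \<times> 'c::euclidean_space \<Rightarrow> complex) \<Rightarrow> 'a \<times> 'c \<Rightarrow> complex" where
  "left_deriv c h = (if snd c = 0 then partial_deriv (fst c, 0) h else h)"

definition right_deriv :: "'a::euclidean_space \<times> 'b::euclidean_space \<Rightarrow> ('c::euclidean_space \<times> 'b \<Rightarrow> complex) \<Rightarrow> 'c \<times> 'b \<Rightarrow> complex" where
  "right_deriv c h = (if snd c = 0 then h else partial_deriv (0, snd c) h)"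

text \<open>The second alternative records \<open>snd c \<noteq> 0\<close>, the test by which
  \<open>left_deriv\<close> and \<open>right_deriv\<close> decide which factor to
  differentiate.\<close>

lemma Basis_prod_cases:
  assumes "(c :: 'a::euclidean_space \<times> 'b::euclidean_space) \<in> Basis"
  obtains "fst c \<in> Basis" "snd c = 0" | "fst c = 0" "snd c \<in> Basis" "snd c \<noteq> 0"
  using assms by (auto simp: Basis_prod_def) (metis nonzero_Basis)

lemma partial_deriv_mult_right:
  "f differentiable at x \<Longrightarrow> partial_deriv b (\<lambda>x. f x * c) x = partial_deriv b f x * c"
proof -
  assume "f differentiable at x"
  then obtain f' where f': "(f has_derivative f') (at x)"
    by (auto simp: differentiable_def)
  show ?thesis
    using partial_deriv_eq[OF has_derivative_mult_left[OF f']] partial_deriv_eq[OF f'] by simp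
qed

lemma set_borel_measurable_mult:
  fixes a b :: "'c::euclidean_space \<Rightarrow> complex"
  assumes "set_borel_measurable lborel \<Xi> a" "set_borel_measurable lborel \<Xi> b"
  shows "set_borel_measurable lborel \<Xi> (\<lambda>\<xi>. a \<xi> * b \<xi>)"
proof -
  have "(\<lambda>\<xi>. (indicator \<Xi> \<xi> *\<^sub>R a \<xi>) * (indicator \<Xi> \<xi> *\<^sub>R b \<xi>)) \<in> borel_measurable lborel"
    using assms unfolding set_borel_measurable_def by (rule borel_measurable_times)
  also have "(\<lambda>\<xi>. (indicator \<Xi> \<xi> *\<^sub>R a \<xi>) * (indicator \<Xi> \<xi> *\<^sub>R b \<xi>)) = (\<lambda>\<xi>. indicator \<Xi> \<xi> *\<^sub>R (a \<xi> * b \<xi>))"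
    by (auto simp: indicator_def)
  finally show ?thesis
    by (simp add: set_borel_measurable_def)
qed

section \<open>Integral operators with a kernel in \<open>H_inf\<close>\<close>

context
  fixes X :: "'a::euclidean_space set" and \<Xi> :: "'c::euclidean_space set"
  assumes X: "open X" and \<Xi>: "open \<Xi>"
begin

text \<open>Local domination gives integrability at every x of X. It makes the operator additive in
  kernel and function, which could fail for Bochner integrals of functions that are not
  integrable.\<close>

lemma int_op_set_integrable:
  assumes "h \<in> H_inf (X \<times> \<Xi>)" "u \<in> L2_on \<Xi>" "x \<in> X"
  shows "set_integrable lborel \<Xi> (\<lambda>\<xi>. h (x, \<xi>) * u \<xi>)"
  using set_integrable_dominated[OF locally_L1_dominated_mult[OF locally_L2_dominated_fst[OF X \<Xi> assms(1)] assms(2)] assms(3)]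
    set_borel_measurable_mult[OF set_borel_measurable_Pair1[OF H_inf_measurable[OF assms(1)] assms(3)]] assms(2)
  by (simp add: open_Times X \<Xi> L2_on_iff)

text \<open>All derivatives fall on the kernel, so square integrability of u is enough.\<close>

lemma
  assumes h: "h \<in> H_inf (X \<times> \<Xi>)" and u: "u \<in> L2_on \<Xi>" and x: "x \<in> X"
  shows int_op_differentiable: "int_op \<Xi> h u differentiable at x"
    and int_op_partial_deriv: "b \<in> Basis \<Longrightarrow> partial_deriv b (int_op \<Xi> h u) x = int_op \<Xi> (partial_deriv (b, 0) h) u x"
proof -
  have op: "open (X \<times> \<Xi>)"
    by (simp add: open_Times X \<Xi>)
  have meas: "set_borel_measurable lborel \<Xi> (\<lambda>\<xi>. k (x, \<xi>) * u \<xi>)" if "k \<in> H_inf (X \<times> \<Xi>)" "x \<in> X" for k x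
    using u by (intro set_borel_measurable_mult set_borel_measurable_Pair1[OF H_inf_measurable[OF that(1) op] that(2)])
      (simp add: L2_on_iff)
  have dom: "locally_L1_dominated X \<Xi> (\<lambda>x \<xi>. k (x, \<xi>) * u \<xi>)" if "k \<in> H_inf (X \<times> \<Xi>)" for k
    by (intro locally_L1_dominated_mult[OF locally_L2_dominated_fst] X \<Xi> that u)
  have diff: "(\<lambda>x. h (x, \<xi>)) differentiable at x" if "x \<in> X" "\<xi> \<in> \<Xi>" for x \<xi>
    using smooth_on_imp_differentiable[OF H_inf_smooth[OF h] op] that by (intro differentiable_Pair1) auto
  have db: "partial_deriv (b, 0) h \<in> H_inf (X \<times> \<Xi>)" if "b \<in> Basis" for b
    by (intro H_inf_partial_deriv[OF op h] Basis_PairI that)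
  have part: "partial_deriv b (\<lambda>x. h (x, \<xi>) * u \<xi>) x = partial_deriv (b, 0) h (x, \<xi>) * u \<xi>"
    if "b \<in> Basis" "x \<in> X" "\<xi> \<in> \<Xi>" for b x \<xi>
    unfolding partial_deriv_mult_right[OF diff[OF that(2,3)]] partial_deriv_fst ..
  note facts = X x meas[OF h] meas[OF db] differentiable_mult[OF diff differentiable_const] part dom[OF h] dom[OF db]
  show "int_op \<Xi> h u differentiable at x"
    unfolding int_op_def
    by (rule differentiable_set_integral[where \<Psi>="\<lambda>b x \<xi>. partial_deriv (b, 0) h (x, \<xi>) * u \<xi>"]) (fact facts)+
  show "partial_deriv b (int_op \<Xi> h u) x = int_op \<Xi> (partial_deriv (b, 0) h) u x" if "b \<in> Basis"
    unfolding int_op_def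
    by (rule partial_deriv_set_integral[where \<Psi>="\<lambda>b x \<xi>. partial_deriv (b, 0) h (x, \<xi>) * u \<xi>"]) (fact facts that)+
qed

text \<open>Coinduction with u fixed and the kernel varying over \<open>H_inf\<close>, since a
  derivative merely replaces h by one of its derivatives.\<close>

lemma int_op_smooth:
  assumes h: "h \<in> H_inf (X \<times> \<Xi>)" and u: "u \<in> L2_on \<Xi>"
  shows "smooth_on X (int_op \<Xi> h u)"
proof (rule smooth_on_coinduct[where P="\<lambda>v. \<exists>h\<in>H_inf (X \<times> \<Xi>). v = int_op \<Xi> h u"])
  show "v differentiable_on X" if "\<exists>h\<in>H_inf (X \<times> \<Xi>). v = int_op \<Xi> h u" for v
    unfolding differentiable_on_eq_differentiable_at[OF X] using that int_op_differentiable[OF _ u] by blast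
  show "\<exists>g. (\<exists>h\<in>H_inf (X \<times> \<Xi>). g = int_op \<Xi> h u) \<and> (\<forall>x\<in>X. partial_deriv b v x = g x)"
    if v: "\<exists>h\<in>H_inf (X \<times> \<Xi>). v = int_op \<Xi> h u" and b: "b \<in> Basis" for v b
  proof -
    obtain h where h: "h \<in> H_inf (X \<times> \<Xi>)" "v = int_op \<Xi> h u"
      using v by blast
    have "partial_deriv (b, 0) h \<in> H_inf (X \<times> \<Xi>)"
      by (intro H_inf_partial_deriv h Basis_PairI b open_Times X \<Xi>)
    then show ?thesis
      using int_op_partial_deriv[OF h(1) u _ b] h(2) by blast
  qed
qed (use h X in auto)

lemma int_op_partial_derivs:
  assumes h: "h \<in> H_inf (X \<times> \<Xi>)" and u: "u \<in> L2_on \<Xi>" and "x \<in> X" "set w \<subseteq> Basis"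
  shows "partial_derivs w (int_op \<Xi> h u) x = int_op \<Xi> (partial_derivs (map (\<lambda>b. (b, 0)) w) h) u x"
  using assms(3,4)
proof (induction w arbitrary: x)
  case (Cons b w)
  let ?k = "partial_derivs (map (\<lambda>b. (b, 0)) w) h"
  have k: "?k \<in> H_inf (X \<times> \<Xi>)"
    using Cons.prems by (intro H_inf_partial_derivs open_Times X \<Xi> h) (auto intro: Basis_PairI)
  have "partial_deriv b (partial_derivs w (int_op \<Xi> h u)) x = partial_deriv b (int_op \<Xi> ?k u) x"
    using Cons by (intro partial_deriv_cong[OF X]) auto
  also have "\<dots> = int_op \<Xi> (partial_deriv (b, 0) ?k) u x"
    using Cons.prems by (intro int_op_partial_deriv k u) auto
  finally show ?case
    by simp
qed simp

text \<open>The Hilbert-Schmidt bound: Cauchy-Schwarz in \<xi> for each x, then integration over x,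
  where the norm of u is a constant factor and Tonelli assembles the norm of h.\<close>

lemma int_op_L2:
  assumes h: "h \<in> H_inf (X \<times> \<Xi>)" and u: "u \<in> L2_on \<Xi>"
  shows "int_op \<Xi> h u \<in> L2_on X" "L2_norm_on X (int_op \<Xi> h u) \<le> L2_norm_on (X \<times> \<Xi>) h * L2_norm_on \<Xi> u"
proof -
  have op: "open (X \<times> \<Xi>)"
    by (simp add: open_Times X \<Xi>)
  have hm: "set_borel_measurable lborel (X \<times> \<Xi>) h" and hL: "h \<in> L2_on (X \<times> \<Xi>)"
    using H_inf_measurable[OF h op] H_inf_L2[OF h op] .
  let ?k = "\<lambda>p. indicator (X \<times> \<Xi>) p *\<^sub>R h p"
  have [measurable]: "?k \<in> borel_measurable (lborel \<Otimes>\<^sub>M lborel)"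
    using hm by (simp add: set_borel_measurable_def lborel_prod)
  have "L2_sq X (int_op \<Xi> h u) \<le> (\<integral>\<^sup>+x. (\<integral>\<^sup>+\<xi>. ennreal ((norm (?k (x, \<xi>)))\<^sup>2) \<partial>lborel) * L2_sq \<Xi> u \<partial>lborel)"
    unfolding L2_sq_def[of X]
  proof (rule nn_integral_mono)
    fix x :: 'a
    show "ennreal ((norm (indicator X x *\<^sub>R int_op \<Xi> h u x))\<^sup>2) \<le> (\<integral>\<^sup>+\<xi>. ennreal ((norm (?k (x, \<xi>)))\<^sup>2) \<partial>lborel) * L2_sq \<Xi> u"
    proof (cases "x \<in> X")
      case True
      have "ennreal ((norm (int_op \<Xi> h u x))\<^sup>2) \<le> L2_sq \<Xi> (\<lambda>\<xi>. h (x, \<xi>)) * L2_sq \<Xi> u"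
        unfolding int_op_def using u True
        by (intro norm_set_integral_mult_le set_borel_measurable_Pair1[OF hm]) (auto simp: L2_on_iff)
      then show ?thesis
        using True by (simp add: L2_sq_def indicator_times)
    qed simp
  qed
  also have "\<dots> = L2_sq (X \<times> \<Xi>) h * L2_sq \<Xi> u"
    unfolding L2_sq_times_fst[OF hm] by (rule nn_integral_multc) measurable
  also have "\<dots> = ennreal ((L2_norm_on (X \<times> \<Xi>) h * L2_norm_on \<Xi> u)\<^sup>2)"
    by (simp add: L2_sq_eq[OF hL] L2_sq_eq[OF u] power_mult_distrib ennreal_mult)
  finally have le: "L2_sq X (int_op \<Xi> h u) \<le> ennreal ((L2_norm_on (X \<times> \<Xi>) h * L2_norm_on \<Xi> u)\<^sup>2)" .
  show "int_op \<Xi> h u \<in> L2_on X" "L2_norm_on X (int_op \<Xi> h u) \<le> L2_norm_on (X \<times> \<Xi>) h * L2_norm_on \<Xi> u"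
    using L2_onI[OF set_borel_measurable_smooth[OF X int_op_smooth[OF h u]] le]
    by (simp_all add: L2_norm_on_nonneg)
qed

text \<open>Each derivative of the result is again an integral operator, with a differentiated
  kernel, and obeys the Hilbert-Schmidt bound. The L2 norm of u is then weakened to
  \<open>H_norm m\<close>, to give the bound the symmetric shape that \<open>H_inf_bilinear\<close>
  expects.\<close>

lemma int_op_H_inf:
  assumes h: "h \<in> H_inf (X \<times> \<Xi>)" and u: "u \<in> H_inf \<Xi>"
  shows "int_op \<Xi> h u \<in> H_inf X"
    "H_norm m X (int_op \<Xi> h u) \<le>
      real (card (multi_indices m :: ('a \<Rightarrow> nat) set)) * (H_norm m (X \<times> \<Xi>) h * H_norm m \<Xi> u)"
proof -
  have op: "open (X \<times> \<Xi>)"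
    by (simp add: open_Times X \<Xi>)
  have uL: "u \<in> L2_on \<Xi>"
    using H_inf_L2[OF u \<Xi>] .
  have eq: "\<forall>x\<in>X. partial_derivs w (int_op \<Xi> h u) x = int_op \<Xi> (partial_derivs (map (\<lambda>b. (b, 0)) w) h) u x"
    if "set w \<subseteq> Basis" for w
    using int_op_partial_derivs[OF h uL _ that] by blast
  have W: "set (map (\<lambda>b. (b, 0)) w) \<subseteq> (Basis :: ('a \<times> 'c) set)" if "set w \<subseteq> Basis" for w
    using that by (auto intro: Basis_PairI)
  note L2 = int_op_L2[OF H_inf_partial_derivs[OF op h W] uL]
  have "partial_derivs w (int_op \<Xi> h u) \<in> L2_on X" if w: "set w \<subseteq> Basis" for w
    using L2(1)[OF w] L2_sq_cong[OF eq[OF w]]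
      set_borel_measurable_smooth[OF X smooth_on_partial_derivs[OF int_op_smooth[OF h uL] w]]
    by (simp add: L2_on_iff)
  then show "int_op \<Xi> h u \<in> H_inf X"
    using int_op_smooth[OF h uL] by (simp add: H_inf_iff[OF X])
  show "H_norm m X (int_op \<Xi> h u) \<le>
      real (card (multi_indices m :: ('a \<Rightarrow> nat) set)) * (H_norm m (X \<times> \<Xi>) h * H_norm m \<Xi> u)"
  proof (rule H_norm_le)
    fix w :: "'a list" assume w: "set w \<subseteq> Basis" "length w \<le> m"
    have "L2_norm_on X (partial_derivs w (int_op \<Xi> h u)) \<le>
        L2_norm_on (X \<times> \<Xi>) (partial_derivs (map (\<lambda>b. (b, 0)) w) h) * L2_norm_on \<Xi> u"
      using L2(2)[OF w(1)] L2_norm_on_cong[OF eq[OF w(1)]] by simp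
    also have "\<dots> \<le> H_norm m (X \<times> \<Xi>) h * H_norm m \<Xi> u"
      using w by (intro mult_mono L2_norm_partial_derivs_le[OF op h W] L2_norm_le_H_norm u \<Xi> L2_norm_on_nonneg H_norm_nonneg) auto
    finally show "L2_norm_on X (partial_derivs w (int_op \<Xi> h u)) \<le> H_norm m (X \<times> \<Xi>) h * H_norm m \<Xi> u" .
  qed
qed

section \<open>Composed kernels\<close>

context
  fixes Y :: "'b::euclidean_space set"
  assumes Y: "open Y"
begin

lemma comp_kernel_set_integrable:
  assumes "h1 \<in> H_inf (X \<times> \<Xi>)" "h2 \<in> H_inf (\<Xi> \<times> Y)" "x \<in> X" "y \<in> Y"
  shows "set_integrable lborel \<Xi> (\<lambda>\<xi>. h1 (x, \<xi>) * h2 (\<xi>, y))"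
proof -
  have "set_borel_measurable lborel \<Xi> (\<lambda>\<xi>. h1 (fst (x, y), \<xi>) * h2 (\<xi>, snd (x, y)))"
    using assms unfolding fst_conv snd_conv
    by (intro set_borel_measurable_mult
          set_borel_measurable_Pair1[OF H_inf_measurable[OF assms(1)]]
          set_borel_measurable_Pair2[OF H_inf_measurable[OF assms(2)]] open_Times X \<Xi> Y)
  from set_integrable_dominated[OF locally_L1_dominated_mult2[OF locally_L2_dominated_fst[OF X \<Xi> assms(1)]
      locally_L2_dominated_snd[OF \<Xi> Y assms(2)]] _ this] assms
  show ?thesis
    by simp
qed

lemma left_deriv_H_inf: "c \<in> Basis \<Longrightarrow> h \<in> H_inf (X \<times> \<Xi>) \<Longrightarrow> left_deriv c h \<in> H_inf (X \<times> \<Xi>)"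
  by (erule Basis_prod_cases)
     (auto simp: left_deriv_def intro!: H_inf_partial_deriv open_Times X \<Xi> Basis_PairI)

lemma right_deriv_H_inf: "c \<in> Basis \<Longrightarrow> h \<in> H_inf (\<Xi> \<times> Y) \<Longrightarrow> right_deriv c h \<in> H_inf (\<Xi> \<times> Y)"
  by (erule Basis_prod_cases)
     (auto simp: right_deriv_def intro!: H_inf_partial_deriv open_Times Y \<Xi> Basis_PairI)

text \<open>Differentiation under the integral with the pair (x, y) as parameter. The product rule
  reduces to one term, since a basis vector of the product moves x or y but not both.\<close>

lemma
  assumes h1: "h1 \<in> H_inf (X \<times> \<Xi>)" and h2: "h2 \<in> H_inf (\<Xi> \<times> Y)" and z: "z \<in> X \<times> Y"
  shows comp_kernel_differentiable: "comp_kernel \<Xi> h1 h2 differentiable at z"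
    and comp_kernel_partial_deriv: "c \<in> Basis \<Longrightarrow>
      partial_deriv c (comp_kernel \<Xi> h1 h2) z = comp_kernel \<Xi> (left_deriv c h1) (right_deriv c h2) z"
proof -
  have op: "open (X \<times> \<Xi>)" "open (\<Xi> \<times> Y)" "open (X \<times> Y)"
    by (simp_all add: open_Times X \<Xi> Y)
  have meas: "set_borel_measurable lborel \<Xi> (\<lambda>\<xi>. k1 (fst z, \<xi>) * k2 (\<xi>, snd z))"
    if "k1 \<in> H_inf (X \<times> \<Xi>)" "k2 \<in> H_inf (\<Xi> \<times> Y)" "z \<in> X \<times> Y" for k1 k2 z
    using that by (intro set_borel_measurable_mult
        set_borel_measurable_Pair1[OF H_inf_measurable[OF that(1) op(1)]]
        set_borel_measurable_Pair2[OF H_inf_measurable[OF that(2) op(2)]]) auto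
  have dom: "locally_L1_dominated (X \<times> Y) \<Xi> (\<lambda>z \<xi>. k1 (fst z, \<xi>) * k2 (\<xi>, snd z))"
    if "k1 \<in> H_inf (X \<times> \<Xi>)" "k2 \<in> H_inf (\<Xi> \<times> Y)" for k1 k2
    by (rule locally_L1_dominated_mult2[OF locally_L2_dominated_fst[OF X \<Xi> that(1)] locally_L2_dominated_snd[OF \<Xi> Y that(2)]])
  have diff1: "h1 differentiable at (fst z, \<xi>)" and diff2: "h2 differentiable at (\<xi>, snd z)"
    if "z \<in> X \<times> Y" "\<xi> \<in> \<Xi>" for z \<xi>
    using smooth_on_imp_differentiable[OF H_inf_smooth[OF h1] op(1)]
      smooth_on_imp_differentiable[OF H_inf_smooth[OF h2] op(2)] that by auto
  have diff: "(\<lambda>z. h1 (fst z, \<xi>) * h2 (\<xi>, snd z)) differentiable at z" if "z \<in> X \<times> Y" "\<xi> \<in> \<Xi>" for z \<xi>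
  proof (rule differentiable_mult)
    have "(\<lambda>z :: 'a \<times> 'b. (fst z, \<xi>)) differentiable at z"
      unfolding differentiable_def by (auto intro!: exI derivative_eq_intros)
    from differentiable_chain_at[OF this diff1[OF that]]
    show "(\<lambda>z. h1 (fst z, \<xi>)) differentiable at z"
      by (simp add: o_def)
    have "(\<lambda>z :: 'a \<times> 'b. (\<xi>, snd z)) differentiable at z"
      unfolding differentiable_def by (auto intro!: exI derivative_eq_intros)
    from differentiable_chain_at[OF this diff2[OF that]]
    show "(\<lambda>z. h2 (\<xi>, snd z)) differentiable at z"
      by (simp add: o_def)
  qed
  have part: "partial_deriv c (\<lambda>z. h1 (fst z, \<xi>) * h2 (\<xi>, snd z)) z = left_deriv c h1 (fst z, \<xi>) * right_deriv c h2 (\<xi>, snd z)"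
    if c: "c \<in> Basis" and z: "z \<in> X \<times> Y" and \<xi>: "\<xi> \<in> \<Xi>" for c z \<xi>
    using c
  proof (cases rule: Basis_prod_cases)
    case 1
    have "partial_deriv c (\<lambda>z. h1 (fst z, \<xi>) * h2 (\<xi>, snd z)) z = partial_deriv (fst c) (\<lambda>x. h1 (x, \<xi>) * h2 (\<xi>, snd z)) (fst z)"
      using 1 by (simp add: partial_deriv_def)
    also have "\<dots> = partial_deriv (fst c, 0) h1 (fst z, \<xi>) * h2 (\<xi>, snd z)"
      unfolding partial_deriv_mult_right[OF differentiable_Pair1[OF diff1[OF z \<xi>]]] partial_deriv_fst ..
    finally show ?thesis
      using 1 by (simp add: left_deriv_def right_deriv_def)
  next
    case 2
    \<comment> \<open>The factors are commuted, because the rule for a constant factor expects it on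
      the right.\<close>
    have "partial_deriv c (\<lambda>z. h1 (fst z, \<xi>) * h2 (\<xi>, snd z)) z = partial_deriv (snd c) (\<lambda>y. h2 (\<xi>, y) * h1 (fst z, \<xi>)) (snd z)"
      using 2 by (simp add: partial_deriv_def mult.commute)
    also have "\<dots> = partial_deriv (0, snd c) h2 (\<xi>, snd z) * h1 (fst z, \<xi>)"
      unfolding partial_deriv_mult_right[OF differentiable_Pair2[OF diff2[OF z \<xi>]]] partial_deriv_snd ..
    finally show ?thesis
      using 2 by (simp add: left_deriv_def right_deriv_def mult.commute)
  qed
  have meas': "set_borel_measurable lborel \<Xi> (\<lambda>\<xi>. left_deriv c h1 (fst z, \<xi>) * right_deriv c h2 (\<xi>, snd z))"
    if "c \<in> Basis" "z \<in> X \<times> Y" for c z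
    by (rule meas[OF left_deriv_H_inf[OF that(1) h1] right_deriv_H_inf[OF that(1) h2] that(2)])
  have dom': "locally_L1_dominated (X \<times> Y) \<Xi> (\<lambda>z \<xi>. left_deriv c h1 (fst z, \<xi>) * right_deriv c h2 (\<xi>, snd z))"
    if "c \<in> Basis" for c
    by (rule dom[OF left_deriv_H_inf[OF that h1] right_deriv_H_inf[OF that h2]])
  note facts = op(3) z meas[OF h1 h2] meas' diff part dom[OF h1 h2] dom'
  show "comp_kernel \<Xi> h1 h2 differentiable at z"
    unfolding comp_kernel_def
    by (rule differentiable_set_integral[where \<Psi>="\<lambda>c z \<xi>. left_deriv c h1 (fst z, \<xi>) * right_deriv c h2 (\<xi>, snd z)"])
       (fact facts)+
  show "partial_deriv c (comp_kernel \<Xi> h1 h2) z = comp_kernel \<Xi> (left_deriv c h1) (right_deriv c h2) z" if "c \<in> Basis"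
    unfolding comp_kernel_def
    by (rule partial_deriv_set_integral[where \<Psi>="\<lambda>c z \<xi>. left_deriv c h1 (fst z, \<xi>) * right_deriv c h2 (\<xi>, snd z)"])
       (fact facts that)+
qed

text \<open>Both kernels vary in the invariant, since derivatives in x act on the first and
  derivatives in y on the second.\<close>

lemma comp_kernel_smooth:
  assumes h1: "h1 \<in> H_inf (X \<times> \<Xi>)" and h2: "h2 \<in> H_inf (\<Xi> \<times> Y)"
  shows "smooth_on (X \<times> Y) (comp_kernel \<Xi> h1 h2)"
proof (rule smooth_on_coinduct[where P="\<lambda>v. \<exists>h1\<in>H_inf (X \<times> \<Xi>). \<exists>h2\<in>H_inf (\<Xi> \<times> Y). v = comp_kernel \<Xi> h1 h2"])
  have op: "open (X \<times> Y)"
    by (simp add: open_Times X Y)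
  show "v differentiable_on X \<times> Y" if "\<exists>h1\<in>H_inf (X \<times> \<Xi>). \<exists>h2\<in>H_inf (\<Xi> \<times> Y). v = comp_kernel \<Xi> h1 h2" for v
    unfolding differentiable_on_eq_differentiable_at[OF op] using that comp_kernel_differentiable by blast
  show "\<exists>g. (\<exists>h1\<in>H_inf (X \<times> \<Xi>). \<exists>h2\<in>H_inf (\<Xi> \<times> Y). g = comp_kernel \<Xi> h1 h2) \<and> (\<forall>z\<in>X \<times> Y. partial_deriv c v z = g z)"
    if v: "\<exists>h1\<in>H_inf (X \<times> \<Xi>). \<exists>h2\<in>H_inf (\<Xi> \<times> Y). v = comp_kernel \<Xi> h1 h2" and c: "c \<in> Basis" for v c
  proof -
    obtain h1 h2 where h: "h1 \<in> H_inf (X \<times> \<Xi>)" "h2 \<in> H_inf (\<Xi> \<times> Y)" "v = comp_kernel \<Xi> h1 h2"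
      using v by blast
    show ?thesis
      using comp_kernel_partial_deriv[OF h(1,2) _ c] left_deriv_H_inf[OF c h(1)] right_deriv_H_inf[OF c h(2)] h(3)
      by blast
  qed
qed (use h1 h2 X Y in \<open>auto simp: open_Times\<close>)

text \<open>The letters of a word are distributed: those in direction x go to the left kernel, those
  in direction y to the right one. Of the two parts only their lengths matter later, to stay within
  order m.\<close>

lemma comp_kernel_partial_derivs:
  assumes h1: "h1 \<in> H_inf (X \<times> \<Xi>)" and h2: "h2 \<in> H_inf (\<Xi> \<times> Y)" and "set w \<subseteq> Basis"
  shows "\<exists>w1 w2. set w1 \<subseteq> Basis \<and> set w2 \<subseteq> Basis \<and> length w1 \<le> length w \<and> length w2 \<le> length w \<and>
    (\<forall>z\<in>X \<times> Y. partial_derivs w (comp_kernel \<Xi> h1 h2) z = comp_kernel \<Xi> (partial_derivs w1 h1) (partial_derivs w2 h2) z)"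
  using assms(3)
proof (induction w)
  case Nil
  show ?case
    by (intro exI[of _ "[]"]) auto
next
  case (Cons c w)
  then obtain w1 w2 where w: "set w1 \<subseteq> Basis" "set w2 \<subseteq> Basis" "length w1 \<le> length w" "length w2 \<le> length w"
    and IH: "\<And>z. z \<in> X \<times> Y \<Longrightarrow> partial_derivs w (comp_kernel \<Xi> h1 h2) z = comp_kernel \<Xi> (partial_derivs w1 h1) (partial_derivs w2 h2) z"
    by auto
  have c: "c \<in> Basis"
    using Cons.prems by simp
  have op: "open (X \<times> \<Xi>)" "open (\<Xi> \<times> Y)" "open (X \<times> Y)"
    by (simp_all add: open_Times X \<Xi> Y)
  have eq: "partial_derivs (c # w) (comp_kernel \<Xi> h1 h2) z =
      comp_kernel \<Xi> (left_deriv c (partial_derivs w1 h1)) (right_deriv c (partial_derivs w2 h2)) z" if z: "z \<in> X \<times> Y" for z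
  proof -
    have "partial_deriv c (partial_derivs w (comp_kernel \<Xi> h1 h2)) z =
        partial_deriv c (comp_kernel \<Xi> (partial_derivs w1 h1) (partial_derivs w2 h2)) z"
      by (rule partial_deriv_cong[OF op(3) z IH])
    also have "\<dots> = comp_kernel \<Xi> (left_deriv c (partial_derivs w1 h1)) (right_deriv c (partial_derivs w2 h2)) z"
      by (intro comp_kernel_partial_deriv H_inf_partial_derivs op h1 h2 w z c)
    finally show ?thesis
      by simp
  qed
  from c show ?case
  proof (cases rule: Basis_prod_cases)
    case 1
    show ?thesis
      by (rule exI[of _ "(fst c, 0) # w1"], rule exI[of _ w2])
         (use eq w 1 in \<open>auto simp: left_deriv_def right_deriv_def intro: Basis_PairI\<close>)
  next
    case 2
    show ?thesis
      by (rule exI[of _ w1], rule exI[of _ "(0, snd c) # w2"])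
         (use eq w 2 in \<open>auto simp: left_deriv_def right_deriv_def intro: Basis_PairI\<close>)
  qed
qed

text \<open>Cauchy-Schwarz in \<xi> bounds the square at (x, y) by A(x) B(y), where A and B are the
  squared norms of the slices of the two kernels; the double integral then factors.\<close>

lemma comp_kernel_L2:
  assumes h1: "h1 \<in> H_inf (X \<times> \<Xi>)" and h2: "h2 \<in> H_inf (\<Xi> \<times> Y)"
  shows "comp_kernel \<Xi> h1 h2 \<in> L2_on (X \<times> Y)"
    "L2_norm_on (X \<times> Y) (comp_kernel \<Xi> h1 h2) \<le> L2_norm_on (X \<times> \<Xi>) h1 * L2_norm_on (\<Xi> \<times> Y) h2"
proof -
  have op: "open (X \<times> \<Xi>)" "open (\<Xi> \<times> Y)" "open (X \<times> Y)"
    by (simp_all add: open_Times X \<Xi> Y)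
  note hm = H_inf_measurable[OF h1 op(1)] H_inf_measurable[OF h2 op(2)]
  note hL = H_inf_L2[OF h1 op(1)] H_inf_L2[OF h2 op(2)]
  note km = set_borel_measurable_smooth[OF op(3) comp_kernel_smooth[OF h1 h2]]
  let ?k1 = "\<lambda>p. indicator (X \<times> \<Xi>) p *\<^sub>R h1 p" and ?k2 = "\<lambda>p. indicator (\<Xi> \<times> Y) p *\<^sub>R h2 p"
  have [measurable]: "?k1 \<in> borel_measurable (lborel \<Otimes>\<^sub>M lborel)" "?k2 \<in> borel_measurable (lborel \<Otimes>\<^sub>M lborel)"
    using hm by (simp_all add: set_borel_measurable_def lborel_prod)
  let ?A = "\<lambda>x. \<integral>\<^sup>+\<xi>. ennreal ((norm (?k1 (x, \<xi>)))\<^sup>2) \<partial>lborel" and ?B = "\<lambda>y. \<integral>\<^sup>+\<xi>. ennreal ((norm (?k2 (\<xi>, y)))\<^sup>2) \<partial>lborel"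
  have "L2_sq (X \<times> Y) (comp_kernel \<Xi> h1 h2) \<le> (\<integral>\<^sup>+x. \<integral>\<^sup>+y. ?A x * ?B y \<partial>lborel \<partial>lborel)"
    unfolding L2_sq_times_fst[OF km]
  proof (intro nn_integral_mono)
    fix x :: 'a and y :: 'b
    show "ennreal ((norm (indicator (X \<times> Y) (x, y) *\<^sub>R comp_kernel \<Xi> h1 h2 (x, y)))\<^sup>2) \<le> ?A x * ?B y"
    proof (cases "x \<in> X \<and> y \<in> Y")
      case True
      have "ennreal ((norm (comp_kernel \<Xi> h1 h2 (x, y)))\<^sup>2) \<le> L2_sq \<Xi> (\<lambda>\<xi>. h1 (x, \<xi>)) * L2_sq \<Xi> (\<lambda>\<xi>. h2 (\<xi>, y))"
        unfolding comp_kernel_def fst_conv snd_conv using True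
        by (intro norm_set_integral_mult_le set_borel_measurable_Pair1[OF hm(1)] set_borel_measurable_Pair2[OF hm(2)]) auto
      then show ?thesis
        using True by (simp add: L2_sq_def indicator_times)
    qed auto
  qed
  also have "\<dots> = (\<integral>\<^sup>+x. ?A x * (\<integral>\<^sup>+y. ?B y \<partial>lborel) \<partial>lborel)"
    by (intro nn_integral_cong nn_integral_cmult) measurable
  also have "\<dots> = L2_sq (X \<times> \<Xi>) h1 * L2_sq (\<Xi> \<times> Y) h2"
    unfolding L2_sq_times_fst[OF hm(1)] L2_sq_times_snd[OF hm(2)] by (rule nn_integral_multc) measurable
  also have "\<dots> = ennreal ((L2_norm_on (X \<times> \<Xi>) h1 * L2_norm_on (\<Xi> \<times> Y) h2)\<^sup>2)"
    by (simp add: L2_sq_eq[OF hL(1)] L2_sq_eq[OF hL(2)] power_mult_distrib ennreal_mult)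
  finally have le: "L2_sq (X \<times> Y) (comp_kernel \<Xi> h1 h2) \<le> ennreal ((L2_norm_on (X \<times> \<Xi>) h1 * L2_norm_on (\<Xi> \<times> Y) h2)\<^sup>2)" .
  show "comp_kernel \<Xi> h1 h2 \<in> L2_on (X \<times> Y)"
    "L2_norm_on (X \<times> Y) (comp_kernel \<Xi> h1 h2) \<le> L2_norm_on (X \<times> \<Xi>) h1 * L2_norm_on (\<Xi> \<times> Y) h2"
    using L2_onI[OF km le] by (simp_all add: L2_norm_on_nonneg)
qed

lemma comp_kernel_H_inf:
  assumes h1: "h1 \<in> H_inf (X \<times> \<Xi>)" and h2: "h2 \<in> H_inf (\<Xi> \<times> Y)"
  shows "comp_kernel \<Xi> h1 h2 \<in> H_inf (X \<times> Y)"
    "H_norm m (X \<times> Y) (comp_kernel \<Xi> h1 h2) \<le>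
      real (card (multi_indices m :: ('a \<times> 'b \<Rightarrow> nat) set)) * (H_norm m (X \<times> \<Xi>) h1 * H_norm m (\<Xi> \<times> Y) h2)"
proof -
  have op: "open (X \<times> \<Xi>)" "open (\<Xi> \<times> Y)" "open (X \<times> Y)"
    by (simp_all add: open_Times X \<Xi> Y)
  have main: "partial_derivs w (comp_kernel \<Xi> h1 h2) \<in> L2_on (X \<times> Y) \<and>
      (length w \<le> m \<longrightarrow> L2_norm_on (X \<times> Y) (partial_derivs w (comp_kernel \<Xi> h1 h2)) \<le>
        H_norm m (X \<times> \<Xi>) h1 * H_norm m (\<Xi> \<times> Y) h2)" if w: "set w \<subseteq> Basis" for w
  proof -
    obtain w1 w2 where ww: "set w1 \<subseteq> Basis" "set w2 \<subseteq> Basis" "length w1 \<le> length w" "length w2 \<le> length w"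
      and eq: "\<forall>z\<in>X \<times> Y. partial_derivs w (comp_kernel \<Xi> h1 h2) z = comp_kernel \<Xi> (partial_derivs w1 h1) (partial_derivs w2 h2) z"
      using comp_kernel_partial_derivs[OF h1 h2 w] by auto
    note L2 = comp_kernel_L2[OF H_inf_partial_derivs[OF op(1) h1 ww(1)] H_inf_partial_derivs[OF op(2) h2 ww(2)]]
    have "partial_derivs w (comp_kernel \<Xi> h1 h2) \<in> L2_on (X \<times> Y)"
      using L2(1) L2_sq_cong[OF eq]
        set_borel_measurable_smooth[OF op(3) smooth_on_partial_derivs[OF comp_kernel_smooth[OF h1 h2] w]]
      by (simp add: L2_on_iff)
    moreover have "L2_norm_on (X \<times> Y) (partial_derivs w (comp_kernel \<Xi> h1 h2)) \<le>
        H_norm m (X \<times> \<Xi>) h1 * H_norm m (\<Xi> \<times> Y) h2" if m: "length w \<le> m"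
    proof -
      have "L2_norm_on (X \<times> Y) (partial_derivs w (comp_kernel \<Xi> h1 h2)) \<le>
          L2_norm_on (X \<times> \<Xi>) (partial_derivs w1 h1) * L2_norm_on (\<Xi> \<times> Y) (partial_derivs w2 h2)"
        using L2(2) L2_norm_on_cong[OF eq] by simp
      also have "\<dots> \<le> H_norm m (X \<times> \<Xi>) h1 * H_norm m (\<Xi> \<times> Y) h2"
        using ww m
        by (intro mult_mono L2_norm_partial_derivs_le op h1 h2 L2_norm_on_nonneg H_norm_nonneg) auto
      finally show ?thesis .
    qed
    ultimately show ?thesis
      by blast
  qed
  show "comp_kernel \<Xi> h1 h2 \<in> H_inf (X \<times> Y)"
    using comp_kernel_smooth[OF h1 h2] main by (simp add: H_inf_iff[OF op(3)])
  show "H_norm m (X \<times> Y) (comp_kernel \<Xi> h1 h2) \<le>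
      real (card (multi_indices m :: ('a \<times> 'b \<Rightarrow> nat) set)) * (H_norm m (X \<times> \<Xi>) h1 * H_norm m (\<Xi> \<times> Y) h2)"
    using main by (intro H_norm_le) blast
qed

text \<open>Fubini for a(\<xi>) v(y) k(\<xi>, y) with x fixed, all three functions being extended by
  zero. Absolute integrability follows from Cauchy-Schwarz on the product space: the tensor product
  of a and v is square integrable, and so is k.\<close>

lemma int_op_int_op:
  assumes h1: "h1 \<in> H_inf (X \<times> \<Xi>)" and h2: "h2 \<in> H_inf (\<Xi> \<times> Y)" and u: "u \<in> L2_on Y" and x: "x \<in> X"
  shows "int_op \<Xi> h1 (int_op Y h2 u) x = int_op Y (comp_kernel \<Xi> h1 h2) u x"
proof -
  have op: "open (X \<times> \<Xi>)" "open (\<Xi> \<times> Y)" "open (X \<times> Y)"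
    by (simp_all add: open_Times X \<Xi> Y)
  define a where "a \<xi> = indicator \<Xi> \<xi> *\<^sub>R h1 (x, \<xi>)" for \<xi>
  define v where "v y = indicator Y y *\<^sub>R u y" for y
  define k where "k p = indicator (\<Xi> \<times> Y) p *\<^sub>R h2 p" for p
  have am [measurable]: "a \<in> borel_measurable lborel"
    unfolding a_def using set_borel_measurable_Pair1[OF H_inf_measurable[OF h1 op(1)] x]
    by (simp add: set_borel_measurable_def)
  have vm [measurable]: "v \<in> borel_measurable lborel"
    unfolding v_def using u by (simp add: L2_on_iff set_borel_measurable_def)
  have km: "k \<in> borel_measurable lborel"
    unfolding k_def using H_inf_measurable[OF h2 op(2)] by (simp add: set_borel_measurable_def)
  \<comment> \<open>The slice at this particular x must be square integrable. Tonelli would give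
    this for almost every x only; the local domination gives it for all.\<close>
  have a_fin: "(\<integral>\<^sup>+\<xi>. ennreal ((norm (a \<xi>))\<^sup>2) \<partial>lborel) < \<infinity>"
  proof -
    obtain U G where *: "x \<in> U" "(\<integral>\<^sup>+\<xi>. ennreal ((G \<xi>)\<^sup>2) \<partial>lborel) < \<infinity>"
      "AE \<xi> in lborel. \<forall>x\<in>U. norm (indicator \<Xi> \<xi> *\<^sub>R h1 (x, \<xi>)) \<le> G \<xi>"
      using locally_L2_dominated_fst[OF X \<Xi> h1] x unfolding locally_L2_dominated_def by blast
    have "(\<integral>\<^sup>+\<xi>. ennreal ((norm (a \<xi>))\<^sup>2) \<partial>lborel) \<le> (\<integral>\<^sup>+\<xi>. ennreal ((G \<xi>)\<^sup>2) \<partial>lborel)"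
    proof (rule nn_integral_mono_AE)
      show "AE \<xi> in lborel. ennreal ((norm (a \<xi>))\<^sup>2) \<le> ennreal ((G \<xi>)\<^sup>2)"
        using *(3)
      proof eventually_elim
        fix \<xi> assume "\<forall>x\<in>U. norm (indicator \<Xi> \<xi> *\<^sub>R h1 (x, \<xi>)) \<le> G \<xi>"
        then have "norm (a \<xi>) \<le> G \<xi>"
          using *(1) by (simp only: a_def)
        then show "ennreal ((norm (a \<xi>))\<^sup>2) \<le> ennreal ((G \<xi>)\<^sup>2)"
          by (intro ennreal_leI power_mono norm_ge_zero)
      qed
    qed
    then show ?thesis
      using *(2) by (rule le_less_trans)
  qed
  have v_fin: "(\<integral>\<^sup>+y. ennreal ((norm (v y))\<^sup>2) \<partial>lborel) < \<infinity>"
    using u by (simp only: v_def L2_on_iff L2_sq_def)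
  have k_fin: "(\<integral>\<^sup>+p. ennreal ((norm (k p))\<^sup>2) \<partial>lborel) < \<infinity>"
    using H_inf_L2[OF h2 op(2)] by (simp only: k_def L2_on_iff L2_sq_def)
  have av_m: "(\<lambda>p. a (fst p) * v (snd p)) \<in> borel_measurable (lborel \<Otimes>\<^sub>M lborel)"
    by measurable
  have "(\<integral>\<^sup>+p. ennreal ((norm (a (fst p) * v (snd p)))\<^sup>2) \<partial>(lborel \<Otimes>\<^sub>M lborel)) =
      (\<integral>\<^sup>+\<xi>. \<integral>\<^sup>+y. ennreal ((norm (a \<xi>))\<^sup>2) * ennreal ((norm (v y))\<^sup>2) \<partial>lborel \<partial>lborel)"
    by (subst lborel.nn_integral_fst[symmetric]) (auto simp: norm_mult power_mult_distrib ennreal_mult)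
  also have "\<dots> = (\<integral>\<^sup>+\<xi>. ennreal ((norm (a \<xi>))\<^sup>2) * (\<integral>\<^sup>+y. ennreal ((norm (v y))\<^sup>2) \<partial>lborel) \<partial>lborel)"
    by (intro nn_integral_cong nn_integral_cmult) measurable
  also have "\<dots> = (\<integral>\<^sup>+\<xi>. ennreal ((norm (a \<xi>))\<^sup>2) \<partial>lborel) * (\<integral>\<^sup>+y. ennreal ((norm (v y))\<^sup>2) \<partial>lborel)"
    by (rule nn_integral_multc) measurable
  also have "\<dots> < \<infinity>"
    using a_fin v_fin by (simp add: ennreal_mult_less_top)
  finally have av_fin: "(\<integral>\<^sup>+p. ennreal ((norm (a (fst p) * v (snd p)))\<^sup>2) \<partial>lborel) < \<infinity>"
    by (simp only: lborel_prod)
  have "integrable lborel (\<lambda>p. (a (fst p) * v (snd p)) * k p)"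
    by (rule integrable_mult_L2[OF _ km av_fin k_fin]) (use av_m in \<open>simp add: lborel_prod\<close>)
  also have "(\<lambda>p. (a (fst p) * v (snd p)) * k p) = case_prod (\<lambda>\<xi> y. (a \<xi> * v y) * k (\<xi>, y))"
    by auto
  finally have int: "integrable (lborel \<Otimes>\<^sub>M lborel) (case_prod (\<lambda>\<xi> y. (a \<xi> * v y) * k (\<xi>, y)))"
    by (simp only: lborel_prod)
  have "int_op \<Xi> h1 (int_op Y h2 u) x = (LINT \<xi>|lborel. LINT y|lborel. (a \<xi> * v y) * k (\<xi>, y))"
    unfolding int_op_def set_lebesgue_integral_def
  proof (rule Bochner_Integration.integral_cong)
    fix \<xi> :: 'c
    have "indicator \<Xi> \<xi> *\<^sub>R (h1 (x, \<xi>) * (LINT y|lborel. indicator Y y *\<^sub>R (h2 (\<xi>, y) * u y))) =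
        a \<xi> * (LINT y|lborel. indicator Y y *\<^sub>R (h2 (\<xi>, y) * u y))"
      by (simp add: a_def)
    \<comment> \<open>Bochner integrals commute with scalar factors unconditionally, so the
      integrability of the inner integrand for this \<xi> is not at issue.\<close>
    also have "\<dots> = (LINT y|lborel. a \<xi> * (indicator Y y *\<^sub>R (h2 (\<xi>, y) * u y)))"
      by (rule integral_mult_right_zero[symmetric])
    also have "\<dots> = (LINT y|lborel. (a \<xi> * v y) * k (\<xi>, y))"
      by (intro Bochner_Integration.integral_cong) (auto simp: a_def v_def k_def indicator_def)
    finally show "indicator \<Xi> \<xi> *\<^sub>R (h1 (x, \<xi>) * (LINT y|lborel. indicator Y y *\<^sub>R (h2 (\<xi>, y) * u y))) =
        (LINT y|lborel. (a \<xi> * v y) * k (\<xi>, y))" .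
  qed simp
  also have "\<dots> = (LINT y|lborel. LINT \<xi>|lborel. (a \<xi> * v y) * k (\<xi>, y))"
    using lborel_pair.Fubini_integral[OF int] by simp
  also have "\<dots> = int_op Y (comp_kernel \<Xi> h1 h2) u x"
    unfolding int_op_def set_lebesgue_integral_def
  proof (rule Bochner_Integration.integral_cong)
    fix y :: 'b
    have "(LINT \<xi>|lborel. (a \<xi> * v y) * k (\<xi>, y)) =
        (LINT \<xi>|lborel. v y * (indicator \<Xi> \<xi> *\<^sub>R (h1 (x, \<xi>) * h2 (\<xi>, y))))"
      by (intro Bochner_Integration.integral_cong) (auto simp: a_def v_def k_def indicator_def)
    also have "\<dots> = v y * (LINT \<xi>|lborel. indicator \<Xi> \<xi> *\<^sub>R (h1 (x, \<xi>) * h2 (\<xi>, y)))"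
      by (rule integral_mult_right_zero)
    also have "\<dots> = indicator Y y *\<^sub>R (comp_kernel \<Xi> h1 h2 (x, y) * u y)"
      by (simp add: v_def comp_kernel_def set_lebesgue_integral_def mult.commute)
    finally show "(LINT \<xi>|lborel. (a \<xi> * v y) * k (\<xi>, y)) = indicator Y y *\<^sub>R (comp_kernel \<Xi> h1 h2 (x, y) * u y)" .
  qed simp
  finally show ?thesis .
qed

end

end

section \<open>Moderate and negligible nets\<close>

lemma eventually_Ioc_at_right: "eventually (\<lambda>\<epsilon>::real. \<epsilon> \<in> {0<..1}) (at_right 0)"
  by (rule eventually_at_rightI[of 0 1]) auto

text \<open>Nets are constrained on (0,1] only, which is a right neighbourhood of 0. The sign of c
  is unknown, hence the absolute value taken in the proof.\<close>

lemma bigo_H_norm_le: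
  fixes p :: "real \<Rightarrow> real"
  assumes "\<And>\<epsilon>. \<epsilon> \<in> {0<..1} \<Longrightarrow> H_norm m \<Omega> (u \<epsilon>) \<le> c * p \<epsilon>" and "p \<in> O[at_right 0](q)"
  shows "(\<lambda>\<epsilon>. H_norm m \<Omega> (u \<epsilon>)) \<in> O[at_right 0](q)"
proof (rule landau_o.big_trans[OF _ assms(2)])
  show "(\<lambda>\<epsilon>. H_norm m \<Omega> (u \<epsilon>)) \<in> O[at_right 0](p)"
  proof (rule bigoI[where c="\<bar>c\<bar>"])
    show "\<forall>\<^sub>F \<epsilon> in at_right 0. norm (H_norm m \<Omega> (u \<epsilon>)) \<le> \<bar>c\<bar> * norm (p \<epsilon>)"
      using eventually_Ioc_at_right
    proof eventually_elim
      fix \<epsilon> :: real assume "\<epsilon> \<in> {0<..1}"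
      from assms(1)[OF this] have "H_norm m \<Omega> (u \<epsilon>) \<le> \<bar>c * p \<epsilon>\<bar>"
        by linarith
      then show "norm (H_norm m \<Omega> (u \<epsilon>)) \<le> \<bar>c\<bar> * norm (p \<epsilon>)"
        by (simp add: H_norm_nonneg abs_mult)
    qed
  qed
qed

lemma I_L2_cong:
  assumes "open \<Omega>" "\<And>\<epsilon> x. \<epsilon> \<in> {0<..1} \<Longrightarrow> x \<in> \<Omega> \<Longrightarrow> u \<epsilon> x = v \<epsilon> x" "u \<in> I_L2 \<Omega>"
  shows "v \<in> I_L2 \<Omega>"
  unfolding I_L2_def
proof (intro CollectI conjI ballI allI)
  show "v \<epsilon> \<in> H_inf \<Omega>" if \<epsilon>: "\<epsilon> \<in> {0<..1}" for \<epsilon>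
    by (rule H_inf_cong[OF assms(1) assms(2)[OF \<epsilon>]]) (use assms(3) \<epsilon> in \<open>auto simp: I_L2_def\<close>)
  fix m n
  have "H_norm m \<Omega> (v \<epsilon>) \<le> 1 * H_norm m \<Omega> (u \<epsilon>)" if "\<epsilon> \<in> {0<..1}" for \<epsilon>
  proof -
    have "H_norm m \<Omega> (u \<epsilon>) = H_norm m \<Omega> (v \<epsilon>)"
      by (rule H_norm_cong[OF assms(1) assms(2)[OF that]])
    then show ?thesis
      by simp
  qed
  then show "(\<lambda>\<epsilon>. H_norm m \<Omega> (v \<epsilon>)) \<in> O[at_right 0](\<lambda>\<epsilon>. \<epsilon> ^ n)"
    by (rule bigo_H_norm_le) (use assms(3) in \<open>auto simp: I_L2_def\<close>)
qed

lemma I_L2_diff: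
  fixes u v :: "'a::euclidean_space net"
  assumes "open \<Omega>" "u \<in> I_L2 \<Omega>" "v \<in> I_L2 \<Omega>"
  shows "(\<lambda>\<epsilon> x. u \<epsilon> x - v \<epsilon> x) \<in> I_L2 \<Omega>"
  unfolding I_L2_def
proof (intro CollectI conjI ballI allI)
  have uv: "u \<epsilon> \<in> H_inf \<Omega>" "v \<epsilon> \<in> H_inf \<Omega>" if "\<epsilon> \<in> {0<..1}" for \<epsilon>
    using assms that by (auto simp: I_L2_def)
  show "(\<lambda>x. u \<epsilon> x - v \<epsilon> x) \<in> H_inf \<Omega>" if "\<epsilon> \<in> {0<..1}" for \<epsilon>
    by (rule H_inf_diff(1)[OF assms(1) uv[OF that]])
  fix m n
  have "H_norm m \<Omega> (\<lambda>x. u \<epsilon> x - v \<epsilon> x) \<le>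
      (real (card (multi_indices m :: ('a \<Rightarrow> nat) set)) * 2) * (H_norm m \<Omega> (u \<epsilon>) + H_norm m \<Omega> (v \<epsilon>))" if "\<epsilon> \<in> {0<..1}" for \<epsilon>
    using H_inf_diff(2)[OF assms(1) uv[OF that], of m] by (simp only: mult.assoc)
  then show "(\<lambda>\<epsilon>. H_norm m \<Omega> (\<lambda>x. u \<epsilon> x - v \<epsilon> x)) \<in> O[at_right 0](\<lambda>\<epsilon>. \<epsilon> ^ n)"
    by (rule bigo_H_norm_le) (use assms(2,3) in \<open>auto simp: I_L2_def intro!: sum_in_bigo\<close>)
qed

lemma H_norm_zero: "H_norm m \<Omega> (\<lambda>x. 0) = 0"
proof -
  have "partial_derivs w (\<lambda>x. 0) = (\<lambda>x. 0)" for w :: "'a list"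
    by (induction w) (auto simp: partial_deriv_def)
  then show ?thesis
    by (simp add: H_norm_def multi_deriv_eq L2_norm_on_def set_lebesgue_integral_def)
qed

text \<open>The zero function lies in \<open>H_inf\<close> as the difference of the member at
  \<epsilon> = 1 of the given net with itself.\<close>

lemma I_L2_zero:
  assumes "open \<Omega>" "u \<in> E_L2 \<Omega>"
  shows "(\<lambda>\<epsilon> x. 0) \<in> I_L2 \<Omega>"
proof -
  have "(\<lambda>x. u 1 x - u 1 x) \<in> H_inf \<Omega>"
    using assms by (intro H_inf_diff) (auto simp: E_L2_def)
  then show ?thesis
    by (simp add: I_L2_def H_norm_zero)
qed

text \<open>Closure under differences suffices: symmetry comes from 0 - (u - v), transitivity from
  (u - v) - (w - v).\<close>

lemma equiv_L2_rel:
  assumes "open \<Omega>"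
  shows "equiv (E_L2 \<Omega>) (L2_rel \<Omega>)"
proof -
  have sym: "(v, u) \<in> L2_rel \<Omega>" if "(u, v) \<in> L2_rel \<Omega>" for u v
  proof -
    have uv: "u \<in> E_L2 \<Omega>" "v \<in> E_L2 \<Omega>" "(\<lambda>\<epsilon> x. u \<epsilon> x - v \<epsilon> x) \<in> I_L2 \<Omega>"
      using that by (auto simp: L2_rel_def)
    from I_L2_diff[OF assms I_L2_zero[OF assms uv(1)] uv(3)]
    have "(\<lambda>\<epsilon> x. 0 - (u \<epsilon> x - v \<epsilon> x)) \<in> I_L2 \<Omega>" .
    then show ?thesis
      using uv by (simp add: L2_rel_def)
  qed
  have trans: "(u, w) \<in> L2_rel \<Omega>" if "(u, v) \<in> L2_rel \<Omega>" "(v, w) \<in> L2_rel \<Omega>" for u v w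
  proof -
    have "(\<lambda>\<epsilon> x. u \<epsilon> x - v \<epsilon> x) \<in> I_L2 \<Omega>" "(\<lambda>\<epsilon> x. w \<epsilon> x - v \<epsilon> x) \<in> I_L2 \<Omega>"
      using that(1) sym[OF that(2)] by (auto simp: L2_rel_def)
    from I_L2_diff[OF assms this] have "(\<lambda>\<epsilon> x. (u \<epsilon> x - v \<epsilon> x) - (w \<epsilon> x - v \<epsilon> x)) \<in> I_L2 \<Omega>" .
    then show ?thesis
      using that by (simp add: L2_rel_def)
  qed
  have refl: "(u, u) \<in> L2_rel \<Omega>" if "u \<in> E_L2 \<Omega>" for u
    using that I_L2_zero[OF assms that] by (simp add: L2_rel_def)
  show ?thesis
  proof (rule equivI)
    show "L2_rel \<Omega> \<subseteq> E_L2 \<Omega> \<times> E_L2 \<Omega>"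
      by (auto simp: L2_rel_def)
  qed (rule refl_onI[OF refl] symI[OF sym] transI[OF trans]; assumption)+
qed

text \<open>This is how pointwise identities, valid on \<Omega> for \<epsilon> in (0,1], become
  equalities of classes: there the difference agrees with the zero net.\<close>

lemma L2_rel_cong:
  assumes "open \<Omega>" "u \<in> E_L2 \<Omega>" "v \<in> E_L2 \<Omega>"
    and "\<And>\<epsilon> x. \<epsilon> \<in> {0<..1} \<Longrightarrow> x \<in> \<Omega> \<Longrightarrow> u \<epsilon> x = v \<epsilon> x"
  shows "(u, v) \<in> L2_rel \<Omega>"
proof -
  have "(\<lambda>\<epsilon> x. u \<epsilon> x - v \<epsilon> x) \<in> I_L2 \<Omega>"
    by (rule I_L2_cong[OF assms(1) _ I_L2_zero[OF assms(1,2)]]) (use assms(4) in auto)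
  then show ?thesis
    using assms by (simp add: L2_rel_def)
qed

section \<open>Classes and their representatives\<close>

lemma Cl_eqI: "open \<Omega> \<Longrightarrow> (u, v) \<in> L2_rel \<Omega> \<Longrightarrow> Cl \<Omega> u = Cl \<Omega> v"
  unfolding Cl_def by (rule equiv_class_eq[OF equiv_L2_rel])

lemma Cl_self: "open \<Omega> \<Longrightarrow> u \<in> E_L2 \<Omega> \<Longrightarrow> u \<in> Cl \<Omega> u"
  unfolding Cl_def by (rule equiv_class_self[OF equiv_L2_rel])

lemma Cl_in_G_L2: "u \<in> E_L2 \<Omega> \<Longrightarrow> Cl \<Omega> u \<in> G_L2 \<Omega>"
  unfolding Cl_def G_L2_def by (rule quotientI)

lemma G_L2_rel:
  assumes "open \<Omega>" "U \<in> G_L2 \<Omega>" "u \<in> U" "v \<in> U"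
  shows "(u, v) \<in> L2_rel \<Omega>"
  using quotient_eq_iff[OF equiv_L2_rel[OF assms(1)], of U U u v] assms by (simp add: G_L2_def)

lemma G_L2_nonempty: "open \<Omega> \<Longrightarrow> U \<in> G_L2 \<Omega> \<Longrightarrow> \<exists>u. u \<in> U"
  unfolding G_L2_def using in_quotient_imp_non_empty[OF equiv_L2_rel] by blast

lemma E_L2_H_inf: "u \<in> E_L2 \<Omega> \<Longrightarrow> \<epsilon> \<in> {0<..1} \<Longrightarrow> u \<epsilon> \<in> H_inf \<Omega>"
  by (simp add: E_L2_def)

lemma E_L2_bigo:
  assumes "u \<in> E_L2 \<Omega>"
  obtains n :: nat where "(\<lambda>\<epsilon>. H_norm m \<Omega> (u \<epsilon>)) \<in> O[at_right 0](\<lambda>\<epsilon>. \<epsilon> powi (- int n))"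
  using assms unfolding E_L2_def by blast

text \<open>What the operator and the composition of kernels have in common, so that the passage to
  classes is proved once. \<open>bound\<close> has the same order m in all three norms and a
  constant uniform in f and g. \<open>diff\<close> is the bilinear identity T f g - T f' g' = T (f -
  f') g + T f' (g - g'), written with a minus sign because only differences are available.\<close>

locale H_inf_bilinear =
  fixes A :: "'a::euclidean_space set" and B :: "'b::euclidean_space set" and C :: "'c::euclidean_space set"
    and T :: "('a \<Rightarrow> complex) \<Rightarrow> ('b \<Rightarrow> complex) \<Rightarrow> 'c \<Rightarrow> complex"
  assumes open_C: "open C" and open_A: "open A" and open_B: "open B"
    and closed: "\<And>f g. f \<in> H_inf A \<Longrightarrow> g \<in> H_inf B \<Longrightarrow> T f g \<in> H_inf C"
    and bound: "\<And>m. \<exists>c. \<forall>f\<in>H_inf A. \<forall>g\<in>H_inf B. H_norm m C (T f g) \<le> c * (H_norm m A f * H_norm m B g)"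
    and diff: "\<And>f f' g g' x. f \<in> H_inf A \<Longrightarrow> f' \<in> H_inf A \<Longrightarrow> g \<in> H_inf B \<Longrightarrow> g' \<in> H_inf B \<Longrightarrow> x \<in> C \<Longrightarrow>
      T f g x - T f' g' x = T (\<lambda>x. f x - f' x) g x - T f' (\<lambda>x. g' x - g x) x"
begin

lemma net_closed:
  assumes "\<forall>\<epsilon>\<in>{0<..1}. u \<epsilon> \<in> H_inf A" "\<forall>\<epsilon>\<in>{0<..1}. v \<epsilon> \<in> H_inf B"
  shows "\<forall>\<epsilon>\<in>{0<..1}. T (u \<epsilon>) (v \<epsilon>) \<in> H_inf C"
  using assms closed by blast

text \<open>General gauges p, q and r let one estimate serve both the product of moderate nets and
  the product of a moderate with a negligible one.\<close>

lemma net_bound: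
  fixes p q r :: "real \<Rightarrow> real"
  assumes u: "\<forall>\<epsilon>\<in>{0<..1}. u \<epsilon> \<in> H_inf A" and v: "\<forall>\<epsilon>\<in>{0<..1}. v \<epsilon> \<in> H_inf B"
    and "(\<lambda>\<epsilon>. H_norm m A (u \<epsilon>)) \<in> O[at_right 0](p)" "(\<lambda>\<epsilon>. H_norm m B (v \<epsilon>)) \<in> O[at_right 0](q)"
    and "\<And>\<epsilon>. \<epsilon> \<in> {0<..1} \<Longrightarrow> p \<epsilon> * q \<epsilon> = r \<epsilon>"
  shows "(\<lambda>\<epsilon>. H_norm m C (T (u \<epsilon>) (v \<epsilon>))) \<in> O[at_right 0](r)"
proof -
  obtain c where c: "\<forall>f\<in>H_inf A. \<forall>g\<in>H_inf B. H_norm m C (T f g) \<le> c * (H_norm m A f * H_norm m B g)"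
    using bound by blast
  have "(\<lambda>\<epsilon>. H_norm m A (u \<epsilon>) * H_norm m B (v \<epsilon>)) \<in> O[at_right 0](\<lambda>\<epsilon>. p \<epsilon> * q \<epsilon>)"
    using assms(3,4) by (rule landau_o.big.mult)
  also have "O[at_right 0](\<lambda>\<epsilon>. p \<epsilon> * q \<epsilon>) = O[at_right 0](r)"
  proof (rule landau_o.big.cong)
    show "\<forall>\<^sub>F \<epsilon> in at_right 0. p \<epsilon> * q \<epsilon> = r \<epsilon>"
      using eventually_Ioc_at_right by eventually_elim (rule assms(5))
  qed
  finally have "(\<lambda>\<epsilon>. H_norm m A (u \<epsilon>) * H_norm m B (v \<epsilon>)) \<in> O[at_right 0](r)" .
  moreover have "H_norm m C (T (u \<epsilon>) (v \<epsilon>)) \<le> c * (H_norm m A (u \<epsilon>) * H_norm m B (v \<epsilon>))" if "\<epsilon> \<in> {0<..1}" for \<epsilon>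
    using c u v that by blast
  ultimately show ?thesis
    by (rule bigo_H_norm_le[rotated])
qed

lemma E_L2_mult:
  assumes u: "u \<in> E_L2 A" and v: "v \<in> E_L2 B"
  shows "(\<lambda>\<epsilon>. T (u \<epsilon>) (v \<epsilon>)) \<in> E_L2 C"
  unfolding E_L2_def
proof (intro CollectI conjI allI)
  have uv: "\<forall>\<epsilon>\<in>{0<..1}. u \<epsilon> \<in> H_inf A" "\<forall>\<epsilon>\<in>{0<..1}. v \<epsilon> \<in> H_inf B"
    using u v by (auto simp: E_L2_def)
  show "\<forall>\<epsilon>\<in>{0<..1}. T (u \<epsilon>) (v \<epsilon>) \<in> H_inf C"
    by (rule net_closed[OF uv])
  fix m
  obtain k where k: "(\<lambda>\<epsilon>. H_norm m A (u \<epsilon>)) \<in> O[at_right 0](\<lambda>\<epsilon>. \<epsilon> powi (- int k))"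
    by (rule E_L2_bigo[OF u])
  obtain l where l: "(\<lambda>\<epsilon>. H_norm m B (v \<epsilon>)) \<in> O[at_right 0](\<lambda>\<epsilon>. \<epsilon> powi (- int l))"
    by (rule E_L2_bigo[OF v])
  \<comment> \<open>The orders of growth add.\<close>
  have "(\<lambda>\<epsilon>. H_norm m C (T (u \<epsilon>) (v \<epsilon>))) \<in> O[at_right 0](\<lambda>\<epsilon>. \<epsilon> powi (- int (k + l)))"
  proof (rule net_bound[OF uv k l])
    fix \<epsilon> :: real assume "\<epsilon> \<in> {0<..1}"
    then show "\<epsilon> powi (- int k) * \<epsilon> powi (- int l) = \<epsilon> powi (- int (k + l))"
      using power_int_add[of \<epsilon> "- int k" "- int l"] by simp
  qed
  then show "\<exists>n. (\<lambda>\<epsilon>. H_norm m C (T (u \<epsilon>) (v \<epsilon>))) \<in> O[at_right 0](\<lambda>\<epsilon>. \<epsilon> powi (- int n))"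
    by blast
qed

lemma I_L2_mult_left:
  assumes u: "u \<in> I_L2 A" and v: "v \<in> E_L2 B"
  shows "(\<lambda>\<epsilon>. T (u \<epsilon>) (v \<epsilon>)) \<in> I_L2 C"
  unfolding I_L2_def
proof (intro CollectI conjI allI)
  have uv: "\<forall>\<epsilon>\<in>{0<..1}. u \<epsilon> \<in> H_inf A" "\<forall>\<epsilon>\<in>{0<..1}. v \<epsilon> \<in> H_inf B"
    using u v by (auto simp: E_L2_def I_L2_def)
  show "\<forall>\<epsilon>\<in>{0<..1}. T (u \<epsilon>) (v \<epsilon>) \<in> H_inf C"
    by (rule net_closed[OF uv])
  fix m n
  obtain l where l: "(\<lambda>\<epsilon>. H_norm m B (v \<epsilon>)) \<in> O[at_right 0](\<lambda>\<epsilon>. \<epsilon> powi (- int l))"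
    by (rule E_L2_bigo[OF v])
  \<comment> \<open>The exponent n + l is chosen to absorb the growth of v, which is of order
    \<epsilon> to the power -l.\<close>
  have "(\<lambda>\<epsilon>. H_norm m A (u \<epsilon>)) \<in> O[at_right 0](\<lambda>\<epsilon>. \<epsilon> ^ (n + l))"
    using u by (simp add: I_L2_def)
  then show "(\<lambda>\<epsilon>. H_norm m C (T (u \<epsilon>) (v \<epsilon>))) \<in> O[at_right 0](\<lambda>\<epsilon>. \<epsilon> ^ n)"
    by (rule net_bound[OF uv _ l]) (simp add: power_int_minus power_add)
qed

lemma I_L2_mult_right:
  assumes u: "u \<in> E_L2 A" and v: "v \<in> I_L2 B"
  shows "(\<lambda>\<epsilon>. T (u \<epsilon>) (v \<epsilon>)) \<in> I_L2 C"
  unfolding I_L2_def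
proof (intro CollectI conjI allI)
  have uv: "\<forall>\<epsilon>\<in>{0<..1}. u \<epsilon> \<in> H_inf A" "\<forall>\<epsilon>\<in>{0<..1}. v \<epsilon> \<in> H_inf B"
    using u v by (auto simp: E_L2_def I_L2_def)
  show "\<forall>\<epsilon>\<in>{0<..1}. T (u \<epsilon>) (v \<epsilon>) \<in> H_inf C"
    by (rule net_closed[OF uv])
  fix m n
  obtain k where k: "(\<lambda>\<epsilon>. H_norm m A (u \<epsilon>)) \<in> O[at_right 0](\<lambda>\<epsilon>. \<epsilon> powi (- int k))"
    by (rule E_L2_bigo[OF u])
  have "(\<lambda>\<epsilon>. H_norm m B (v \<epsilon>)) \<in> O[at_right 0](\<lambda>\<epsilon>. \<epsilon> ^ (n + k))"
    using v by (simp add: I_L2_def)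
  then show "(\<lambda>\<epsilon>. H_norm m C (T (u \<epsilon>) (v \<epsilon>))) \<in> O[at_right 0](\<lambda>\<epsilon>. \<epsilon> ^ n)"
    by (rule net_bound[OF uv k]) (simp add: power_int_minus power_add)
qed

text \<open>One factor is changed at a time: \<open>diff\<close> writes the difference as two terms,
  each with one negligible and one moderate argument.\<close>

lemma L2_rel_mult:
  assumes "(u, u') \<in> L2_rel A" "(v, v') \<in> L2_rel B"
  shows "((\<lambda>\<epsilon>. T (u \<epsilon>) (v \<epsilon>)), (\<lambda>\<epsilon>. T (u' \<epsilon>) (v' \<epsilon>))) \<in> L2_rel C"
proof -
  have E: "u \<in> E_L2 A" "u' \<in> E_L2 A" "v \<in> E_L2 B" "v' \<in> E_L2 B"
    using assms by (auto simp: L2_rel_def)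
  \<comment> \<open>In \<open>diff\<close> the right argument occurs as v' - v, hence the reversed
    relation.\<close>
  have "(v', v) \<in> L2_rel B"
    using equiv_L2_rel[OF open_B] assms(2) by (auto elim!: equivE dest: symD)
  then have I: "(\<lambda>\<epsilon> x. u \<epsilon> x - u' \<epsilon> x) \<in> I_L2 A" "(\<lambda>\<epsilon> x. v' \<epsilon> x - v \<epsilon> x) \<in> I_L2 B"
    using assms by (auto simp: L2_rel_def)
  have "(\<lambda>\<epsilon> x. T (\<lambda>x. u \<epsilon> x - u' \<epsilon> x) (v \<epsilon>) x - T (u' \<epsilon>) (\<lambda>x. v' \<epsilon> x - v \<epsilon> x) x) \<in> I_L2 C"
    by (rule I_L2_diff[OF open_C I_L2_mult_left[OF I(1) E(3)] I_L2_mult_right[OF E(2) I(2)]])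
  then have "(\<lambda>\<epsilon> x. T (u \<epsilon>) (v \<epsilon>) x - T (u' \<epsilon>) (v' \<epsilon>) x) \<in> I_L2 C"
    by (rule I_L2_cong[OF open_C, rotated]) (use diff E[THEN E_L2_H_inf] in auto)
  then show ?thesis
    using E E_L2_mult by (simp add: L2_rel_def)
qed

end

text \<open>The bilinear identity compares three integrals, all of which exist by integrability at
  every x; closure and bounds are those of \<open>int_op_H_inf\<close>.\<close>

lemma int_op_bilinear:
  fixes X :: "'a::euclidean_space set" and \<Xi> :: "'c::euclidean_space set"
  assumes X: "open X" and \<Xi>: "open \<Xi>"
  shows "H_inf_bilinear (X \<times> \<Xi>) \<Xi> X (int_op \<Xi>)"
proof
  show "open X" "open \<Xi>" "open (X \<times> \<Xi>)"
    using assms by (auto simp: open_Times)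
  fix h h' :: "'a \<times> 'c \<Rightarrow> complex" and u u' :: "'c \<Rightarrow> complex" and x
  show "int_op \<Xi> h u \<in> H_inf X" if "h \<in> H_inf (X \<times> \<Xi>)" "u \<in> H_inf \<Xi>"
    using int_op_H_inf(1)[OF assms that] .
  show "\<exists>c. \<forall>h\<in>H_inf (X \<times> \<Xi>). \<forall>u\<in>H_inf \<Xi>.
      H_norm m X (int_op \<Xi> h u) \<le> c * (H_norm m (X \<times> \<Xi>) h * H_norm m \<Xi> u)" for m
    using int_op_H_inf(2)[OF assms] by blast
  assume h: "h \<in> H_inf (X \<times> \<Xi>)" "h' \<in> H_inf (X \<times> \<Xi>)" and u: "u \<in> H_inf \<Xi>" "u' \<in> H_inf \<Xi>" and x: "x \<in> X"
  note int = int_op_set_integrable[OF X \<Xi> _ _ x]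
  note uL = u[THEN H_inf_L2, OF \<Xi>]
  note ints = int[OF h(1) uL(1)] int[OF h(2) uL(1)] int[OF h(2) uL(2)]
  have "int_op \<Xi> (\<lambda>x. h x - h' x) u x = int_op \<Xi> h u x - int_op \<Xi> h' u x"
    unfolding int_op_def left_diff_distrib using ints by (intro set_integral_diff)
  moreover have "int_op \<Xi> h' (\<lambda>x. u' x - u x) x = int_op \<Xi> h' u' x - int_op \<Xi> h' u x"
    unfolding int_op_def right_diff_distrib using ints by (intro set_integral_diff)
  ultimately show "int_op \<Xi> h u x - int_op \<Xi> h' u' x =
      int_op \<Xi> (\<lambda>x. h x - h' x) u x - int_op \<Xi> h' (\<lambda>x. u' x - u x) x"
    by simp
qed

lemma comp_kernel_bilinear:
  fixes X :: "'a::euclidean_space set" and \<Xi> :: "'c::euclidean_space set" and Y :: "'b::euclidean_space set"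
  assumes X: "open X" and \<Xi>: "open \<Xi>" and Y: "open Y"
  shows "H_inf_bilinear (X \<times> \<Xi>) (\<Xi> \<times> Y) (X \<times> Y) (comp_kernel \<Xi>)"
proof
  show "open (X \<times> Y)" "open (\<Xi> \<times> Y)" "open (X \<times> \<Xi>)"
    using assms by (auto simp: open_Times)
  fix h h' :: "'a \<times> 'c \<Rightarrow> complex" and k k' :: "'c \<times> 'b \<Rightarrow> complex" and z
  show "comp_kernel \<Xi> h k \<in> H_inf (X \<times> Y)" if "h \<in> H_inf (X \<times> \<Xi>)" "k \<in> H_inf (\<Xi> \<times> Y)"
    using comp_kernel_H_inf(1)[OF assms that] .
  show "\<exists>c. \<forall>h\<in>H_inf (X \<times> \<Xi>). \<forall>k\<in>H_inf (\<Xi> \<times> Y).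
      H_norm m (X \<times> Y) (comp_kernel \<Xi> h k) \<le> c * (H_norm m (X \<times> \<Xi>) h * H_norm m (\<Xi> \<times> Y) k)" for m
    using comp_kernel_H_inf(2)[OF assms] by blast
  assume h: "h \<in> H_inf (X \<times> \<Xi>)" "h' \<in> H_inf (X \<times> \<Xi>)" and k: "k \<in> H_inf (\<Xi> \<times> Y)" "k' \<in> H_inf (\<Xi> \<times> Y)" and z: "z \<in> X \<times> Y"
  then have z': "fst z \<in> X" "snd z \<in> Y"
    by auto
  note int = comp_kernel_set_integrable[OF assms _ _ z']
  note ints = int[OF h(1) k(1)] int[OF h(2) k(1)] int[OF h(2) k(2)]
  have "comp_kernel \<Xi> (\<lambda>x. h x - h' x) k z = comp_kernel \<Xi> h k z - comp_kernel \<Xi> h' k z"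
    unfolding comp_kernel_def left_diff_distrib using ints by (intro set_integral_diff)
  moreover have "comp_kernel \<Xi> h' (\<lambda>x. k' x - k x) z = comp_kernel \<Xi> h' k' z - comp_kernel \<Xi> h' k z"
    unfolding comp_kernel_def right_diff_distrib using ints by (intro set_integral_diff)
  ultimately show "comp_kernel \<Xi> h k z - comp_kernel \<Xi> h' k' z =
      comp_kernel \<Xi> (\<lambda>x. h x - h' x) k z - comp_kernel \<Xi> h' (\<lambda>x. k' x - k x) z"
    by simp
qed

text \<open>By \<open>L2_rel_mult\<close> all terms of the union over representatives are the same
  class, so the union collapses to the class of any chosen pair. This is the independence of
  representatives.\<close>

lemma gen_int_op_eq:
  assumes X: "open X" and Y: "open Y" and H: "H \<in> G_L2 (X \<times> Y)" and f: "f \<in> G_L2 Y" and h: "h \<in> H" and u: "u \<in> f"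
  shows "gen_int_op X Y H f = Cl X (\<lambda>\<epsilon>. int_op Y (h \<epsilon>) (u \<epsilon>))"
proof -
  interpret H_inf_bilinear "X \<times> Y" Y X "int_op Y"
    by (rule int_op_bilinear[OF X Y])
  have "Cl X (\<lambda>\<epsilon> x. LINT y:Y|lborel. h' \<epsilon> (x, y) * u' \<epsilon> y) = Cl X (\<lambda>\<epsilon>. int_op Y (h \<epsilon>) (u \<epsilon>))"
    if "h' \<in> H" "u' \<in> f" for h' u'
    using Cl_eqI[OF X L2_rel_mult[OF G_L2_rel[OF open_A H that(1) h] G_L2_rel[OF Y f that(2) u]]]
    by (simp add: int_op_def)
  then show ?thesis
    using f h u by (auto simp: gen_int_op_def)
qed

lemma G_L2_E_L2: "open \<Omega> \<Longrightarrow> U \<in> G_L2 \<Omega> \<Longrightarrow> u \<in> U \<Longrightarrow> u \<in> E_L2 \<Omega>"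
  using G_L2_rel[of \<Omega> U u u] by (auto simp: L2_rel_def)

theorem proposition36:
  fixes X :: "(real ^ 'm) set" and Y :: "(real ^ 'n) set" and \<Xi> :: "(real ^ 'p) set"
    and H1 :: "((real ^ 'm) \<times> (real ^ 'p)) net set"
    and H2 :: "((real ^ 'p) \<times> (real ^ 'n)) net set"
  assumes "open X" and "open Y" and "open \<Xi>"
    and "H1 \<in> G_L2 (X \<times> \<Xi>)" and "H2 \<in> G_L2 (\<Xi> \<times> Y)"
  shows "compose (G_L2 Y) (gen_int_op X \<Xi> H1) (gen_int_op \<Xi> Y H2) \<in> G_L2 Y \<rightarrow>\<^sub>E G_L2 X \<and>
    (\<exists>L\<in>G_L2 (X \<times> Y).
       (\<forall>h1\<in>H1. \<forall>h2\<in>H2.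
          L = Cl (X \<times> Y) (\<lambda>\<epsilon> (x, y). LINT \<xi>:\<Xi>|lborel. h1 \<epsilon> (x, \<xi>) * h2 \<epsilon> (\<xi>, y))) \<and>
       compose (G_L2 Y) (gen_int_op X \<Xi> H1) (gen_int_op \<Xi> Y H2) = gen_int_op X Y L)"
proof -
  note X = \<open>open X\<close> and Y = \<open>open Y\<close> and \<Xi> = \<open>open \<Xi>\<close>
  have op: "open (X \<times> \<Xi>)" "open (\<Xi> \<times> Y)" "open (X \<times> Y)"
    by (simp_all add: open_Times X Y \<Xi>)
  interpret ker: H_inf_bilinear "X \<times> \<Xi>" "\<Xi> \<times> Y" "X \<times> Y" "comp_kernel \<Xi>"
    by (rule comp_kernel_bilinear[OF X \<Xi> Y])
  interpret op1: H_inf_bilinear "X \<times> \<Xi>" \<Xi> X "int_op \<Xi>"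
    by (rule int_op_bilinear[OF X \<Xi>])
  interpret op2: H_inf_bilinear "\<Xi> \<times> Y" Y \<Xi> "int_op Y"
    by (rule int_op_bilinear[OF \<Xi> Y])
  interpret op3: H_inf_bilinear "X \<times> Y" Y X "int_op Y"
    by (rule int_op_bilinear[OF X Y])
  \<comment> \<open>Classes are nonempty. The representatives fixed here define the kernel, and
    \<open>Cl_l\<close> shows that every other choice gives the same class.\<close>
  obtain h1 h2 where h1: "h1 \<in> H1" and h2: "h2 \<in> H2"
    using G_L2_nonempty[OF op(1) assms(4)] G_L2_nonempty[OF op(2) assms(5)] by blast
  have E: "h1 \<in> E_L2 (X \<times> \<Xi>)" "h2 \<in> E_L2 (\<Xi> \<times> Y)"
    using G_L2_E_L2[OF op(1) assms(4) h1] G_L2_E_L2[OF op(2) assms(5) h2] .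
  define l where "l \<epsilon> = comp_kernel \<Xi> (h1 \<epsilon>) (h2 \<epsilon>)" for \<epsilon>
  have l: "l \<in> E_L2 (X \<times> Y)"
    unfolding l_def by (rule ker.E_L2_mult[OF E])
  have L: "Cl (X \<times> Y) l \<in> G_L2 (X \<times> Y)"
    by (rule Cl_in_G_L2[OF l])
  have Cl_l: "Cl (X \<times> Y) l = Cl (X \<times> Y) (\<lambda>\<epsilon> (x, y). LINT \<xi>:\<Xi>|lborel. k1 \<epsilon> (x, \<xi>) * k2 \<epsilon> (\<xi>, y))"
    if "k1 \<in> H1" "k2 \<in> H2" for k1 k2
  proof -
    have "Cl (X \<times> Y) l = Cl (X \<times> Y) (\<lambda>\<epsilon>. comp_kernel \<Xi> (k1 \<epsilon>) (k2 \<epsilon>))"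
      unfolding l_def
      by (rule Cl_eqI[OF op(3) ker.L2_rel_mult[OF G_L2_rel[OF op(1) assms(4) h1 that(1)] G_L2_rel[OF op(2) assms(5) h2 that(2)]]])
    also have "(\<lambda>\<epsilon>. comp_kernel \<Xi> (k1 \<epsilon>) (k2 \<epsilon>)) = (\<lambda>\<epsilon> (x, y). LINT \<xi>:\<Xi>|lborel. k1 \<epsilon> (x, \<xi>) * k2 \<epsilon> (\<xi>, y))"
      by (auto simp: comp_kernel_def fun_eq_iff)
    finally show ?thesis .
  qed
  have eq: "gen_int_op X \<Xi> H1 (gen_int_op \<Xi> Y H2 f) = gen_int_op X Y (Cl (X \<times> Y) l) f \<and>
      gen_int_op X \<Xi> H1 (gen_int_op \<Xi> Y H2 f) \<in> G_L2 X" if f: "f \<in> G_L2 Y" for f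
  proof -
    obtain u where u: "u \<in> f"
      using G_L2_nonempty[OF Y f] by blast
    have uE: "u \<in> E_L2 Y"
      by (rule G_L2_E_L2[OF Y f u])
    \<comment> \<open>A representative of the inner image; being moderate it lies in its own class,
      so the outer operator may be evaluated on it.\<close>
    define v where "v \<epsilon> = int_op Y (h2 \<epsilon>) (u \<epsilon>)" for \<epsilon>
    have v: "v \<in> E_L2 \<Xi>"
      unfolding v_def by (rule op2.E_L2_mult[OF E(2) uE])
    have w1: "(\<lambda>\<epsilon>. int_op \<Xi> (h1 \<epsilon>) (v \<epsilon>)) \<in> E_L2 X"
      by (rule op1.E_L2_mult[OF E(1) v])
    have w2: "(\<lambda>\<epsilon>. int_op Y (l \<epsilon>) (u \<epsilon>)) \<in> E_L2 X"
      by (rule op3.E_L2_mult[OF l uE])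
    have "gen_int_op \<Xi> Y H2 f = Cl \<Xi> v"
      unfolding v_def by (rule gen_int_op_eq[OF \<Xi> Y assms(5) f h2 u])
    then have 1: "gen_int_op X \<Xi> H1 (gen_int_op \<Xi> Y H2 f) = Cl X (\<lambda>\<epsilon>. int_op \<Xi> (h1 \<epsilon>) (v \<epsilon>))"
      using gen_int_op_eq[OF X \<Xi> assms(4) Cl_in_G_L2[OF v] h1 Cl_self[OF \<Xi> v]] by simp
    have 2: "gen_int_op X Y (Cl (X \<times> Y) l) f = Cl X (\<lambda>\<epsilon>. int_op Y (l \<epsilon>) (u \<epsilon>))"
      by (rule gen_int_op_eq[OF X Y L f Cl_self[OF op(3) l] u])
    \<comment> \<open>Fubini gives equality at every x in X for each \<epsilon> in (0,1], which is
      more than equality of classes.\<close>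
    have "Cl X (\<lambda>\<epsilon>. int_op \<Xi> (h1 \<epsilon>) (v \<epsilon>)) = Cl X (\<lambda>\<epsilon>. int_op Y (l \<epsilon>) (u \<epsilon>))"
    proof (rule Cl_eqI[OF X L2_rel_cong[OF X w1 w2]])
      fix \<epsilon> :: real and x assume \<epsilon>: "\<epsilon> \<in> {0<..1}" and x: "x \<in> X"
      show "int_op \<Xi> (h1 \<epsilon>) (v \<epsilon>) x = int_op Y (l \<epsilon>) (u \<epsilon>) x"
        unfolding v_def l_def
        by (rule int_op_int_op[OF X \<Xi> Y E_L2_H_inf[OF E(1) \<epsilon>] E_L2_H_inf[OF E(2) \<epsilon>] H_inf_L2[OF E_L2_H_inf[OF uE \<epsilon>] Y] x])
    qed
    then show ?thesis
      using 1 2 Cl_in_G_L2[OF w1] by simp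
  qed
  have "compose (G_L2 Y) (gen_int_op X \<Xi> H1) (gen_int_op \<Xi> Y H2) = gen_int_op X Y (Cl (X \<times> Y) l)"
  proof
    fix f
    show "compose (G_L2 Y) (gen_int_op X \<Xi> H1) (gen_int_op \<Xi> Y H2) f = gen_int_op X Y (Cl (X \<times> Y) l) f"
    \<comment> \<open>Off \<open>G_L2 Y\<close> both sides are \<open>undefined\<close>, as both
      functions are extensional.\<close>
    proof (cases "f \<in> G_L2 Y")
      case True
      then show ?thesis
        using eq by (simp add: compose_def)
    next
      case False
      then show ?thesis
        by (simp add: compose_def gen_int_op_def)
    qed
  qed
  moreover have "compose (G_L2 Y) (gen_int_op X \<Xi> H1) (gen_int_op \<Xi> Y H2) \<in> G_L2 Y \<rightarrow>\<^sub>E G_L2 X"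
    using eq by (auto simp: compose_def)
  ultimately show ?thesis
    using L Cl_l by blast
qed

end
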